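(* Let $G$ be a (topologically) finitely generated profinite group that is Fitting-free and let $c$ be a non-negative integer. If $G$ is JNN$_c$F, then it is the inverse limit of a family $G_n$, for $n\geq 0$, of profinite groups with respect to surjective continuous homomorphisms $\rho_n\colon G_{n+1}\to G_n$ with the following properties: for every $n\geq 0$, $G_n$ has an open normal subgroup $P_n$ such that, upon setting $Q_n=P_{n+1}\rho_n$ (the image of $P_{n+1}$ under $\rho_n$), for every $n \geq 0$, (i) $G_n$ is virtually class-$c$ nilpotent; (ii) $P_n>Q_n$; (iii) $\gamma_{c+1}(P_n)>\mathrm{M}_{G_n}(\gamma_{c+1}(P_n))\geq\ker\rho_{n-1}\geq\gamma_{c+1}(Q_n)>1$ (where for $n=0$ the undefined term $\ker\rho_{n-1}$ is omitted from the chain); (iv) if $N$ is an open normal subgroup of $G_n$, then either $\gamma_{c+1}(N)\leq P_n$ or $\gamma_{c+1}(Q_n)\leq\gamma_{c+1}(N)$. Conversely, suppose, for some integer $d\geq 1$, that $G=\varprojlim G_n$ is an inverse limit of a countable family $G_n$ ($n\geq0$) of $d$-generator profinite groups with respect to surjective continuous homomorphisms $\rho_n\colon G_{n+1}\to G_n$ such that $G$ is Fitting-free and there are open normal subgroups $P_n$ of $G_n$ for which, with $Q_n=P_{n+1}\rho_n$, conditions (i)–(iv) hold for every $n\ge 0$. For each $n$, let $\pi_n\colon G\to G_n$ be the natural map associated to the inverse limit. Then if $K$ is a non-trivial closed normal subgroup of $G$, there exists $n_0\geq 0$ such that $\ker\pi_{n_0}\leq K$. In particular, $G$ is JNN$_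c$F.
   Context: For closed subgroups $K,L$ of a profinite group, $[K,L]$ denotes the closed subgroup generated by all commutators $[x,y]$ with $x\in K$, $y\in L$. The lower central series is $\gamma_1(K)=K$, $\gamma_{i+1}(K)=[\gamma_i(K),K]$. A profinite group is virtually class-$c$ nilpotent if it has a subgroup $H$ of finite index (equivalently, an open subgroup $H$) with $\gamma_{c+1}(H)=1$. A profinite group $G$ is JNN$_c$F if $G$ is not virtually class-$c$ nilpotent but $G/N$ is virtually class-$c$ nilpotent for every non-trivial closed normal subgroup $N$ of $G$. A profinite group is Fitting-free if it has no non-trivial abelian closed normal subgroup. "$d$-generator" means topologically generated by $d$ elements. For a non-trivial closed normal subgroup $A$ of a profinite group $G$, $\mathrm{M}_G(A)$ denotes the intersection of all maximal $G$-invariant open subgroups of $A$ (i.e. of all maximal members of the set of proper open subgroups of $A$ that are normal in $G$). Maps are written on the right. *)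

theory Defs
  imports "HOL-Analysis.Analysis" "HOL-Algebra.Coset"
begin

section \<open>Profinite groups\<close>

locale topological_group = group G for G (structure) +
  fixes T
  assumes topspace_eq_carrier: "topspace T = carrier G"
    and continuous_mult: "continuous_map (prod_topology T T) T (\<lambda>(x, y). x \<otimes> y)"
    and continuous_inv: "continuous_map T T (\<lambda>x. inv x)"

definition totally_disconnected_space :: "'a topology \<Rightarrow> bool" where
  "totally_disconnected_space T \<longleftrightarrow> (\<forall>S. connectedin T S \<longrightarrow> (\<exists>x. S \<subseteq> {x}))"

locale profinite_group = topological_group +
  assumes compact: "compact_space T"
    and Hausdorff: "Hausdorff_space T"
    and totally_disconnected: "totally_disconnected_space T"

definition quotient_topology :: "('a, 'm) monoid_scheme \<Rightarrow> 'a topology \<Rightarrow> 'a set \<Rightarrow> 'a set topology" where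
  "quotient_topology G T N = topology (\<lambda>U. U \<subseteq> carrier (G Mod N) \<and> openin T (\<Union>U))"

text \<open>The predicate above is a topology because the cosets of a subgroup are pairwise disjoint;
  it is the quotient topology of the coset map, since the preimage of \<open>U\<close> is \<open>\<Union>U\<close>.\<close>

lemma (in group) openin_quotient_topology:
  assumes "subgroup N G"
  shows "openin (quotient_topology G T N) U \<longleftrightarrow> U \<subseteq> carrier (G Mod N) \<and> openin T (\<Union>U)"
proof -
  let ?P = "\<lambda>U. U \<subseteq> carrier (G Mod N) \<and> openin T (\<Union>U)"
  have Int: "\<Union>(U \<inter> V) = \<Union>U \<inter> \<Union>V"
    if "U \<subseteq> carrier (G Mod N)" "V \<subseteq> carrier (G Mod N)" for U V
  proof -
    have "C = D" if "C \<in> U" "D \<in> V" "x \<in> C" "x \<in> D" for C D x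
      using rcos_disjoint[OF assms] that \<open>U \<subseteq> _\<close> \<open>V \<subseteq> _\<close>
      unfolding FactGroup_def pairwise_def disjnt_def by fastforce
    then show ?thesis by blast
  qed
  have "istopology ?P"
    unfolding istopology_def
  proof (intro conjI allI impI)
    fix U V assume UV: "?P U" "?P V"
    then show "U \<inter> V \<subseteq> carrier (G Mod N)" by blast
    show "openin T (\<Union>(U \<inter> V))" using UV by (simp only: Int openin_Int)
  next
    fix \<K> assume K: "\<forall>K\<in>\<K>. ?P K"
    then show "\<Union>\<K> \<subseteq> carrier (G Mod N)" by blast
    have "\<Union>(\<Union>\<K>) = \<Union>(Union ` \<K>)" by blast
    then show "openin T (\<Union>(\<Union>\<K>))" using K by auto
  qed
  then show ?thesis by (simp add: quotient_topology_def)
qed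

lemma (in topological_group) quotient_map_quotient_topology:
  assumes "subgroup N G"
  shows "quotient_map T (quotient_topology G T N) (\<lambda>x. N #> x)"
proof -
  have top: "topspace (quotient_topology G T N) = carrier (G Mod N)"
  proof -
    have "\<Union>(carrier (G Mod N)) = topspace T"
      using rcosets_part_G[OF assms] by (simp add: FactGroup_def topspace_eq_carrier)
    then have "openin (quotient_topology G T N) (carrier (G Mod N))"
      by (simp add: openin_quotient_topology[OF assms])
    then show ?thesis
      by (metis openin_quotient_topology[OF assms] openin_subset openin_topspace subset_antisym)
  qed
  have "{x \<in> carrier G. N #> x \<in> U} = \<Union>U" if U: "U \<subseteq> carrier (G Mod N)" for U
  proof (intro subset_antisym subsetI)
    fix x assume "x \<in> {x \<in> carrier G. N #> x \<in> U}"
    then show "x \<in> \<Union>U" using rcos_self[OF _ assms] by blast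
  next
    fix x assume "x \<in> \<Union>U"
    then obtain C where C: "C \<in> U" "x \<in> C" by blast
    then obtain a where a: "a \<in> carrier G" "C = N #> a"
      using U unfolding carrier_FactGroup by blast
    then have "N #> x = C" "x \<in> carrier G"
      using C repr_independence[OF _ _ assms] r_coset_subset_G[OF subgroup.subset[OF assms] a(1)]
      by auto
    then show "x \<in> {x \<in> carrier G. N #> x \<in> U}" using C by simp
  qed
  then show ?thesis
    unfolding quotient_map_def
    by (auto simp: top topspace_eq_carrier carrier_FactGroup openin_quotient_topology[OF assms])
qed

definition closed_generate :: "('a, 'm) monoid_scheme \<Rightarrow> 'a topology \<Rightarrow> 'a set \<Rightarrow> 'a set" where
  "closed_generate G T S = \<Inter>{H. subgroup H G \<and> closedin T H \<and> S \<subseteq> H}"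

text \<open>The entries of the list may repeat, so this is ``generated by at most \<open>d\<close> elements''.\<close>

definition d_generator :: "nat \<Rightarrow> ('a, 'm) monoid_scheme \<Rightarrow> 'a topology \<Rightarrow> bool" where
  "d_generator d G T \<longleftrightarrow>
     (\<exists>xs. length xs = d \<and> set xs \<subseteq> carrier G \<and> closed_generate G T (set xs) = carrier G)"

definition fin_generated :: "('a, 'm) monoid_scheme \<Rightarrow> 'a topology \<Rightarrow> bool" where
  "fin_generated G T \<longleftrightarrow> (\<exists>d. d_generator d G T)"

definition closed_commutator ::
    "('a, 'm) monoid_scheme \<Rightarrow> 'a topology \<Rightarrow> 'a set \<Rightarrow> 'a set \<Rightarrow> 'a set" where
  "closed_commutator G T K L =
     closed_generate G T
       {inv\<^bsub>G\<^esub> x \<otimes>\<^bsub>G\<^esub> inv\<^bsub>G\<^esub> y \<otimes>\<^bsub>G\<^esub> x \<otimes>\<^bsub>G\<^esub> y | x y. x \<in> K \<and> y \<in> L}"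

text \<open>Indexed from \<open>1\<close>; the value at \<open>0\<close> is a dummy.\<close>

fun lower_central ::
    "('a, 'm) monoid_scheme \<Rightarrow> 'a topology \<Rightarrow> nat \<Rightarrow> 'a set \<Rightarrow> 'a set" where
  "lower_central G T 0 K = K"
| "lower_central G T (Suc 0) K = K"
| "lower_central G T (Suc (Suc i)) K = closed_commutator G T (lower_central G T (Suc i) K) K"

definition virtually_nilpotent :: "nat \<Rightarrow> ('a, 'm) monoid_scheme \<Rightarrow> 'a topology \<Rightarrow> bool" where
  "virtually_nilpotent c G T \<longleftrightarrow>
     (\<exists>H. subgroup H G \<and> openin T H \<and> lower_central G T (c + 1) H = {\<one>\<^bsub>G\<^esub>})"

definition JNNF :: "nat \<Rightarrow> ('a, 'm) monoid_scheme \<Rightarrow> 'a topology \<Rightarrow> bool" where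
  "JNNF c G T \<longleftrightarrow> profinite_group G T \<and> \<not> virtually_nilpotent c G T \<and>
     (\<forall>N. N \<lhd> G \<and> closedin T N \<and> N \<noteq> {\<one>\<^bsub>G\<^esub>} \<longrightarrow>
        virtually_nilpotent c (G Mod N) (quotient_topology G T N))"

definition fitting_free :: "('a, 'm) monoid_scheme \<Rightarrow> 'a topology \<Rightarrow> bool" where
  "fitting_free G T \<longleftrightarrow>
     (\<forall>N. N \<lhd> G \<and> closedin T N \<and> comm_group (G\<lparr>carrier := N\<rparr>) \<longrightarrow> N = {\<one>\<^bsub>G\<^esub>})"

definition invariant_open_subgroups ::
    "('a, 'm) monoid_scheme \<Rightarrow> 'a topology \<Rightarrow> 'a set \<Rightarrow> 'a set set" where
  "invariant_open_subgroups G T A = {B. B \<subset> A \<and> openin (subtopology T A) B \<and> B \<lhd> G}"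

text \<open>The intersection is taken inside \<open>A\<close>; this only matters for \<open>A\<close> trivial, where there is
  nothing to intersect.\<close>

definition max_invariant_core ::
    "('a, 'm) monoid_scheme \<Rightarrow> 'a topology \<Rightarrow> 'a set \<Rightarrow> 'a set" where
  "max_invariant_core G T A =
     A \<inter> \<Inter>{B \<in> invariant_open_subgroups G T A.
            \<forall>C \<in> invariant_open_subgroups G T A. B \<subseteq> C \<longrightarrow> C = B}"

section \<open>Inverse limits of sequences\<close>

definition profinite_inverse_system ::
    "(nat \<Rightarrow> ('b, 'n) monoid_scheme) \<Rightarrow> (nat \<Rightarrow> 'b topology) \<Rightarrow> (nat \<Rightarrow> 'b \<Rightarrow> 'b) \<Rightarrow> bool" where
  "profinite_inverse_system Gs Ts \<rho> \<longleftrightarrow>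
     (\<forall>n. profinite_group (Gs n) (Ts n)) \<and>
     (\<forall>n. \<rho> n \<in> hom (Gs (Suc n)) (Gs n) \<and>
          continuous_map (Ts (Suc n)) (Ts n) (\<rho> n) \<and>
          \<rho> n ` carrier (Gs (Suc n)) = carrier (Gs n))"

definition inverse_limit ::
    "(nat \<Rightarrow> ('b, 'n) monoid_scheme) \<Rightarrow> (nat \<Rightarrow> 'b \<Rightarrow> 'b) \<Rightarrow> (nat \<Rightarrow> 'b) monoid" where
  "inverse_limit Gs \<rho> =
     \<lparr>carrier = {x. \<forall>n. x n \<in> carrier (Gs n) \<and> \<rho> n (x (Suc n)) = x n},
      mult = (\<lambda>x y n. x n \<otimes>\<^bsub>Gs n\<^esub> y n),
      one = (\<lambda>n. \<one>\<^bsub>Gs n\<^esub>)\<rparr>"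

definition inverse_limit_topology ::
    "(nat \<Rightarrow> ('b, 'n) monoid_scheme) \<Rightarrow> (nat \<Rightarrow> 'b topology) \<Rightarrow> (nat \<Rightarrow> 'b \<Rightarrow> 'b) \<Rightarrow>
     (nat \<Rightarrow> 'b) topology" where
  "inverse_limit_topology Gs Ts \<rho> =
     subtopology (product_topology Ts UNIV) (carrier (inverse_limit Gs \<rho>))"

text \<open>\<open>G\<close> is the inverse limit with natural maps \<open>\<pi> n\<close> if these maps jointly identify \<open>G\<close>, as a
  topological group, with the group of compatible sequences.\<close>

definition is_inverse_limit ::
    "('a, 'm) monoid_scheme \<Rightarrow> 'a topology \<Rightarrow> (nat \<Rightarrow> 'a \<Rightarrow> 'b) \<Rightarrow>
     (nat \<Rightarrow> ('b, 'n) monoid_scheme) \<Rightarrow> (nat \<Rightarrow> 'b topology) \<Rightarrow> (nat \<Rightarrow> 'b \<Rightarrow> 'b) \<Rightarrow> bool" where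
  "is_inverse_limit G T \<pi> Gs Ts \<rho> \<longleftrightarrow>
     topological_group G T \<and>
     (\<lambda>x n. \<pi> n x) \<in> iso G (inverse_limit Gs \<rho>) \<and>
     homeomorphic_map T (inverse_limit_topology Gs Ts \<rho>) (\<lambda>x n. \<pi> n x)"

text \<open>The map out of \<open>Gs n\<close>, and hence its kernel, is only available for \<open>n > 0\<close>; for \<open>n = 0\<close>
  that term is dropped from the chain of inclusions.\<close>

definition JNNF_conditions ::
    "nat \<Rightarrow> (nat \<Rightarrow> ('b, 'n) monoid_scheme) \<Rightarrow> (nat \<Rightarrow> 'b topology) \<Rightarrow> (nat \<Rightarrow> 'b \<Rightarrow> 'b) \<Rightarrow>
     (nat \<Rightarrow> 'b set) \<Rightarrow> bool" where
  "JNNF_conditions c Gs Ts \<rho> P \<longleftrightarrow>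
     (\<forall>n. let
         Q = \<rho> n ` P (Suc n);
         \<gamma> = lower_central (Gs n) (Ts n) (c + 1);
         M = max_invariant_core (Gs n) (Ts n) (\<gamma> (P n))
       in
         (P n \<lhd> Gs n \<and> openin (Ts n) (P n)) \<and>
         virtually_nilpotent c (Gs n) (Ts n) \<and>
         Q \<subset> P n \<and>
         (M \<subset> \<gamma> (P n) \<and>
          (if n = 0 then \<gamma> Q \<subseteq> M
           else kernel (Gs n) (Gs (n - 1)) (\<rho> (n - 1)) \<subseteq> M \<and>
                \<gamma> Q \<subseteq> kernel (Gs n) (Gs (n - 1)) (\<rho> (n - 1))) \<and>
          \<gamma> Q \<noteq> {\<one>\<^bsub>Gs n\<^esub>}) \<and>
         (\<forall>N. N \<lhd> Gs n \<and> openin (Ts n) N \<longrightarrow> \<gamma> N \<subseteq> P n \<or> \<gamma> Q \<subseteq> \<gamma> N))"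

end

theory Submission
  imports Defs "HOL-Algebra.Generated_Groups" "HOL-Algebra.Zassenhaus"
begin

text \<open>
  Write \<open>\<gamma>\<close> for \<open>\<gamma>\<^bsub>c+1\<^esub>\<close> and \<open>M(A)\<close> for the intersection of the maximal \<open>G\<close>-invariant open
  subgroups of \<open>A\<close>. The elements of \<open>M(A)\<close> are non-generators of \<open>A\<close>, and \<open>M(A) \<noteq> 1\<close> for \<open>A \<noteq> 1\<close> because
  a JNNF group has no non-trivial finite normal subgroup.

  For the direct part the key point is that only finitely many of the subgroups \<open>\<gamma>(D)\<close>, with \<open>D\<close> open
  normal, fail to lie in a given open normal subgroup \<open>H\<close>; their intersection is then non-trivial,
  and so contains \<open>\<gamma>(F)\<close> for some open normal \<open>F\<close>. This rests on the finiteness of \<open>{\<gamma>(D)K}\<close> for every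
  closed normal \<open>K \<noteq> 1\<close>: choosing \<open>F\<close> with \<open>\<gamma>(F) \<le> K\<close>, Fitting's argument gives
  \<open>\<gamma>\<^bsub>2c+1\<^esub>(DF) \<le> \<gamma>(D)K\<close>, and \<open>\<gamma>\<^bsub>2c+1\<^esub>(DF)K\<close> has finite index in \<open>\<gamma>\<^bsub>c+1\<^esub>(DF)K\<close>. One obtains a descending
  sequence \<open>H\<^sub>n\<close> of open normal subgroups with \<open>\<gamma>(H\<^bsub>n+1\<^esub>) \<le> M(\<gamma>(H\<^sub>n))\<close>, and takes \<open>G\<^sub>n = G/M(\<gamma>(H\<^bsub>n+1\<^esub>))\<close>
  and \<open>P\<^sub>n\<close> the image of \<open>H\<^sub>n\<close>.

  For the converse, the preimages of the \<open>P\<^sub>n\<close> intersect in a nilpotent, hence trivial, normal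
  subgroup. So for a closed normal \<open>K \<noteq> 1\<close> and all large \<open>n\<close> the second alternative in (iv) holds for
  \<open>K\<pi>\<^sub>n\<close>, and as \<open>ker \<rho>\<^sub>n\<close> consists of non-generators of \<open>\<gamma>(P\<^bsub>n+1\<^esub>)\<close>, it lies in \<open>K\<pi>\<^bsub>n+1\<^esub>\<close>.
\<close>

text \<open>The bound \<open>2c+1\<close> counts weights: a commutator of that weight with entries
  from \<open>D\<close> and \<open>F\<close> has at least \<open>c+1\<close> entries from one of
  them. The finite index rests on finite generation: open subgroups are again finitely generated, so
  each section of the lower central series has finitely many iterated commutators as generators, and
  these are torsion modulo \<open>K\<close> because powers of their entries lie in \<open>F\<close>.
  The obstacle in the direct part is that the groups \<gamma>(D) need not be open, so no index
  argument applies to them directly; hence the detour through products with \<open>K\<close> and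
  minimal closed normal subgroups. In the converse the image of \<open>K\<close> in
  \<open>G\<^sub>n\<close> is merely closed, whereas (iv) speaks of open subgroups; the gap is
  closed by writing \<gamma> of a closed normal subgroup as the intersection of \<gamma> over the
  open normal subgroups above it.\<close>

declare lower_central.simps(3) [simp del]

section \<open>Commutators and lower central series\<close>

definition commutator :: "('a, 'm) monoid_scheme \<Rightarrow> 'a \<Rightarrow> 'a \<Rightarrow> 'a" where
  "commutator G x y = inv\<^bsub>G\<^esub> x \<otimes>\<^bsub>G\<^esub> inv\<^bsub>G\<^esub> y \<otimes>\<^bsub>G\<^esub> x \<otimes>\<^bsub>G\<^esub> y"

lemma closed_commutator_alt:
  "closed_commutator G T K L = closed_generate G T {commutator G x y | x y. x \<in> K \<and> y \<in> L}"
  by (simp add: closed_commutator_def commutator_def)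

context group
begin

lemma inv_mult_cancel:
  assumes "x \<in> carrier G" "y \<in> carrier G"
  shows "inv x \<otimes> (x \<otimes> y) = y" "x \<otimes> (inv x \<otimes> y) = y"
  using assms by (simp_all add: m_assoc[symmetric])

lemmas word_simps = m_assoc inv_mult_group inv_mult_cancel

lemma commutator_closed [simp, intro]:
  "x \<in> carrier G \<Longrightarrow> y \<in> carrier G \<Longrightarrow> commutator G x y \<in> carrier G"
  by (simp add: commutator_def)

lemma commutator_mult_left:
  assumes "x \<in> carrier G" "x' \<in> carrier G" "y \<in> carrier G"
  shows "commutator G (x \<otimes> x') y = (inv x' \<otimes> commutator G x y \<otimes> x') \<otimes> commutator G x' y"
  using assms by (simp add: commutator_def word_simps)

lemma inv_commutator:
  assumes "x \<in> carrier G" "y \<in> carrier G"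
  shows "inv (commutator G x y) = commutator G y x"
  using assms by (simp add: commutator_def word_simps)

lemma commutator_mult_right:
  assumes "x \<in> carrier G" "y' \<in> carrier G" "y \<in> carrier G"
  shows "commutator G x (y \<otimes> y') = commutator G x y' \<otimes> (inv y' \<otimes> commutator G x y \<otimes> y')"
  using assms by (simp add: commutator_def word_simps)

lemma commutator_inv_right:
  assumes "x \<in> carrier G" "y \<in> carrier G"
  shows "commutator G x (inv y) = y \<otimes> inv (commutator G x y) \<otimes> inv y"
  using assms by (simp add: commutator_def word_simps)

lemma commutator_one [simp]:
  assumes "x \<in> carrier G"
  shows "commutator G \<one> x = \<one>" "commutator G x \<one> = \<one>"
  using assms by (simp_all add: commutator_def)

lemma conj_commutator:
  assumes "g \<in> carrier G" "x \<in> carrier G" "y \<in> carrier G"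
  shows "g \<otimes> commutator G x y \<otimes> inv g = commutator G (g \<otimes> x \<otimes> inv g) (g \<otimes> y \<otimes> inv g)"
  using assms by (simp add: commutator_def word_simps)

lemma commutator_in_normal:
  assumes "N \<lhd> G" "x \<in> carrier G" "y \<in> carrier G" "x \<in> N \<or> y \<in> N"
  shows "commutator G x y \<in> N"
proof -
  interpret normal N G by fact
  have "commutator G x y = inv x \<otimes> (inv y \<otimes> x \<otimes> y)"
    using assms by (simp add: commutator_def m_assoc)
  moreover have "commutator G x y = (inv x \<otimes> inv y \<otimes> x) \<otimes> y"
    using assms by (simp add: commutator_def m_assoc)
  ultimately show ?thesis
    using assms inv_op_closed1 by (metis m_closed m_inv_closed)
qed

lemma commutator_eq_one_iff:
  assumes "x \<in> carrier G" "y \<in> carrier G"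
  shows "commutator G x y = \<one> \<longleftrightarrow> x \<otimes> y = y \<otimes> x"
proof -
  have "commutator G x y = inv (y \<otimes> x) \<otimes> (x \<otimes> y)"
    using assms by (simp add: commutator_def word_simps)
  then show ?thesis
    using assms by (metis inv_closed inv_comm inv_equality inv_inv m_closed l_inv)
qed

lemma comm_group_if_commute:
  assumes "subgroup H G" "\<And>x y. x \<in> H \<Longrightarrow> y \<in> H \<Longrightarrow> x \<otimes> y = y \<otimes> x"
  shows "comm_group (G\<lparr>carrier := H\<rparr>)"
  using assms subgroup.subgroup_is_group[OF assms(1) is_group]
  by (intro group.group_comm_groupI) auto

end

section \<open>Topological groups: translates, open subgroups and topologically generated
  subgroups\<close>

context topological_group
begin

lemma continuous_map_mult [continuous_intros]:
  assumes "continuous_map X T f" "continuous_map X T g"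
  shows "continuous_map X T (\<lambda>x. f x \<otimes> g x)"
proof -
  have "continuous_map X (prod_topology T T) (\<lambda>x. (f x, g x))"
    using assms by (simp add: continuous_map_pairwise o_def)
  from continuous_map_compose[OF this continuous_mult] show ?thesis
    by (simp add: o_def)
qed

lemma continuous_map_inv [continuous_intros]:
  "continuous_map X T f \<Longrightarrow> continuous_map X T (\<lambda>x. inv (f x))"
  using continuous_map_compose[OF _ continuous_inv] by (simp add: o_def)

lemma continuous_map_constant [continuous_intros]:
  "a \<in> carrier G \<Longrightarrow> continuous_map X T (\<lambda>x. a)"
  by (simp add: topspace_eq_carrier)

lemma continuous_map_ident [continuous_intros]: "continuous_map T T (\<lambda>x. x)"
  by simp

lemma continuous_map_commutator [continuous_intros]:
  assumes "continuous_map X T f" "continuous_map X T g"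
  shows "continuous_map X T (\<lambda>x. commutator G (f x) (g x))"
  unfolding commutator_def by (intro continuous_intros assms)

lemma closedin_preimage:
  "continuous_map T T f \<Longrightarrow> closedin T C \<Longrightarrow> closedin T {x \<in> carrier G. f x \<in> C}"
  using closedin_continuous_map_preimage topspace_eq_carrier by metis

lemma openin_preimage:
  "continuous_map T T f \<Longrightarrow> openin T C \<Longrightarrow> openin T {x \<in> carrier G. f x \<in> C}"
  using openin_continuous_map_preimage topspace_eq_carrier by metis

lemma closedin_subset_carrier: "closedin T C \<Longrightarrow> C \<subseteq> carrier G"
  using closedin_subset topspace_eq_carrier by metis

lemma openin_subset_carrier: "openin T C \<Longrightarrow> C \<subseteq> carrier G"
  using openin_subset topspace_eq_carrier by metis

lemma closedin_carrier: "closedin T (carrier G)"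
  using closedin_topspace topspace_eq_carrier by metis

lemma openin_carrier: "openin T (carrier G)"
  using openin_topspace topspace_eq_carrier by metis

lemma r_coset_eq_preimage:
  assumes "U \<subseteq> carrier G" "a \<in> carrier G"
  shows "U #> a = {x \<in> carrier G. x \<otimes> inv a \<in> U}"
proof (intro equalityI subsetI)
  fix x assume "x \<in> U #> a"
  then obtain u where "u \<in> U" "x = u \<otimes> a" by (auto simp: r_coset_def)
  then show "x \<in> {x \<in> carrier G. x \<otimes> inv a \<in> U}"
    using assms by (auto simp: m_assoc)
next
  fix x assume "x \<in> {x \<in> carrier G. x \<otimes> inv a \<in> U}"
  then have "x = (x \<otimes> inv a) \<otimes> a" "x \<otimes> inv a \<in> U" using assms(2) by (auto simp: m_assoc)
  then show "x \<in> U #> a" by (auto simp: r_coset_def)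
qed

lemma openin_r_coset:
  assumes "openin T U" "a \<in> carrier G"
  shows "openin T (U #> a)"
  unfolding r_coset_eq_preimage[OF openin_subset_carrier[OF assms(1)] assms(2)]
  by (intro openin_preimage continuous_intros assms inv_closed)

lemma closedin_r_coset:
  assumes "closedin T U" "a \<in> carrier G"
  shows "closedin T (U #> a)"
  unfolding r_coset_eq_preimage[OF closedin_subset_carrier[OF assms(1)] assms(2)]
  by (intro closedin_preimage continuous_intros assms inv_closed)

lemma openin_set_mult:
  assumes "openin T U" "A \<subseteq> carrier G"
  shows "openin T (U <#> A)"
proof -
  have "U <#> A = (\<Union>a\<in>A. U #> a)" by (auto simp: set_mult_def r_coset_def)
  then show ?thesis using assms openin_r_coset by (auto intro!: openin_Union)
qed

lemma openin_subgroup_nbhd: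
  assumes "subgroup H G" "openin T V" "\<one> \<in> V" "V \<subseteq> H"
  shows "openin T H"
proof -
  have "V <#> H = H"
  proof (intro equalityI subsetI)
    fix h assume "h \<in> H"
    then have "h = \<one> \<otimes> h" using subgroup.subset[OF assms(1)] by auto
    then show "h \<in> V <#> H"
      using assms \<open>h \<in> H\<close> unfolding set_mult_def by blast
  next
    fix x assume "x \<in> V <#> H"
    then show "x \<in> H" using assms(4) subgroup.m_closed[OF assms(1)] by (auto simp: set_mult_def)
  qed
  then show ?thesis using openin_set_mult[OF assms(2)] subgroup.subset[OF assms(1)] by metis
qed

lemma openin_subgroup_mono:
  "subgroup U G \<Longrightarrow> openin T U \<Longrightarrow> subgroup H G \<Longrightarrow> U \<subseteq> H \<Longrightarrow> openin T H"
  by (rule openin_subgroup_nbhd[OF _ _ subgroup.one_closed])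

lemma closedin_open_subgroup:
  assumes "subgroup U G" "openin T U"
  shows "closedin T U"
proof -
  have "carrier G - U = (\<Union>a\<in>carrier G - U. U #> a)"
  proof (intro equalityI subsetI)
    fix x assume "x \<in> carrier G - U"
    then show "x \<in> (\<Union>a\<in>carrier G - U. U #> a)" using rcos_self[OF _ assms(1)] by blast
  next
    fix x assume "x \<in> (\<Union>a\<in>carrier G - U. U #> a)"
    then obtain a u where a: "a \<in> carrier G" "a \<notin> U" "u \<in> U" "x = u \<otimes> a" by (auto simp: r_coset_def)
    have "u \<in> carrier G" using a subgroup.subset[OF assms(1)] by auto
    moreover have "x \<notin> U"
    proof
      assume "x \<in> U"
      then have "inv u \<otimes> x \<in> U" using a assms(1) by (simp add: subgroup.m_closed subgroup.m_inv_closed)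
      then show False using a \<open>u \<in> carrier G\<close> by (simp add: inv_mult_cancel)
    qed
    ultimately show "x \<in> carrier G - U" using a by simp
  qed
  moreover have "openin T (\<Union>a\<in>carrier G - U. U #> a)"
    using openin_r_coset[OF assms(2)] by auto
  ultimately show ?thesis
    using openin_subset_carrier[OF assms(2)] by (simp add: closedin_def topspace_eq_carrier)
qed

lemma closed_generate_superset: "S \<subseteq> closed_generate G T S"
  by (auto simp: closed_generate_def)

lemma closed_generate_least:
  "subgroup H G \<Longrightarrow> closedin T H \<Longrightarrow> S \<subseteq> H \<Longrightarrow> closed_generate G T S \<subseteq> H"
  by (auto simp: closed_generate_def)

lemma closed_generate_mono: "S \<subseteq> S' \<Longrightarrow> closed_generate G T S \<subseteq> closed_generate G T S'"
  by (auto simp: closed_generate_def)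

lemma closed_generate_closed_subgroup:
  assumes "S \<subseteq> carrier G"
  shows "subgroup (closed_generate G T S) G" "closedin T (closed_generate G T S)"
proof -
  have ne: "carrier G \<in> {H. subgroup H G \<and> closedin T H \<and> S \<subseteq> H}"
    using assms subgroup_self closedin_carrier by simp
  show "subgroup (closed_generate G T S) G"
    unfolding closed_generate_def by (rule subgroups_Inter) (use ne in auto)
  show "closedin T (closed_generate G T S)"
    unfolding closed_generate_def by (rule closedin_Inter) (use ne in auto)
qed

lemma closed_generate_subset_carrier: "S \<subseteq> carrier G \<Longrightarrow> closed_generate G T S \<subseteq> carrier G"
  using closed_generate_least[OF subgroup_self closedin_carrier] .

lemma closed_generate_eq: "subgroup H G \<Longrightarrow> closedin T H \<Longrightarrow> closed_generate G T H = H"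
  by (meson closed_generate_least closed_generate_superset order_refl subset_antisym)

text \<open>Elements of a topologically generated subgroup are not given by words in the generators,
  so a property spreads from \<open>S\<close> by checking that the elements having it form a closed
  subgroup. Here these are the elements whose conjugate by \<open>g\<close> stays inside.\<close>

lemma closed_generate_invariant:
  assumes S: "S \<subseteq> carrier G" and g: "g \<in> carrier G"
    and inv: "\<And>s. s \<in> S \<Longrightarrow> g \<otimes> s \<otimes> inv g \<in> closed_generate G T S"
    and x: "x \<in> closed_generate G T S"
  shows "g \<otimes> x \<otimes> inv g \<in> closed_generate G T S"
proof -
  let ?W = "closed_generate G T S"
  note W = closed_generate_closed_subgroup[OF S]
  let ?H = "{x \<in> carrier G. g \<otimes> x \<otimes> inv g \<in> ?W}"
  have "closedin T ?H"
    using g by (intro closedin_preimage continuous_intros W) auto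
  moreover have "subgroup ?H G"
  proof (rule subgroupI)
    show "?H \<noteq> {}" using subgroup.one_closed[OF W(1)] g by auto
  next
    fix a assume a: "a \<in> ?H"
    then have "inv (g \<otimes> a \<otimes> inv g) \<in> ?W" using subgroup.m_inv_closed[OF W(1)] by auto
    then show "inv a \<in> ?H" using a g by (simp add: word_simps)
  next
    fix a b assume a: "a \<in> ?H" and b: "b \<in> ?H"
    then have "(g \<otimes> a \<otimes> inv g) \<otimes> (g \<otimes> b \<otimes> inv g) \<in> ?W"
      using subgroup.m_closed[OF W(1)] by auto
    then show "a \<otimes> b \<in> ?H" using a b g by (simp add: word_simps)
  qed auto
  ultimately show ?thesis
    using closed_generate_least[of ?H S] S inv x by auto
qed

lemma closed_generate_normal:
  assumes "S \<subseteq> carrier G"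
    and "\<And>g s. g \<in> carrier G \<Longrightarrow> s \<in> S \<Longrightarrow> g \<otimes> s \<otimes> inv g \<in> closed_generate G T S"
  shows "closed_generate G T S \<lhd> G"
  using closed_generate_closed_subgroup[OF assms(1)] closed_generate_invariant[OF assms(1)] assms(2)
  by (auto simp: normal_inv_iff)

text \<open>The commutator identities express \<open>[s, a b]\<close> and \<open>[s, inv a]\<close>
  through conjugates, by elements of \<open>L\<close>, of \<open>[s, a]\<close>,
  \<open>[s, b]\<close> and their inverses. As \<open>L\<close> normalises \<open>V\<close>, the
  \<open>y\<close> in \<open>L\<close> with \<open>[s, y]\<close> in \<open>V\<close> form a closed
  subgroup.\<close>

lemma closed_generate_commutator_right:
  assumes L: "subgroup L G" "closedin T L" and V: "subgroup V G" "closedin T V"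
    and nrm: "\<And>l v. l \<in> L \<Longrightarrow> v \<in> V \<Longrightarrow> l \<otimes> v \<otimes> inv l \<in> V"
    and s: "s \<in> L" and R: "R \<subseteq> L" and comm: "\<And>r. r \<in> R \<Longrightarrow> commutator G s r \<in> V"
    and y: "y \<in> closed_generate G T R"
  shows "commutator G s y \<in> V"
proof -
  interpret L: subgroup L G by fact
  interpret V: subgroup V G by fact
  have nrm': "inv l \<otimes> v \<otimes> l \<in> V" if "l \<in> L" "v \<in> V" for l v
    using nrm[of "inv l" v] that L.m_inv_closed L.subset by auto
  have sG: "s \<in> carrier G" using s L.subset by auto
  let ?H = "{y \<in> carrier G. commutator G s y \<in> V} \<inter> L"
  have "closedin T ?H"
    using sG by (intro closedin_Int closedin_preimage continuous_intros V L) auto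
  moreover have "subgroup ?H G"
  proof (rule subgroupI)
    show "?H \<noteq> {}" using sG V.one_closed L.one_closed by (auto intro: exI[of _ \<one>])
  next
    fix a assume "a \<in> ?H"
    then show "inv a \<in> ?H"
      using sG nrm L.m_inv_closed V.m_inv_closed by (simp add: commutator_inv_right)
  next
    fix a b assume "a \<in> ?H" "b \<in> ?H"
    then show "a \<otimes> b \<in> ?H"
      using sG nrm' L.m_closed V.m_closed by (simp add: commutator_mult_right)
  qed auto
  ultimately show ?thesis
    using closed_generate_least[of ?H R] y comm R L.subset by auto
qed

text \<open>The one-sided version is applied once in each argument, and
  \<open>[y, x] = inv [x, y]\<close> exchanges the roles in between. This bounds a term of a lower
  central series by looking at generators alone.\<close>

lemma closed_generate_commutator:
  assumes L: "subgroup L G" "closedin T L" and V: "subgroup V G" "closedin T V"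
    and nrm: "\<And>l v. l \<in> L \<Longrightarrow> v \<in> V \<Longrightarrow> l \<otimes> v \<otimes> inv l \<in> V"
    and S: "S \<subseteq> L" and R: "R \<subseteq> L"
    and comm: "\<And>s r. s \<in> S \<Longrightarrow> r \<in> R \<Longrightarrow> commutator G s r \<in> V"
    and x: "x \<in> closed_generate G T S" and y: "y \<in> closed_generate G T R"
  shows "commutator G x y \<in> V"
proof -
  have LG: "L \<subseteq> carrier G" using subgroup.subset[OF L(1)] .
  have yL: "y \<in> L" and xL: "x \<in> L" using closed_generate_least[OF L] S R x y by blast+
  have swap: "commutator G b a \<in> V" if "a \<in> L" "b \<in> L" "commutator G a b \<in> V" for a b
    using subgroup.m_inv_closed[OF V(1) that(3)]
      inv_commutator[OF subsetD[OF LG that(1)] subsetD[OF LG that(2)]] by simp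
  have "commutator G y s \<in> V" if s: "s \<in> S" for s
    using closed_generate_commutator_right[OF L V nrm subsetD[OF S s] R comm[OF s] y] swap s S yL by auto
  then have "commutator G y x \<in> V"
    using closed_generate_commutator_right[OF L V nrm yL S _ x] by blast
  then show ?thesis using swap xL yL by blast
qed

section \<open>Basic properties of the closed lower central series\<close>

abbreviation lcs where "lcs \<equiv> lower_central G T"

lemma lower_central_Suc:
  "i \<ge> 1 \<Longrightarrow> lcs (Suc i) K = closed_commutator G T (lcs i K) K"
  by (cases i) (simp_all add: lower_central.simps(3))

text \<open>Starts at \<open>1\<close>, since the dummy term of index \<open>0\<close> does not obey
  the recursion.\<close>

lemma lower_central_induct [consumes 1, case_names 1 Suc]:
  assumes "i \<ge> (1::nat)" "P 1" "\<And>i. i \<ge> 1 \<Longrightarrow> P i \<Longrightarrow> P (Suc i)"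
  shows "P i"
  using assms by (rule nat_induct_at_least)

lemma lower_central_subset_carrier:
  assumes "K \<subseteq> carrier G"
  shows "lcs i K \<subseteq> carrier G"
proof (cases "i \<ge> 1")
  case True
  then show ?thesis
  proof (induction rule: lower_central_induct)
    case (Suc i)
    then show ?case
      using assms unfolding lower_central_Suc[OF Suc(1)] closed_commutator_alt
      by (intro closed_generate_subset_carrier) auto
  qed (use assms in auto)
next
  case False
  then have "i = 0" by simp
  then show ?thesis using assms by simp
qed

lemma commutator_in_lower_central:
  "i \<ge> 1 \<Longrightarrow> x \<in> lcs i K \<Longrightarrow> y \<in> K \<Longrightarrow> commutator G x y \<in> lcs (Suc i) K"
  unfolding lower_central_Suc closed_commutator_alt
  by (rule subsetD[OF closed_generate_superset]) auto

lemma lower_central_mono: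
  assumes "K \<subseteq> L"
  shows "lcs i K \<subseteq> lcs i L"
proof (cases "i \<ge> 1")
  case True
  then show ?thesis
  proof (induction rule: lower_central_induct)
    case (Suc i)
    then show ?case
      using assms unfolding lower_central_Suc[OF Suc(1)] closed_commutator_alt
      by (intro closed_generate_mono) auto
  qed (use assms in auto)
next
  case False
  then have "i = 0" by simp
  then show ?thesis using assms by simp
qed

lemma lower_central_closed_subgroup:
  assumes "subgroup K G" "closedin T K"
  shows "subgroup (lcs i K) G" "closedin T (lcs i K)"
proof -
  have "subgroup (lcs i K) G \<and> closedin T (lcs i K)"
  proof (cases "i \<ge> 2")
    case True
    then obtain j where j: "i = Suc j" "j \<ge> 1" by (cases i) auto
    have "{commutator G x y | x y. x \<in> lcs j K \<and> y \<in> K} \<subseteq> carrier G"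
      using lower_central_subset_carrier subgroup.subset[OF assms(1)] by blast
    then show ?thesis
      unfolding j(1) lower_central_Suc[OF j(2)] closed_commutator_alt
      using closed_generate_closed_subgroup by blast
  next
    case False
    then have "i = 0 \<or> i = Suc 0" by auto
    then show ?thesis using assms by auto
  qed
  then show "subgroup (lcs i K) G" "closedin T (lcs i K)" by auto
qed

lemma lower_central_normal:
  assumes "K \<lhd> G"
  shows "lcs i K \<lhd> G"
proof (cases "i \<ge> 1")
  case True
  then show ?thesis
  proof (induction rule: lower_central_induct)
    case (Suc i)
    interpret K: normal K G by fact
    interpret N: normal "lcs i K" G by fact
    show ?case
      unfolding lower_central_Suc[OF Suc(1)] closed_commutator_alt
    proof (rule closed_generate_normal)
      fix g s assume g: "g \<in> carrier G"
        and "s \<in> {commutator G x y | x y. x \<in> lcs i K \<and> y \<in> K}"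
      then obtain x y where xy: "s = commutator G x y" "x \<in> lcs i K" "y \<in> K" by auto
      then have "g \<otimes> s \<otimes> inv g = commutator G (g \<otimes> x \<otimes> inv g) (g \<otimes> y \<otimes> inv g)"
        using g N.subset K.subset by (auto intro!: conj_commutator)
      moreover have "g \<otimes> x \<otimes> inv g \<in> lcs i K" "g \<otimes> y \<otimes> inv g \<in> K"
        using N.inv_op_closed2 K.inv_op_closed2 g xy by auto
      ultimately show "g \<otimes> s \<otimes> inv g \<in> closed_generate G T
          {commutator G x y | x y. x \<in> lcs i K \<and> y \<in> K}"
        by (intro subsetD[OF closed_generate_superset]) blast
    qed (use N.subset K.subset in auto)
  qed (use assms in auto)
next
  case False
  then have "i = 0" by simp
  then show ?thesis using assms by simp
qed

lemma lower_central_Suc_subset: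
  assumes "K \<lhd> G" "closedin T K" "i \<ge> 1"
  shows "lcs (Suc i) K \<subseteq> lcs i K"
proof -
  have K: "subgroup K G" using assms(1) by (rule normal_imp_subgroup)
  have "commutator G x y \<in> lcs i K"
    if "x \<in> lcs i K" "y \<in> K" for x y
    by (rule commutator_in_normal[OF lower_central_normal[OF assms(1)]])
       (use that lower_central_subset_carrier subgroup.subset[OF K] in auto)
  then show ?thesis
    unfolding lower_central_Suc[OF assms(3)] closed_commutator_alt
    by (intro closed_generate_least lower_central_closed_subgroup K assms) auto
qed

lemma lower_central_antimono:
  assumes "K \<lhd> G" "closedin T K" "1 \<le> i" "i \<le> j"
  shows "lcs j K \<subseteq> lcs i K"
  using assms(4)
proof (induction j rule: dec_induct)
  case (step n)
  then show ?case using lower_central_Suc_subset[OF assms(1,2), of n] assms(3) by auto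
qed auto

lemma lower_central_subset:
  assumes "K \<lhd> G" "closedin T K"
  shows "lcs i K \<subseteq> K"
  using lower_central_antimono[OF assms, of 1 i] by (cases "i = 0") auto

end

section \<open>Profinite groups and their quotients\<close>

text \<open>Profiniteness of quotients and of inverse limits is checked through this criterion: a
  clopen set and its complement are disjoint neighbourhoods, and no connected set meets
  both.\<close>

lemma clopen_separation_imp:
  assumes "\<And>x y. x \<in> topspace X \<Longrightarrow> y \<in> topspace X \<Longrightarrow> x \<noteq> y \<Longrightarrow>
             \<exists>A. openin X A \<and> closedin X A \<and> x \<in> A \<and> y \<notin> A"
  shows "Hausdorff_space X" "totally_disconnected_space X"
proof -
  show "Hausdorff_space X"
    unfolding Hausdorff_space_def
  proof (intro allI impI)
    fix x y assume xy: "x \<in> topspace X \<and> y \<in> topspace X \<and> x \<noteq> y"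
    then obtain A where "openin X A" "closedin X A" "x \<in> A" "y \<notin> A" using assms by blast
    then show "\<exists>U V. openin X U \<and> openin X V \<and> x \<in> U \<and> y \<in> V \<and> disjnt U V"
      using xy by (intro exI[of _ A] exI[of _ "topspace X - A"]) (auto simp: disjnt_iff)
  qed
  show "totally_disconnected_space X"
    unfolding totally_disconnected_space_def
  proof (intro allI impI)
    fix S assume S: "connectedin X S"
    have "x = y" if "x \<in> S" "y \<in> S" for x y
    proof (rule ccontr)
      assume "x \<noteq> y"
      moreover have "x \<in> topspace X" "y \<in> topspace X"
        using connectedin_subset_topspace[OF S] that by auto
      ultimately obtain A where "openin X A" "closedin X A" "x \<in> A" "y \<notin> A"
        using assms[of x y] by auto
      then show False using connectedin_clopen_cases[OF S] that by (auto simp: disjnt_iff)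
    qed
    then show "\<exists>x. S \<subseteq> {x}" by blast
  qed
qed

text \<open>Directedness puts a single non-empty member below every finite intersection, which is
  the finite intersection property.\<close>

lemma compact_directed_Inter_nonempty:
  assumes "compact_space X" "\<C> \<noteq> {}" "\<And>C. C \<in> \<C> \<Longrightarrow> closedin X C" "\<And>C. C \<in> \<C> \<Longrightarrow> C \<noteq> {}"
    and dir: "\<And>C D. C \<in> \<C> \<Longrightarrow> D \<in> \<C> \<Longrightarrow> \<exists>E\<in>\<C>. E \<subseteq> C \<inter> D"
  shows "\<Inter>\<C> \<noteq> {}"
proof -
  have "\<exists>E\<in>\<C>. E \<subseteq> \<Inter>\<F>" if "finite \<F>" "\<F> \<subseteq> \<C>" for \<F>
    using that
  proof (induction)
    case empty
    then show ?case using assms(2) by auto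
  next
    case (insert F \<F>)
    then obtain E where "E \<in> \<C>" "E \<subseteq> \<Inter>\<F>" by auto
    moreover obtain E' where "E' \<in> \<C>" "E' \<subseteq> E \<inter> F" using dir[of E F] insert calculation by auto
    ultimately show ?case by blast
  qed
  then have "\<Inter>\<F> \<noteq> {}" if "finite \<F>" "\<F> \<subseteq> \<C>" for \<F>
    using assms(4) that by (metis subset_empty)
  then show ?thesis using assms(1)[unfolded compact_space_fip, rule_format, of \<C>] assms(3) by simp
qed

context group
begin

lemma normal_set_mult_subgroup:
  assumes "N \<lhd> G" "subgroup H G"
  shows "subgroup (H <#> N) G"
  using mult_norm_subgroup[OF assms] commut_normal[OF assms(2,1)] by simp

lemma normal_set_mult_normal:
  assumes "N \<lhd> G" "H \<lhd> G"
  shows "H <#> N \<lhd> G"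
proof -
  interpret N: normal N G by fact
  interpret H: normal H G by fact
  show ?thesis
    unfolding normal_inv_iff
  proof (intro conjI ballI normal_set_mult_subgroup assms(1) H.subgroup_axioms)
    fix x a assume x: "x \<in> carrier G" and "a \<in> H <#> N"
    then obtain h n where a: "a = h \<otimes> n" "h \<in> H" "n \<in> N" by (auto simp: set_mult_def)
    have "x \<otimes> a \<otimes> inv x = (x \<otimes> h \<otimes> inv x) \<otimes> (x \<otimes> n \<otimes> inv x)"
      using a x N.subset H.subset by (auto simp: word_simps subset_iff)
    moreover have "x \<otimes> h \<otimes> inv x \<in> H" "x \<otimes> n \<otimes> inv x \<in> N"
      using a x by (auto intro: N.inv_op_closed2 H.inv_op_closed2)
    ultimately show "x \<otimes> a \<otimes> inv x \<in> H <#> N" by (auto simp: set_mult_def)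
  qed
qed

lemma set_mult_superset:
  assumes "subgroup H G" "subgroup K G"
  shows "H \<subseteq> H <#> K" "K \<subseteq> H <#> K"
proof -
  show "H \<subseteq> H <#> K"
  proof
    fix h assume "h \<in> H"
    moreover have "h = h \<otimes> \<one>" using \<open>h \<in> H\<close> subgroup.subset[OF assms(1)] by auto
    ultimately show "h \<in> H <#> K"
      using subgroup.one_closed[OF assms(2)] unfolding set_mult_def by blast
  qed
  show "K \<subseteq> H <#> K"
  proof
    fix h assume "h \<in> K"
    moreover have "h = \<one> \<otimes> h" using \<open>h \<in> K\<close> subgroup.subset[OF assms(2)] by auto
    ultimately show "h \<in> H <#> K"
      using subgroup.one_closed[OF assms(1)] unfolding set_mult_def by blast
  qed
qed

lemma set_mult_least:
  assumes "subgroup L G" "H \<subseteq> L" "K \<subseteq> L"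
  shows "H <#> K \<subseteq> L"
  using assms subgroup.m_closed[OF assms(1)] by (auto simp: set_mult_def)

text \<open>Dedekind's law: if \<open>x = b u\<close> lies in \<open>A\<close>, then
  \<open>u = inv b x\<close> lies in \<open>A \<inter> V\<close>. It identifies a subgroup of
  \<open>A\<close> with the trace on \<open>A\<close> of an open subgroup of
  \<open>G\<close>.\<close>

lemma modular_law_subset:
  assumes A: "subgroup A G" and H: "subgroup H G" "H \<subseteq> A" and V: "V \<subseteq> carrier G" "A \<inter> V \<subseteq> H"
  shows "A \<inter> (H <#> V) \<subseteq> H"
proof
  fix x assume "x \<in> A \<inter> (H <#> V)"
  then obtain b u where x: "x \<in> A" "b \<in> H" "u \<in> V" "x = b \<otimes> u" by (auto simp: set_mult_def)
  have "inv b \<otimes> x = u"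
    using x subgroup.subset[OF H(1)] V(1) by (auto simp: inv_mult_cancel subset_iff)
  moreover have "inv b \<otimes> x \<in> A"
    using x H(2) subgroup.m_closed[OF A] subgroup.m_inv_closed[OF A] by auto
  ultimately have "u \<in> H" using x(3) V(2) by auto
  then show "x \<in> H" using x subgroup.m_closed[OF H(1)] by auto
qed

lemma normal_Inter:
  assumes "\<N> \<noteq> {}" "\<And>N. N \<in> \<N> \<Longrightarrow> N \<lhd> G"
  shows "\<Inter>\<N> \<lhd> G"
  unfolding normal_inv_iff
proof (intro conjI ballI)
  show "subgroup (\<Inter>\<N>) G"
    using assms by (intro subgroups_Inter) (auto simp: normal_imp_subgroup)
  fix x h assume "x \<in> carrier G" "h \<in> \<Inter>\<N>"
  then show "x \<otimes> h \<otimes> inv x \<in> \<Inter>\<N>"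
    using assms(2) unfolding normal_inv_iff by blast
qed

end

context topological_group
begin

lemma open_normal_set_mult:
  assumes "H \<lhd> G" "U \<lhd> G" "openin T U"
  shows "H <#> U \<lhd> G" "openin T (H <#> U)" "H \<subseteq> H <#> U" "U \<subseteq> H <#> U"
proof -
  note sH = normal_imp_subgroup[OF assms(1)] and sU = normal_imp_subgroup[OF assms(2)]
  show sup: "H \<subseteq> H <#> U" "U \<subseteq> H <#> U" by (rule set_mult_superset[OF sH sU])+
  show HU: "H <#> U \<lhd> G" by (rule normal_set_mult_normal[OF assms(2,1)])
  show "openin T (H <#> U)"
    by (rule openin_subgroup_mono[OF sU assms(3) normal_imp_subgroup[OF HU] sup(2)])
qed

end

section \<open>Open normal subgroups as a base at the identity\<close>

context profinite_group
begin

lemma closedin_one: "closedin T {\<one>}"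
  using Hausdorff by (simp add: closedin_Hausdorff_singleton topspace_eq_carrier)

text \<open>Otherwise the sets \<open>C - W\<close>, for clopen \<open>C\<close> containing
  \<open>x\<close>, form a directed family of non-empty closed sets, and a common point lies in the
  quasi-component of \<open>x\<close>. In a compact Hausdorff space that is the connected component,
  here a singleton, whereas the point is outside \<open>W\<close>.\<close>

lemma clopen_base:
  assumes "openin T W" "x \<in> W"
  shows "\<exists>C. openin T C \<and> closedin T C \<and> x \<in> C \<and> C \<subseteq> W"
proof (rule ccontr)
  assume none: "\<not> ?thesis"
  have xT: "x \<in> topspace T" using assms openin_subset by blast
  let ?\<C> = "{C - W | C. openin T C \<and> closedin T C \<and> x \<in> C}"
  have "\<Inter>?\<C> \<noteq> {}"
  proof (rule compact_directed_Inter_nonempty[OF compact])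
    show "?\<C> \<noteq> {}" using xT by auto
    show "closedin T C" if "C \<in> ?\<C>" for C using that assms(1) by (auto intro: closedin_diff)
    show "C \<noteq> {}" if "C \<in> ?\<C>" for C using that none by blast
    fix C D assume "C \<in> ?\<C>" "D \<in> ?\<C>"
    then obtain C' D' where "C = C' - W" "openin T C'" "closedin T C'" "x \<in> C'"
      "D = D' - W" "openin T D'" "closedin T D'" "x \<in> D'" by blast
    then show "\<exists>E\<in>?\<C>. E \<subseteq> C \<inter> D"
      by (intro bexI[of _ "C' \<inter> D' - W"]) auto
  qed
  then obtain y where y: "y \<in> \<Inter>?\<C>" by blast
  then have "quasi_component_of T x y"
    using xT unfolding quasi_component_of by auto
  moreover have "y \<notin> W" using y xT by auto
  then have "y \<noteq> x" using assms(2) by auto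
  moreover have "quasi_component_of T x = connected_component_of T x"
    by (rule quasi_eq_connected_component_of) (simp add: compact Hausdorff)
  moreover obtain z where "connected_component_of_set T x \<subseteq> {z}"
    using totally_disconnected connectedin_connected_component_of
    unfolding totally_disconnected_space_def by metis
  moreover have "connected_component_of T x x" using xT by (simp add: connected_component_of_refl)
  ultimately show False by auto
qed

text \<open>A clopen set \<open>C\<close> containing \<open>\<one>\<close> contains the normal subgroup of all \<open>x\<close> that can be inserted
  into any product without affecting its membership in \<open>C\<close>; compactness makes it open.\<close>

lemma open_normal_base:
  assumes "openin T W" "\<one> \<in> W"
  shows "\<exists>N. N \<lhd> G \<and> openin T N \<and> N \<subseteq> W"
proof -
  obtain C where C: "openin T C" "closedin T C" "\<one> \<in> C" "C \<subseteq> W" using clopen_base[OF assms] by blast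
  let ?X = "prod_topology (prod_topology T T) T"
  let ?f = "\<lambda>z. fst (fst z) \<otimes> snd z \<otimes> snd (fst z)" and ?g = "\<lambda>z. fst (fst z) \<otimes> snd (fst z)"
  let ?W = "{z \<in> topspace ?X. ?f z \<in> C \<longleftrightarrow> ?g z \<in> C}"
  have proj: "continuous_map ?X T (\<lambda>z. fst (fst z))" "continuous_map ?X T (\<lambda>z. snd (fst z))"
    "continuous_map ?X T snd"
    using continuous_map_compose[OF continuous_map_fst continuous_map_fst, of T T T]
      continuous_map_compose[OF continuous_map_fst continuous_map_snd, of T T T]
    by (simp_all add: o_def continuous_map_snd)
  have f: "continuous_map ?X T ?f" and g: "continuous_map ?X T ?g"
    by (intro continuous_map_mult proj)+
  have CC: "openin T (carrier G - C)" using C(2) openin_carrier by (intro openin_diff)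
  have "?f z \<in> carrier G" "?g z \<in> carrier G" if "z \<in> topspace ?X" for z
    using that by (auto simp: topspace_eq_carrier)
  then have "?W = ({z \<in> topspace ?X. ?f z \<in> C} \<inter> {z \<in> topspace ?X. ?g z \<in> C}) \<union>
    ({z \<in> topspace ?X. ?f z \<in> carrier G - C} \<inter> {z \<in> topspace ?X. ?g z \<in> carrier G - C})"
    by blast
  then have W: "openin ?X ?W"
    using openin_continuous_map_preimage[OF f C(1)] openin_continuous_map_preimage[OF g C(1)]
      openin_continuous_map_preimage[OF f CC] openin_continuous_map_preimage[OF g CC]
    by (simp only: openin_Int openin_Un)
  \<comment> \<open>The tube lemma with the compact factor \<open>G \<times> G\<close> yields one
    neighbourhood \<open>V\<close> of \<open>\<one>\<close> that works for all \<open>a\<close> and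
    \<open>b\<close> at once.\<close>
  obtain U V where UV: "openin T V" "carrier G \<times> carrier G \<subseteq> U" "{\<one>} \<subseteq> V" "U \<times> V \<subseteq> ?W"
  proof (rule Wallace_theorem_prod_topology[OF _ _ W])
    show "compactin (prod_topology T T) (carrier G \<times> carrier G)"
      using compact by (simp add: compactin_Times compact_space_def topspace_eq_carrier)
    show "compactin T {\<one>}" by (simp add: topspace_eq_carrier)
    show "(carrier G \<times> carrier G) \<times> {\<one>} \<subseteq> ?W" by (auto simp: topspace_eq_carrier)
  qed auto
  let ?N = "{x \<in> carrier G. \<forall>a\<in>carrier G. \<forall>b\<in>carrier G. a \<otimes> x \<otimes> b \<in> C \<longleftrightarrow> a \<otimes> b \<in> C}"
  have N: "subgroup ?N G"
  proof (rule subgroupI)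
    show "?N \<noteq> {}" by (auto intro!: exI[of _ \<one>])
  next
    fix x assume x: "x \<in> ?N"
    have "a \<otimes> inv x \<otimes> b \<in> C \<longleftrightarrow> a \<otimes> b \<in> C" if "a \<in> carrier G" "b \<in> carrier G" for a b
    proof -
      have "(a \<otimes> inv x) \<otimes> x \<otimes> b \<in> C \<longleftrightarrow> (a \<otimes> inv x) \<otimes> b \<in> C" using x that by simp
      then show ?thesis using x that by (simp add: word_simps)
    qed
    then show "inv x \<in> ?N" using x by simp
  next
    fix x y assume x: "x \<in> ?N" and y: "y \<in> ?N"
    have "a \<otimes> (x \<otimes> y) \<otimes> b \<in> C \<longleftrightarrow> a \<otimes> b \<in> C" if "a \<in> carrier G" "b \<in> carrier G" for a b
    proof -
      have "(a \<otimes> x) \<otimes> y \<otimes> b \<in> C \<longleftrightarrow> (a \<otimes> x) \<otimes> b \<in> C" using x y that by simp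
      also have "\<dots> \<longleftrightarrow> a \<otimes> b \<in> C" using x that by simp
      finally show ?thesis using x y that by (simp add: m_assoc)
    qed
    then show "x \<otimes> y \<in> ?N" using x y by simp
  qed auto
  have "?N \<lhd> G"
    unfolding normal_inv_iff
  proof (intro conjI N ballI)
    fix g x assume g: "g \<in> carrier G" and x: "x \<in> ?N"
    have "a \<otimes> (g \<otimes> x \<otimes> inv g) \<otimes> b \<in> C \<longleftrightarrow> a \<otimes> b \<in> C" if "a \<in> carrier G" "b \<in> carrier G" for a b
    proof -
      have "(a \<otimes> g) \<otimes> x \<otimes> (inv g \<otimes> b) \<in> C \<longleftrightarrow> (a \<otimes> g) \<otimes> (inv g \<otimes> b) \<in> C" using x g that by simp
      then show ?thesis using x g that by (simp add: word_simps)
    qed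
    then show "g \<otimes> x \<otimes> inv g \<in> ?N" using g x by simp
  qed
  moreover have "V \<subseteq> ?N"
  proof
    fix x assume x: "x \<in> V"
    have "a \<otimes> x \<otimes> b \<in> C \<longleftrightarrow> a \<otimes> b \<in> C" if "a \<in> carrier G" "b \<in> carrier G" for a b
    proof -
      have "((a, b), x) \<in> U \<times> V" using that x UV(2) by auto
      then have "((a, b), x) \<in> ?W" by (rule subsetD[OF UV(4)])
      then show ?thesis by simp
    qed
    then show "x \<in> ?N" using x openin_subset_carrier[OF UV(1)] by auto
  qed
  then have "openin T ?N" using openin_subgroup_nbhd[OF N UV(1)] UV(3) by auto
  moreover have "?N \<subseteq> W"
  proof
    fix x assume x: "x \<in> ?N"
    then have "\<one> \<otimes> x \<otimes> \<one> \<in> C \<longleftrightarrow> \<one> \<otimes> \<one> \<in> C" by blast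
    then show "x \<in> W" using x C(3,4) by auto
  qed
  ultimately show ?thesis by blast
qed

lemma open_normal_subset_subgroup:
  "subgroup H G \<Longrightarrow> openin T H \<Longrightarrow> \<exists>N. N \<lhd> G \<and> openin T N \<and> N \<subseteq> H"
  using open_normal_base subgroup.one_closed by metis

text \<open>Membership in a closed set can be tested modulo all open normal subgroups. If
  \<open>x\<close> is not in \<open>A\<close>, the \<open>u\<close> with \<open>x (inv u)\<close>
  outside \<open>A\<close> form an open neighbourhood of \<open>\<one>\<close>, and an open normal
  \<open>N\<close> inside it excludes \<open>x\<close> from \<open>A N\<close>.\<close>

lemma closed_memI:
  assumes A: "closedin T A" and x: "x \<in> carrier G"
    and all: "\<And>N. N \<lhd> G \<Longrightarrow> openin T N \<Longrightarrow> x \<in> A <#> N"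
  shows "x \<in> A"
proof (rule ccontr)
  assume "x \<notin> A"
  have AG: "A \<subseteq> carrier G" using A closedin_subset_carrier by auto
  let ?W = "{u \<in> carrier G. x \<otimes> inv u \<in> carrier G - A}"
  have "openin T ?W"
    by (intro openin_preimage continuous_intros x openin_diff openin_carrier A)
  moreover have "\<one> \<in> ?W" using x \<open>x \<notin> A\<close> by auto
  ultimately obtain N where N: "N \<lhd> G" "openin T N" "N \<subseteq> ?W" using open_normal_base by blast
  obtain a u where "a \<in> A" "u \<in> N" "x = a \<otimes> u" using all[OF N(1,2)] by (auto simp: set_mult_def)
  moreover from this have "x \<otimes> inv u = a" using AG openin_subset_carrier[OF N(2)]
    by (auto simp: m_assoc subset_iff)
  ultimately show False using N(3) by auto
qed

lemma open_normal_separating: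
  assumes "x \<in> carrier G" "x \<noteq> \<one>"
  shows "\<exists>N. N \<lhd> G \<and> openin T N \<and> x \<notin> N"
  using open_normal_base[of "carrier G - {x}"] assms openin_carrier closedin_Hausdorff_singleton[OF Hausdorff]
    openin_diff by (metis DiffD2 Diff_iff one_closed singleton_iff subsetD topspace_eq_carrier)

lemma closedin_set_mult:
  assumes "closedin T A" "closedin T B"
  shows "closedin T (A <#> B)"
proof -
  have "A <#> B = (\<lambda>(x, y). x \<otimes> y) ` (A \<times> B)" by (auto simp: set_mult_def)
  moreover have "compactin (prod_topology T T) (A \<times> B)"
    using assms compact by (simp add: compactin_Times closedin_compact_space)
  ultimately have "compactin T (A <#> B)" using image_compactin continuous_mult by metis
  then show ?thesis using Hausdorff compactin_imp_closedin by blast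
qed

lemma finite_rcosets_open:
  assumes "subgroup U G" "openin T U"
  shows "finite (rcosets U)"
proof -
  have "compactin T (carrier G)" using compact by (simp add: compact_space_def topspace_eq_carrier)
  moreover have "\<forall>C\<in>rcosets U. openin T C" using openin_r_coset assms by (auto simp: RCOSETS_def)
  moreover have "carrier G \<subseteq> \<Union>(rcosets U)" using rcosets_part_G[OF assms(1)] by auto
  ultimately obtain \<F> where \<F>: "finite \<F>" "\<F> \<subseteq> rcosets U" "carrier G \<subseteq> \<Union>\<F>"
    unfolding compactin_def by meson
  have "rcosets U \<subseteq> \<F>"
  proof
    fix C assume C: "C \<in> rcosets U"
    then obtain x where x: "x \<in> C" "x \<in> carrier G"
      using rcos_self assms(1) by (auto simp: RCOSETS_def)
    then obtain D where "D \<in> \<F>" "x \<in> D" using \<F> by blast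
    moreover have "C = D"
      using rcos_disjoint[OF assms(1)] C x calculation \<F>(2) by (fastforce simp: pairwise_def disjnt_iff)
    ultimately show "C \<in> \<F>" by simp
  qed
  then show ?thesis using \<F>(1) finite_subset by blast
qed

lemma profinite_quotient:
  assumes N: "N \<lhd> G" and cl: "closedin T N"
  shows "profinite_group (G Mod N) (quotient_topology G T N)"
proof -
  interpret N: normal N G by fact
  let ?Q = "quotient_topology G T N"
  let ?f = "\<lambda>x. N #> x"
  interpret Q: group "G Mod N" by (rule N.factorgroup_is_group)
  have q: "quotient_map T ?Q ?f" by (rule quotient_map_quotient_topology[OF N.subgroup_axioms])
  then have cont: "continuous_map T ?Q ?f" by (rule quotient_imp_continuous_map)
  have top: "topspace ?Q = carrier (G Mod N)"
    using quotient_imp_surjective_map[OF q] by (simp add: topspace_eq_carrier carrier_FactGroup)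
  have qo: "openin ?Q X \<longleftrightarrow> openin T {z \<in> topspace T. ?f z \<in> X}" if "X \<subseteq> topspace ?Q" for X
    using q that unfolding quotient_map_def by simp
  have qc: "closedin ?Q X \<longleftrightarrow> closedin T {z \<in> topspace T. ?f z \<in> X}" if "X \<subseteq> topspace ?Q" for X
    using q that unfolding quotient_map_closedin by simp
  have sep: "\<exists>A. openin ?Q A \<and> closedin ?Q A \<and> C \<in> A \<and> D \<notin> A"
    if CD: "C \<in> topspace ?Q" "D \<in> topspace ?Q" "C \<noteq> D" for C D
  proof -
    obtain x y where x: "x \<in> carrier G" "C = N #> x" and y: "y \<in> carrier G" "D = N #> y"
      using CD unfolding top carrier_FactGroup by auto
    have "y \<otimes> inv x \<notin> N"
      using CD(3) x y N.rcos_module[OF is_group x(1) y(1)]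
        repr_independence[OF _ x(1) N.subgroup_axioms, of y] by auto
    then obtain U where U: "U \<lhd> G" "openin T U" "y \<otimes> inv x \<notin> N <#> U"
      using closed_memI[OF cl, of "y \<otimes> inv x"] x y by auto
    let ?V = "N <#> U"
    note Vop = open_normal_set_mult[OF N U(1,2)]
    interpret V: normal ?V G by (rule Vop(1))
    have inv_coset: "N #> z \<subseteq> ?V #> x" if "z \<in> ?V #> x" for z
    proof
      fix w assume "w \<in> N #> z"
      then obtain n where "n \<in> N" "w = n \<otimes> z" unfolding r_coset_def by blast
      moreover obtain v where "v \<in> ?V" "z = v \<otimes> x" using \<open>z \<in> ?V #> x\<close> unfolding r_coset_def by blast
      ultimately obtain n v where n: "n \<in> N" "v \<in> ?V" "w = n \<otimes> (v \<otimes> x)" by blast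
      then have "w = (n \<otimes> v) \<otimes> x" using V.subset Vop(3) x by (auto simp: m_assoc subset_iff)
      then show "w \<in> ?V #> x" using n Vop(3) V.m_closed by (auto simp: r_coset_def)
    qed
    \<comment> \<open>The separating set downstairs: its preimage is exactly \<open>?V #> x\<close>,
      because \<open>?V\<close> absorbs \<open>N\<close>, and a coset of an open subgroup is
      clopen.\<close>
    let ?A = "{E \<in> carrier (G Mod N). E \<subseteq> ?V #> x}"
    have preim: "{z \<in> topspace T. ?f z \<in> ?A} = ?V #> x"
    proof (intro equalityI subsetI)
      fix z assume "z \<in> {z \<in> topspace T. ?f z \<in> ?A}"
      then show "z \<in> ?V #> x" using rcos_self[OF _ N.subgroup_axioms] by (auto simp: topspace_eq_carrier)
    next
      fix z assume "z \<in> ?V #> x"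
      then show "z \<in> {z \<in> topspace T. ?f z \<in> ?A}"
        using inv_coset V.subset x r_coset_subset_G[of ?V x] by (auto simp: topspace_eq_carrier carrier_FactGroup)
    qed
    have sub: "?A \<subseteq> topspace ?Q" by (auto simp: top)
    have "openin T {z \<in> topspace T. ?f z \<in> ?A}" "closedin T {z \<in> topspace T. ?f z \<in> ?A}"
      unfolding preim
      by (intro openin_r_coset[OF Vop(2) x(1)] closedin_r_coset closedin_open_subgroup V.subgroup_axioms Vop(2) x)+
    then have "openin ?Q ?A" "closedin ?Q ?A"
      unfolding qo[OF sub] qc[OF sub] .
    moreover have "C \<in> ?A"
      using inv_coset[OF rcos_self[OF x(1) V.subgroup_axioms]] x by (auto simp: carrier_FactGroup)
    moreover have "D \<notin> ?A"
    proof
      assume "D \<in> ?A"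
      then have "y \<in> ?V #> x" using y rcos_self[OF _ N.subgroup_axioms] by auto
      then obtain v where "v \<in> ?V" "y = v \<otimes> x" by (auto simp: r_coset_def)
      then have "y \<otimes> inv x = v" using x V.subset by (auto simp: m_assoc subset_iff)
      then show False using U(3) \<open>v \<in> ?V\<close> by simp
    qed
    ultimately show ?thesis by blast
  qed
  note HT = clopen_separation_imp[of ?Q, OF sep]
  have comp: "compact_space ?Q"
    using compact cont quotient_imp_surjective_map[OF q] image_compactin compact_space_def by metis
  \<comment> \<open>A product of quotient maps is not a quotient map in general; this one is, being
    a continuous map from a compact space onto a Hausdorff space and therefore closed. Continuity of
    the multiplication then descends along it.\<close>
  have q2: "quotient_map (prod_topology T T) (prod_topology ?Q ?Q) (\<lambda>(x, y). (?f x, ?f y))"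
  proof (rule continuous_closed_imp_quotient_map)
    show c2: "continuous_map (prod_topology T T) (prod_topology ?Q ?Q) (\<lambda>(x, y). (?f x, ?f y))"
      using cont by (simp add: continuous_map_prod_top)
    show "closed_map (prod_topology T T) (prod_topology ?Q ?Q) (\<lambda>(x, y). (?f x, ?f y))"
      by (rule continuous_imp_closed_map[OF c2])
         (auto simp: compact_space_prod_topology compact Hausdorff_space_prod_topology HT)
    show "(\<lambda>(x, y). (?f x, ?f y)) ` topspace (prod_topology T T) = topspace (prod_topology ?Q ?Q)"
      by (simp add: image_paired_Times quotient_imp_surjective_map[OF q])
  qed
  have hom: "?f (x \<otimes> y) = ?f x <#> ?f y" if "x \<in> carrier G" "y \<in> carrier G" for x y
    using N.rcos_sum that by simp
  have mult: "continuous_map (prod_topology ?Q ?Q) ?Q (\<lambda>(x, y). x \<otimes>\<^bsub>G Mod N\<^esub> y)"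
  proof -
    have "continuous_map (prod_topology T T) ?Q (?f \<circ> (\<lambda>(x, y). x \<otimes> y))"
      by (rule continuous_map_compose[OF continuous_mult cont])
    then have "continuous_map (prod_topology T T) ?Q ((\<lambda>(x, y). x \<otimes>\<^bsub>G Mod N\<^esub> y) \<circ> (\<lambda>(x, y). (?f x, ?f y)))"
      by (rule continuous_map_eq) (auto simp: topspace_eq_carrier hom)
    then show ?thesis using continuous_compose_quotient_map_eq[OF q2] by blast
  qed
  have inv: "continuous_map ?Q ?Q (\<lambda>x. inv\<^bsub>G Mod N\<^esub> x)"
  proof -
    have "continuous_map T ?Q (?f \<circ> (\<lambda>x. inv x))"
      by (rule continuous_map_compose[OF continuous_inv cont])
    then have "continuous_map T ?Q ((\<lambda>x. inv\<^bsub>G Mod N\<^esub> x) \<circ> ?f)"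
      by (rule continuous_map_eq)
         (auto simp: topspace_eq_carrier N.inv_FactGroup carrier_FactGroup N.rcos_inv)
    then show ?thesis using continuous_compose_quotient_map_eq[OF q] by blast
  qed
  show ?thesis
    by (intro profinite_group.intro topological_group.intro topological_group_axioms.intro
        profinite_group_axioms.intro Q.is_group top mult inv comp HT)
qed

end

text \<open>Covers alike the quotient maps, the maps between successive quotients, the projections
  of an inverse limit and its transition maps, so that images and preimages are treated
  once.\<close>

locale profinite_epi = profinite_group G T + G': profinite_group G' T'
  for G (structure) and T and G' and T' +
  fixes f
  assumes homf: "f \<in> hom G G'"
    and contf: "continuous_map T T' f"
    and surjf: "f ` carrier G = carrier G'"

sublocale profinite_epi \<subseteq> group_hom G G' f
  by unfold_locales (rule homf)

context profinite_epi
begin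

lemma closed_map_f: "closed_map T T' f"
  by (rule continuous_imp_closed_map[OF contf compact G'.Hausdorff])

lemma quotient_map_f: "quotient_map T T' f"
  using continuous_closed_imp_quotient_map[OF contf closed_map_f] surjf
  by (simp add: topspace_eq_carrier G'.topspace_eq_carrier)

lemma closedin_image: "closedin T C \<Longrightarrow> closedin T' (f ` C)"
  using closed_map_f by (simp add: closed_map_def)

lemma closedin_vimage: "closedin T' C \<Longrightarrow> closedin T {x \<in> carrier G. f x \<in> C}"
  using closedin_continuous_map_preimage[OF contf] by (simp add: topspace_eq_carrier)

lemma openin_vimage: "openin T' C \<Longrightarrow> openin T {x \<in> carrier G. f x \<in> C}"
  using openin_continuous_map_preimage[OF contf] by (simp add: topspace_eq_carrier)

lemma vimage_image:
  assumes "A \<subseteq> carrier G"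
  shows "{x \<in> carrier G. f x \<in> f ` A} = kernel G G' f <#> A"
proof (intro equalityI subsetI)
  fix x assume "x \<in> {x \<in> carrier G. f x \<in> f ` A}"
  then obtain a where a: "x \<in> carrier G" "a \<in> A" "f x = f a" by auto
  then have "x \<otimes> inv a \<in> kernel G G' f" using assms by (auto simp: kernel_def subset_iff)
  moreover have "x = (x \<otimes> inv a) \<otimes> a" using a assms by (auto simp: m_assoc subset_iff)
  ultimately show "x \<in> kernel G G' f <#> A" using a(2) unfolding set_mult_def by blast
next
  fix x assume "x \<in> kernel G G' f <#> A"
  then show "x \<in> {x \<in> carrier G. f x \<in> f ` A}"
    using assms by (auto simp: kernel_def set_mult_def subset_iff)
qed

text \<open>The preimage of the image is a union of translates of \<open>U\<close> by elements of
  the kernel, and \<open>f\<close> is a quotient map because it is closed.\<close>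

lemma openin_image:
  assumes "openin T U"
  shows "openin T' (f ` U)"
proof -
  have U: "U \<subseteq> carrier G" using assms openin_subset_carrier by auto
  have "kernel G G' f <#> U = (\<Union>k\<in>kernel G G' f. {x \<in> carrier G. inv k \<otimes> x \<in> U})"
  proof (intro equalityI subsetI)
    fix x assume "x \<in> kernel G G' f <#> U"
    then show "x \<in> (\<Union>k\<in>kernel G G' f. {x \<in> carrier G. inv k \<otimes> x \<in> U})"
      using U by (auto simp: set_mult_def kernel_def inv_mult_cancel subset_iff)
  next
    fix x assume "x \<in> (\<Union>k\<in>kernel G G' f. {x \<in> carrier G. inv k \<otimes> x \<in> U})"
    then obtain k where k: "k \<in> kernel G G' f" "x \<in> carrier G" "inv k \<otimes> x \<in> U" by auto
    then have "x = k \<otimes> (inv k \<otimes> x)" by (auto simp: inv_mult_cancel kernel_def)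
    then show "x \<in> kernel G G' f <#> U" using k unfolding set_mult_def by blast
  qed
  moreover have "openin T (\<Union>k\<in>kernel G G' f. {x \<in> carrier G. inv k \<otimes> x \<in> U})"
    by (intro openin_Union) (auto intro!: openin_preimage continuous_intros assms simp: kernel_def)
  ultimately have "openin T {x \<in> topspace T. f x \<in> f ` U}"
    using vimage_image[OF U] by (simp add: topspace_eq_carrier)
  moreover have "f ` U \<subseteq> topspace T'" using U by (auto simp: G'.topspace_eq_carrier)
  ultimately show ?thesis using quotient_map_f unfolding quotient_map_def by blast
qed

lemma subgroup_vimage: "subgroup H G' \<Longrightarrow> subgroup {x \<in> carrier G. f x \<in> H} G"
  by (rule subgroupI) (auto simp: subgroup.m_closed subgroup.m_inv_closed subgroup.one_closed intro!: exI[of _ \<one>])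

lemma normal_vimage: "H \<lhd> G' \<Longrightarrow> {x \<in> carrier G. f x \<in> H} \<lhd> G"
  by (auto simp: normal_inv_iff G'.normal_inv_iff intro!: subgroup_vimage)

lemma normal_image: "H \<lhd> G \<Longrightarrow> f ` H \<lhd> G'"
  using normal.surj_hom_normal_subgroup[OF _ _ surjf] group_hom_axioms by blast

lemma image_vimage: "B \<subseteq> carrier G' \<Longrightarrow> f ` {x \<in> carrier G. f x \<in> B} = B"
  using surjf by auto

text \<open>One inclusion pulls the closed subgroup on the right back along \<open>f\<close>; the
  other needs images of closed subgroups to be closed, which compactness provides.\<close>

lemma image_closed_generate:
  assumes "S \<subseteq> carrier G"
  shows "f ` closed_generate G T S = closed_generate G' T' (f ` S)"
proof
  have fS: "f ` S \<subseteq> carrier G'" using assms by auto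
  note W = G'.closed_generate_closed_subgroup[OF fS]
  have "closed_generate G T S \<subseteq> {x \<in> carrier G. f x \<in> closed_generate G' T' (f ` S)}"
    by (rule closed_generate_least)
       (use assms G'.closed_generate_superset[of "f ` S"] in \<open>auto intro: subgroup_vimage W closedin_vimage\<close>)
  then show "f ` closed_generate G T S \<subseteq> closed_generate G' T' (f ` S)" by auto
  show "closed_generate G' T' (f ` S) \<subseteq> f ` closed_generate G T S"
    using closed_generate_closed_subgroup[OF assms] closed_generate_superset
    by (intro G'.closed_generate_least closedin_image image_mono subgroup_img_is_subgroup) auto
qed

lemma hom_commutator:
  "x \<in> carrier G \<Longrightarrow> y \<in> carrier G \<Longrightarrow> f (commutator G x y) = commutator G' (f x) (f y)"
  by (simp add: commutator_def)

lemma image_lower_central: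
  assumes "K \<subseteq> carrier G"
  shows "f ` lcs i K = lower_central G' T' i (f ` K)"
proof (cases "i \<ge> 1")
  case True
  then show ?thesis
  proof (induction rule: lower_central_induct)
    case (Suc i)
    let ?C = "{commutator G x y | x y. x \<in> lcs i K \<and> y \<in> K}"
    note sub = lower_central_subset_carrier[OF assms, of i]
    have "?C \<subseteq> carrier G" using sub assms by auto
    moreover have "f ` ?C = {commutator G' x y | x y. x \<in> f ` lcs i K \<and> y \<in> f ` K}"
    proof (intro equalityI subsetI)
      fix z assume "z \<in> f ` ?C"
      then obtain x y where "x \<in> lcs i K" "y \<in> K" "z = f (commutator G x y)" by auto
      moreover from this have "z = commutator G' (f x) (f y)" using sub assms hom_commutator by auto
      ultimately show "z \<in> {commutator G' x y | x y. x \<in> f ` lcs i K \<and> y \<in> f ` K}" by blast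
    next
      fix z assume "z \<in> {commutator G' x y | x y. x \<in> f ` lcs i K \<and> y \<in> f ` K}"
      then obtain x y where xy: "x \<in> lcs i K" "y \<in> K" "z = commutator G' (f x) (f y)" by auto
      moreover from this have "x \<in> carrier G" "y \<in> carrier G" using sub assms by auto
      ultimately have "z = f (commutator G x y)" using hom_commutator by simp
      then show "z \<in> f ` ?C" using xy by blast
    qed
    ultimately show ?case
      unfolding lower_central_Suc[OF Suc(1)] G'.lower_central_Suc[OF Suc(1)] closed_commutator_alt
      using image_closed_generate[of ?C] Suc.IH by simp
  qed auto
next
  case False
  then have "i = 0" by simp
  then show ?thesis by simp
qed

lemma kernel_normal_closed: "kernel G G' f \<lhd> G" "closedin T (kernel G G' f)"
  using normal_kernel closedin_vimage[OF G'.closedin_one] by (simp_all add: kernel_def)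

lemma image_subset_image_iff:
  assumes "A \<subseteq> carrier G" "subgroup B G" "kernel G G' f \<subseteq> B"
  shows "f ` A \<subseteq> f ` B \<longleftrightarrow> A \<subseteq> B"
proof
  assume "f ` A \<subseteq> f ` B"
  then have "A \<subseteq> {x \<in> carrier G. f x \<in> f ` B}" using assms by auto
  also have "\<dots> = kernel G G' f <#> B" using vimage_image subgroup.subset[OF assms(2)] by auto
  also have "\<dots> \<subseteq> B" using assms set_mult_least by auto
  finally show "A \<subseteq> B" .
qed auto

text \<open>Translates virtual nilpotency of the image into a statement about open normal subgroups
  of \<open>G\<close>. A normal \<open>F\<close> can be taken inside the preimage of
  \<open>H\<close>, since lower central terms are monotone.\<close>

lemma virtually_nilpotent_iff:
  "virtually_nilpotent c G' T' \<longleftrightarrow>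
     (\<exists>F. F \<lhd> G \<and> openin T F \<and> lcs (c + 1) F \<subseteq> kernel G G' f)"
proof
  assume "virtually_nilpotent c G' T'"
  then obtain H where H: "subgroup H G'" "openin T' H" "lower_central G' T' (c + 1) H = {\<one>\<^bsub>G'\<^esub>}"
    by (auto simp: virtually_nilpotent_def)
  obtain F where F: "F \<lhd> G" "openin T F" "F \<subseteq> {x \<in> carrier G. f x \<in> H}"
    using open_normal_subset_subgroup[OF subgroup_vimage[OF H(1)] openin_vimage[OF H(2)]] by blast
  have FG: "F \<subseteq> carrier G" using F by auto
  have "f ` lcs (c + 1) F \<subseteq> {\<one>\<^bsub>G'\<^esub>}"
    using image_lower_central[OF FG] G'.lower_central_mono[of "f ` F" H "c + 1"] F(3) H(3) by auto
  then show "\<exists>F. F \<lhd> G \<and> openin T F \<and> lcs (c + 1) F \<subseteq> kernel G G' f"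
    using F lower_central_subset_carrier[OF FG] unfolding kernel_def by blast
next
  assume "\<exists>F. F \<lhd> G \<and> openin T F \<and> lcs (c + 1) F \<subseteq> kernel G G' f"
  then obtain F where F: "F \<lhd> G" "openin T F" "lcs (c + 1) F \<subseteq> kernel G G' f" by auto
  have sub: "subgroup (f ` F) G'" using normal_image[OF F(1)] by (rule normal_imp_subgroup)
  have "lower_central G' T' (c + 1) (f ` F) \<subseteq> {\<one>\<^bsub>G'\<^esub>}"
    unfolding image_lower_central[OF openin_subset_carrier[OF F(2)], symmetric]
    using F(3) by (auto simp: kernel_def)
  moreover have "subgroup (lower_central G' T' (c + 1) (f ` F)) G'"
    using G'.lower_central_closed_subgroup[OF sub] G'.closedin_open_subgroup[OF sub openin_image[OF F(2)]] by blast
  ultimately have "lower_central G' T' (c + 1) (f ` F) = {\<one>\<^bsub>G'\<^esub>}"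
    using subgroup.one_closed by blast
  then show "virtually_nilpotent c G' T'"
    using sub openin_image[OF F(2)] by (auto simp: virtually_nilpotent_def)
qed

end

context profinite_group
begin

lemma quotient_epi:
  assumes "N \<lhd> G" "closedin T N"
  shows "profinite_epi G T (G Mod N) (quotient_topology G T N) (\<lambda>x. N #> x)"
proof -
  interpret Q: profinite_group "G Mod N" "quotient_topology G T N" by (rule profinite_quotient[OF assms])
  show ?thesis
  proof
    show "(\<lambda>x. N #> x) \<in> hom G (G Mod N)" using normal.r_coset_hom_Mod[OF assms(1)] .
    show "continuous_map T (quotient_topology G T N) (\<lambda>x. N #> x)"
      using quotient_map_quotient_topology[OF normal_imp_subgroup[OF assms(1)]] quotient_imp_continuous_map by blast
    show "(\<lambda>x. N #> x) ` carrier G = carrier (G Mod N)" by (simp add: carrier_FactGroup)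
  qed
qed

lemma kernel_quotient:
  assumes "N \<lhd> G"
  shows "kernel G (G Mod N) (\<lambda>x. N #> x) = N"
proof -
  interpret normal N G by fact
  have "x \<in> N" if "x \<in> carrier G" "N #> x = N" for x
    using that rcos_self[OF _ subgroup_axioms] by metis
  moreover have "N #> x = N" if "x \<in> N" for x
    using that subset coset_join2[OF _ subgroup_axioms] by auto
  ultimately show ?thesis
    using subset by (auto simp: kernel_def)
qed

lemma virtually_nilpotent_quotient_iff:
  assumes "N \<lhd> G" "closedin T N"
  shows "virtually_nilpotent c (G Mod N) (quotient_topology G T N) \<longleftrightarrow>
     (\<exists>F. F \<lhd> G \<and> openin T F \<and> lcs (c + 1) F \<subseteq> N)"
  using profinite_epi.virtually_nilpotent_iff[OF quotient_epi[OF assms]] kernel_quotient[OF assms(1)] by simp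

lemma virtually_nilpotent_alt:
  "virtually_nilpotent c G T \<longleftrightarrow>
     (\<exists>F. F \<lhd> G \<and> openin T F \<and> lcs (c + 1) F = {\<one>})"
proof
  assume "virtually_nilpotent c G T"
  then obtain H where H: "subgroup H G" "openin T H" "lcs (c + 1) H = {\<one>}"
    by (auto simp: virtually_nilpotent_def)
  then obtain F where F: "F \<lhd> G" "openin T F" "F \<subseteq> H" using open_normal_subset_subgroup by blast
  then have "lcs (c + 1) F \<subseteq> {\<one>}" using lower_central_mono[of F H "c + 1"] H(3) by auto
  moreover have "\<one> \<in> lcs (c + 1) F"
    using lower_central_normal[OF F(1)] normal_imp_subgroup subgroup.one_closed by blast
  ultimately show "\<exists>F. F \<lhd> G \<and> openin T F \<and> lcs (c + 1) F = {\<one>}" using F by blast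
next
  assume "\<exists>F. F \<lhd> G \<and> openin T F \<and> lcs (c + 1) F = {\<one>}"
  then show "virtually_nilpotent c G T"
    unfolding virtually_nilpotent_def using normal_imp_subgroup by blast
qed

end

section \<open>Maximal invariant open subgroups\<close>

lemma ex_minimal_set:
  assumes "S \<noteq> {}"
    and "\<And>\<C>. \<C> \<noteq> {} \<Longrightarrow> \<C> \<subseteq> S \<Longrightarrow> (\<And>C D. C \<in> \<C> \<Longrightarrow> D \<in> \<C> \<Longrightarrow> C \<subseteq> D \<or> D \<subseteq> C) \<Longrightarrow> \<Inter>\<C> \<in> S"
  shows "\<exists>M\<in>S. \<forall>X\<in>S. X \<subseteq> M \<longrightarrow> X = M"
proof (rule predicate_Zorn)
  show "partial_order_on S (relation_of (\<lambda>x y. y \<subseteq> x) S)"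
    by (rule partial_order_on_relation_ofI) auto
  fix \<C> assume ch: "\<C> \<in> Chains (relation_of (\<lambda>x y. y \<subseteq> x) S)"
  show "\<exists>u\<in>S. \<forall>a\<in>\<C>. u \<subseteq> a"
  proof (cases "\<C> = {}")
    case False
    have "\<C> \<subseteq> S" using ch by (auto simp: Chains_def relation_of_def)
    moreover have "C \<subseteq> D \<or> D \<subseteq> C" if "C \<in> \<C>" "D \<in> \<C>" for C D
      using ch that by (auto simp: Chains_def relation_of_def)
    ultimately show ?thesis using assms(2)[OF False] by blast
  qed (use assms(1) in auto)
qed

context group
begin

text \<open>A subgroup above \<open>V\<close> is the union of the cosets of \<open>V\<close> that it
  meets, so it is determined by a subset of a finite set.\<close>

lemma finite_subgroups_between:
  assumes V: "subgroup V G" and fin: "finite ((\<lambda>b. V #> b) ` B)"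
  shows "finite {C. subgroup C G \<and> V \<subseteq> C \<and> C \<subseteq> B}"
proof -
  have "C = \<Union>((\<lambda>b. V #> b) ` C)" if C: "subgroup C G" "V \<subseteq> C" for C
  proof
    show "C \<subseteq> \<Union>((\<lambda>b. V #> b) ` C)"
      using rcos_self[OF _ V] subgroup.subset[OF C(1)] by blast
    show "\<Union>((\<lambda>b. V #> b) ` C) \<subseteq> C"
      using C subgroup.m_closed[OF C(1)] by (auto simp: r_coset_def)
  qed
  then have "C \<in> Union ` Pow ((\<lambda>b. V #> b) ` B)" if "subgroup C G" "V \<subseteq> C" "C \<subseteq> B" for C
    by (rule image_eqI[of _ _ "(\<lambda>b. V #> b) ` C"]) (use that in auto)
  then have "{C. subgroup C G \<and> V \<subseteq> C \<and> C \<subseteq> B} \<subseteq> Union ` Pow ((\<lambda>b. V #> b) ` B)"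
    by (intro subsetI) simp
  then show ?thesis by (rule finite_subset) (use fin in simp)
qed

end

context profinite_group
begin

text \<open>For \<open>a\<close> in \<open>A\<close>, the coset \<open>(A \<inter> V) a\<close> is
  the trace on \<open>A\<close> of \<open>V a\<close>, and \<open>V\<close> has finitely many cosets
  in \<open>G\<close>.\<close>

lemma finite_cosets_Int_open:
  assumes A: "subgroup A G" and V: "subgroup V G" "openin T V"
  shows "finite ((\<lambda>a. (A \<inter> V) #> a) ` A)"
proof -
  have "(A \<inter> V) #> a = A \<inter> (V #> a)" if "a \<in> A" for a
  proof (intro equalityI subsetI)
    fix x assume "x \<in> (A \<inter> V) #> a"
    then show "x \<in> A \<inter> (V #> a)"
      using that subgroup.m_closed[OF A] by (auto simp: r_coset_def)
  next
    fix x assume "x \<in> A \<inter> (V #> a)"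
    then obtain v where v: "v \<in> V" "x = v \<otimes> a" "x \<in> A" by (auto simp: r_coset_def)
    have "x \<otimes> inv a \<in> A" using v(3) that subgroup.m_closed[OF A] subgroup.m_inv_closed[OF A] by auto
    moreover have "x \<otimes> inv a = v"
      using v that subgroup.subset[OF A] subgroup.subset[OF V(1)] by (auto simp: m_assoc subset_iff)
    ultimately have "v \<in> A" by simp
    then show "x \<in> (A \<inter> V) #> a" using v unfolding r_coset_def by blast
  qed
  then have "(A \<inter> V) #> a \<in> (\<lambda>X. A \<inter> X) ` (rcosets V)" if "a \<in> A" for a
    by (rule image_eqI[of _ _ "V #> a"])
       (use that subgroup.mem_carrier[OF A that] rcosetsI[OF subgroup.subset[OF V(1)]] in auto)
  then have "(\<lambda>a. (A \<inter> V) #> a) ` A \<subseteq> (\<lambda>X. A \<inter> X) ` (rcosets V)"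
    by (rule image_subsetI)
  then show ?thesis using finite_rcosets_open[OF V] finite_subset by blast
qed

text \<open>Exchanges the subspace topology of \<open>A\<close> for open normal subgroups of
  \<open>G\<close>: \<open>B\<close> contains \<open>A \<inter> U\<close> for some open normal
  \<open>U\<close>, and then the modular law gives \<open>B = A \<inter> B U\<close>.\<close>

lemma invariant_open_subgroups_iff:
  assumes A: "A \<lhd> G"
  shows "B \<in> invariant_open_subgroups G T A \<longleftrightarrow>
           (\<exists>V. V \<lhd> G \<and> openin T V \<and> B = A \<inter> V \<and> \<not> A \<subseteq> V)"
proof
  assume "B \<in> invariant_open_subgroups G T A"
  then have B: "B \<subset> A" "openin (subtopology T A) B" "B \<lhd> G" by (auto simp: invariant_open_subgroups_def)
  note sB = normal_imp_subgroup[OF B(3)] and sA = normal_imp_subgroup[OF A]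
  obtain W where W: "openin T W" "B = A \<inter> W" using B(2) by (auto simp: openin_subtopology)
  then have "\<one> \<in> W" using subgroup.one_closed[OF sB] by auto
  then obtain U where U: "U \<lhd> G" "openin T U" "U \<subseteq> W" using open_normal_base[OF W(1)] by blast
  have "A \<inter> (B <#> U) \<subseteq> B"
    using W(2) U(3) B(1) subgroup.subset[OF normal_imp_subgroup[OF U(1)]]
    by (intro modular_law_subset sA sB) auto
  moreover note BU = open_normal_set_mult[OF B(3) U(1,2)]
  ultimately have "B = A \<inter> (B <#> U)" "\<not> A \<subseteq> B <#> U" using B(1) by blast+
  then show "\<exists>V. V \<lhd> G \<and> openin T V \<and> B = A \<inter> V \<and> \<not> A \<subseteq> V"
    using BU by blast
next
  assume "\<exists>V. V \<lhd> G \<and> openin T V \<and> B = A \<inter> V \<and> \<not> A \<subseteq> V"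
  then show "B \<in> invariant_open_subgroups G T A"
    using A normal_subgroup_intersect by (auto simp: invariant_open_subgroups_def openin_subtopology)
qed

text \<open>With \<open>B = A \<inter> V\<close>, the modular law gives
  \<open>H = A \<inter> H V\<close>.\<close>

lemma invariant_open_subgroups_upward:
  assumes A: "A \<lhd> G" and B: "B \<in> invariant_open_subgroups G T A"
    and H: "H \<lhd> G" "B \<subseteq> H" "H \<subset> A"
  shows "H \<in> invariant_open_subgroups G T A"
proof -
  obtain V where V: "V \<lhd> G" "openin T V" "B = A \<inter> V" using B invariant_open_subgroups_iff[OF A] by auto
  note HV = open_normal_set_mult[OF H(1) V(1,2)]
  have "A \<inter> (H <#> V) \<subseteq> H"
    using H(2,3) V(3) subgroup.subset[OF normal_imp_subgroup[OF V(1)]]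
    by (intro modular_law_subset normal_imp_subgroup A H) auto
  then have "H = A \<inter> (H <#> V)" "\<not> A \<subseteq> H <#> V" using H(3) HV(3) by blast+
  then show ?thesis
    using HV(1,2) unfolding invariant_open_subgroups_iff[OF A] by blast
qed

definition max_invariant_open_subgroups where
  "max_invariant_open_subgroups A =
     {B \<in> invariant_open_subgroups G T A. \<forall>C \<in> invariant_open_subgroups G T A. B \<subseteq> C \<longrightarrow> C = B}"

lemma max_invariant_core_alt:
  "max_invariant_core G T A = A \<inter> \<Inter>(max_invariant_open_subgroups A)"
  by (simp add: max_invariant_core_def max_invariant_open_subgroups_def)

lemma max_invariant_core_subset: "max_invariant_core G T A \<subseteq> A"
  by (auto simp: max_invariant_core_alt)

text \<open>\<open>B\<close> is the trace on \<open>A\<close> of an open subgroup, so only finitely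
  many subgroups lie between \<open>B\<close> and \<open>A\<close>.\<close>

lemma max_invariant_above:
  assumes A: "A \<lhd> G" and B: "B \<in> invariant_open_subgroups G T A"
  shows "\<exists>C\<in>max_invariant_open_subgroups A. B \<subseteq> C"
proof -
  obtain V where V: "V \<lhd> G" "openin T V" "B = A \<inter> V" using B invariant_open_subgroups_iff[OF A] by auto
  let ?S = "{C \<in> invariant_open_subgroups G T A. B \<subseteq> C}"
  have "finite {C. subgroup C G \<and> B \<subseteq> C \<and> C \<subseteq> A}"
    unfolding V(3)
    by (intro finite_subgroups_between finite_cosets_Int_open normal_imp_subgroup A V normal_subgroup_intersect)
  then have "finite ?S"
    by (rule rev_finite_subset) (auto simp: invariant_open_subgroups_def normal_imp_subgroup)
  moreover have "B \<in> ?S" using B by auto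
  ultimately obtain C where C: "C \<in> ?S" "\<forall>D\<in>?S. C \<subseteq> D \<longrightarrow> C = D"
    using finite_has_maximal2[of ?S B] by blast
  have "D = C" if "D \<in> invariant_open_subgroups G T A" "C \<subseteq> D" for D
    using C that by auto
  then show ?thesis using C(1) unfolding max_invariant_open_subgroups_def by auto
qed

lemma max_invariant_core_normal:
  assumes "A \<lhd> G"
  shows "max_invariant_core G T A \<lhd> G"
proof -
  have "max_invariant_core G T A = \<Inter>(insert A (max_invariant_open_subgroups A))"
    by (simp add: max_invariant_core_alt)
  also have "\<dots> \<lhd> G"
    by (rule normal_Inter)
       (use assms in \<open>auto simp: max_invariant_open_subgroups_def invariant_open_subgroups_def\<close>)
  finally show ?thesis .
qed

lemma closedin_invariant_open:
  assumes "A \<lhd> G" "closedin T A" "B \<in> invariant_open_subgroups G T A"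
  shows "closedin T B"
proof -
  obtain V where "V \<lhd> G" "openin T V" "B = A \<inter> V"
    using assms(3) invariant_open_subgroups_iff[OF assms(1)] by auto
  then show ?thesis
    using assms(2) closedin_open_subgroup[OF normal_imp_subgroup] by (auto intro: closedin_Int)
qed

lemma closedin_max_invariant_core:
  assumes "A \<lhd> G" "closedin T A"
  shows "closedin T (max_invariant_core G T A)"
proof -
  have "max_invariant_core G T A = \<Inter>(insert A (max_invariant_open_subgroups A))"
    by (simp add: max_invariant_core_alt)
  moreover have "closedin T (\<Inter>(insert A (max_invariant_open_subgroups A)))"
    using assms closedin_invariant_open
    by (intro closedin_Inter) (auto simp: max_invariant_open_subgroups_def)
  ultimately show ?thesis by simp
qed

text \<open>The argument known for Frattini subgroups: a closed normal \<open>B\<close> properly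
  inside \<open>A\<close> is contained in a proper \<open>A \<inter> B U\<close> with
  \<open>U\<close> open normal. A maximal member above that contains both \<open>B\<close> and the
  core, hence their product.\<close>

lemma max_invariant_core_nongenerating:
  assumes A: "A \<lhd> G" and B: "B \<lhd> G" "closedin T B" "B \<subseteq> A"
    and gen: "A \<subseteq> B <#> max_invariant_core G T A"
  shows "B = A"
proof (rule ccontr)
  assume "B \<noteq> A"
  then obtain a where a: "a \<in> A" "a \<notin> B" using B(3) by auto
  obtain U where U: "U \<lhd> G" "openin T U" "a \<notin> B <#> U"
    using closed_memI[OF B(2)] a subgroup.subset[OF normal_imp_subgroup[OF A]] by blast
  let ?V = "B <#> U"
  note V = open_normal_set_mult[OF B(1) U(1,2)]
  have "A \<inter> ?V \<in> invariant_open_subgroups G T A"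
    using V(1,2) U(3) a(1) unfolding invariant_open_subgroups_iff[OF A] by blast
  then obtain C where C: "C \<in> max_invariant_open_subgroups A" "A \<inter> ?V \<subseteq> C"
    using max_invariant_above[OF A] by blast
  have C': "C \<lhd> G" "C \<subset> A"
    using C(1) by (auto simp: max_invariant_open_subgroups_def invariant_open_subgroups_def)
  have "B \<subseteq> C" using C(2) B(3) V(3) by auto
  moreover have "max_invariant_core G T A \<subseteq> C" using C(1) by (auto simp: max_invariant_core_alt)
  ultimately have "B <#> max_invariant_core G T A \<subseteq> C"
    using set_mult_least[OF normal_imp_subgroup[OF C'(1)]] by blast
  then show False using gen C'(2) by auto
qed

text \<open>If the core were all of \<open>A\<close>, then \<open>A\<close> would be generated by
  the trivial subgroup and non-generators.\<close>

lemma max_invariant_core_psubset: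
  assumes A: "A \<lhd> G" "A \<noteq> {\<one>}"
  shows "max_invariant_core G T A \<subset> A"
proof -
  have "max_invariant_core G T A \<noteq> A"
  proof
    assume eq: "max_invariant_core G T A = A"
    have "A \<subseteq> {\<one>} <#> max_invariant_core G T A"
      unfolding eq using set_mult_superset[OF triv_subgroup normal_imp_subgroup[OF A(1)]] by blast
    then show False
      using max_invariant_core_nongenerating[OF A(1) one_is_normal closedin_one] A
        subgroup.one_closed[OF normal_imp_subgroup[OF A(1)]] by auto
  qed
  then show ?thesis using max_invariant_core_subset by auto
qed

text \<open>If the core of \<open>A\<close> is trivial, then a minimal normal supplement of a maximal invariant open
  subgroup is a complement, hence finite.\<close>

lemma finite_normal_if_core_trivial:
  assumes A: "A \<lhd> G" "closedin T A" "A \<noteq> {\<one>}" and core: "max_invariant_core G T A = {\<one>}"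
  shows "\<exists>C. C \<lhd> G \<and> finite C \<and> C \<noteq> {\<one>}"
proof -
  note sA = normal_imp_subgroup[OF A(1)]
  have "max_invariant_open_subgroups A \<noteq> {}"
    using core A(3) by (auto simp: max_invariant_core_alt)
  then obtain B where B: "B \<in> max_invariant_open_subgroups A" by auto
  have Binv: "B \<in> invariant_open_subgroups G T A" using B by (auto simp: max_invariant_open_subgroups_def)
  then have B': "B \<lhd> G" "B \<subset> A" "closedin T B"
    using closedin_invariant_open[OF A(1,2)] by (auto simp: invariant_open_subgroups_def)
  interpret B: normal B G by fact
  let ?S = "{C. C \<lhd> G \<and> closedin T C \<and> C \<subseteq> A \<and> A \<subseteq> C <#> B}"
  have "\<exists>M\<in>?S. \<forall>X\<in>?S. X \<subseteq> M \<longrightarrow> X = M"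
  proof (rule ex_minimal_set)
    show "?S \<noteq> {}" using A set_mult_superset[OF sA B.subgroup_axioms] by blast
    fix \<C> assume ne: "\<C> \<noteq> {}" and sub: "\<C> \<subseteq> ?S"
      and ch: "\<And>C D. C \<in> \<C> \<Longrightarrow> D \<in> \<C> \<Longrightarrow> C \<subseteq> D \<or> D \<subseteq> C"
    have "A \<subseteq> \<Inter>\<C> <#> B"
    proof
      fix a assume a: "a \<in> A"
      then have aG: "a \<in> carrier G" using subgroup.subset[OF sA] by auto
      \<comment> \<open>This is the coset \<open>a B\<close>. As \<open>a\<close> lies in
        \<open>C B\<close> exactly when \<open>C\<close> meets \<open>a B\<close>, compactness shows
        that the intersection of a chain of supplements is a supplement.\<close>
      let ?W = "{x \<in> carrier G. inv x \<otimes> a \<in> B}"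
      have "\<Inter>((\<lambda>C. C \<inter> ?W) ` \<C>) \<noteq> {}"
      proof (rule compact_directed_Inter_nonempty[OF compact])
        show "(\<lambda>C. C \<inter> ?W) ` \<C> \<noteq> {}" using ne by auto
        fix X assume "X \<in> (\<lambda>C. C \<inter> ?W) ` \<C>"
        then obtain C where C: "C \<in> \<C>" "X = C \<inter> ?W" by auto
        then have C': "closedin T C" "C \<subseteq> A" "A \<subseteq> C <#> B" using sub by auto
        show "closedin T X"
          unfolding C(2) by (intro closedin_Int closedin_preimage continuous_intros B' C' aG)
        obtain c b where "c \<in> C" "b \<in> B" "a = c \<otimes> b" using C'(3) a by (auto simp: set_mult_def)
        then have "c \<in> X" using C C'(2) subgroup.subset[OF sA] B.subset by (auto simp: inv_mult_cancel subset_iff)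
        then show "X \<noteq> {}" by auto
      next
        fix X Y assume "X \<in> (\<lambda>C. C \<inter> ?W) ` \<C>" "Y \<in> (\<lambda>C. C \<inter> ?W) ` \<C>"
        then obtain C D where "C \<in> \<C>" "X = C \<inter> ?W" "D \<in> \<C>" "Y = D \<inter> ?W" by auto
        then show "\<exists>E\<in>(\<lambda>C. C \<inter> ?W) ` \<C>. E \<subseteq> X \<inter> Y"
          using ch[of C D] by auto
      qed
      then obtain c where c: "c \<in> carrier G" "c \<in> \<Inter>\<C>" "inv c \<otimes> a \<in> B" using ne by blast
      then have "a = c \<otimes> (inv c \<otimes> a)" using aG by (simp add: inv_mult_cancel)
      then show "a \<in> \<Inter>\<C> <#> B" using c unfolding set_mult_def by blast
    qed
    moreover have "\<Inter>\<C> \<lhd> G" using ne sub by (intro normal_Inter) auto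
    moreover have "closedin T (\<Inter>\<C>)" using ne sub by (intro closedin_Inter) auto
    moreover have "\<Inter>\<C> \<subseteq> A" using ne sub by blast
    ultimately show "\<Inter>\<C> \<in> ?S" by blast
  qed
  then obtain C where CS: "C \<in> ?S" and min': "\<forall>X\<in>?S. X \<subseteq> C \<longrightarrow> X = C" by (rule bexE)
  then have C: "C \<lhd> G" "closedin T C" "C \<subseteq> A" "A \<subseteq> C <#> B" by auto
  have min: "X = C" if "X \<in> ?S" "X \<subseteq> C" for X
    using bspec[OF min' that(1)] that(2) by (rule mp)
  interpret C: normal C G by fact
  have CB: "C \<inter> B = {\<one>}"
  proof (rule ccontr)
    assume "C \<inter> B \<noteq> {\<one>}"
    then have "\<not> C \<inter> B \<subseteq> max_invariant_core G T A"
      using core C.one_closed B.one_closed by auto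
    then obtain D where D: "D \<in> max_invariant_open_subgroups A" "\<not> C \<inter> B \<subseteq> D"
      using C(3) by (auto simp: max_invariant_core_alt)
    have Dinv: "D \<in> invariant_open_subgroups G T A" using D by (auto simp: max_invariant_open_subgroups_def)
    then have D': "D \<lhd> G" "D \<subset> A" "closedin T D"
      using closedin_invariant_open[OF A(1,2)] by (auto simp: invariant_open_subgroups_def)
    interpret D: normal D G by fact
    have CBn: "C \<inter> B \<lhd> G" using C(1) B'(1) normal_subgroup_intersect by blast
    let ?H = "(C \<inter> B) <#> D"
    have H: "?H \<lhd> G" by (rule normal_set_mult_normal[OF D'(1) CBn])
    have HD: "D \<subseteq> ?H" "C \<inter> B \<subseteq> ?H"
      using set_mult_superset[OF normal_imp_subgroup[OF CBn] D.subgroup_axioms] by auto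
    have HA: "?H \<subseteq> A" using C(3) D'(2) by (intro set_mult_least[OF sA]) auto
    have HeqA: "?H = A"
    proof (rule ccontr)
      assume "?H \<noteq> A"
      then have "?H \<in> invariant_open_subgroups G T A"
        using invariant_open_subgroups_upward[OF A(1) Dinv H HD(1)] HA by auto
      then have "?H = D" using D(1) HD(1) by (auto simp: max_invariant_open_subgroups_def)
      then show False using HD(2) D(2) by auto
    qed
    \<comment> \<open>From \<open>a = c b\<close> and \<open>c = x d\<close> with \<open>x\<close>
      in \<open>C \<inter> B\<close>, the element \<open>d\<close> lies in
      \<open>C \<inter> D\<close>; moving \<open>x\<close> past \<open>d\<close> conjugates it
      inside the normal subgroup \<open>B\<close>.\<close>
    have "A \<subseteq> (C \<inter> D) <#> B"
    proof
      fix a assume "a \<in> A"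
      then obtain c b where cb: "c \<in> C" "b \<in> B" "a = c \<otimes> b" using C(4) by (auto simp: set_mult_def)
      then have "c \<in> ?H" using C(3) HeqA by auto
      then obtain x d where xd: "x \<in> C" "x \<in> B" "d \<in> D" "c = x \<otimes> d" by (auto simp: set_mult_def)
      have G: "x \<in> carrier G" "d \<in> carrier G" "b \<in> carrier G" using xd cb D.subset B.subset by auto
      have "inv x \<otimes> c = d" using xd G by (simp add: inv_mult_cancel)
      moreover have "inv x \<otimes> c \<in> C" using xd(1) cb(1) by simp
      ultimately have dC: "d \<in> C" by simp
      have "a = d \<otimes> ((inv d \<otimes> x \<otimes> d) \<otimes> b)" using cb xd G by (simp add: word_simps)
      moreover have "(inv d \<otimes> x \<otimes> d) \<otimes> b \<in> B" using B.inv_op_closed1 xd cb G by auto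
      ultimately show "a \<in> (C \<inter> D) <#> B" using dC xd unfolding set_mult_def by blast
    qed
    then have "C \<inter> D = C"
      using C D' normal_subgroup_intersect by (intro min) auto
    then show False using D(2) by auto
  qed
  \<comment> \<open>Since \<open>B = A \<inter> V\<close>, the complement \<open>C\<close> meets the
    open subgroup \<open>V\<close> trivially, so its elements represent distinct cosets of
    \<open>V\<close>.\<close>
  obtain V where V: "V \<lhd> G" "openin T V" "B = A \<inter> V"
    using Binv invariant_open_subgroups_iff[OF A(1)] by auto
  have "finite ((\<lambda>a. (C \<inter> V) #> a) ` C)"
    using finite_cosets_Int_open[OF C.subgroup_axioms normal_imp_subgroup[OF V(1)] V(2)] .
  moreover have "C \<inter> V = {\<one>}" using CB C(3) V(3) by auto
  moreover have "(\<lambda>a. {\<one>} #> a) ` C = (\<lambda>a. {a}) ` C"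
    using C.subset by (intro image_cong) (auto simp: r_coset_def)
  ultimately have "finite C" by (simp add: finite_image_iff)
  moreover have "C \<noteq> {\<one>}"
  proof
    assume "C = {\<one>}"
    then have "A \<subseteq> B" using C(4) B.subset by (auto simp: set_mult_def)
    then show False using B'(2) by auto
  qed
  ultimately show ?thesis using C(1) by blast
qed

end

section \<open>The invariant core under epimorphisms\<close>

context profinite_epi
begin

text \<open>The part of \<open>A\<close> mapping into a maximal \<open>B'\<close> is itself maximal:
  a larger proper \<open>C\<close> contains all elements of \<open>A\<close> that map to the
  identity, so its image remains proper and, lying above \<open>B'\<close>, equals
  \<open>B'\<close>. Only this inclusion of cores is required for (iii).\<close>

lemma image_max_invariant_core:
  assumes A: "A \<lhd> G"
  shows "f ` max_invariant_core G T A \<subseteq> max_invariant_core G' T' (f ` A)"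
proof -
  note sA = normal_imp_subgroup[OF A]
  note fA = normal_image[OF A]
  have "f ` max_invariant_core G T A \<subseteq> B'" if B': "B' \<in> G'.max_invariant_open_subgroups (f ` A)" for B'
  proof -
    have inv': "B' \<in> invariant_open_subgroups G' T' (f ` A)"
      using B' by (auto simp: G'.max_invariant_open_subgroups_def)
    then obtain V where V: "V \<lhd> G'" "openin T' V" "B' = f ` A \<inter> V" "\<not> f ` A \<subseteq> V"
      using G'.invariant_open_subgroups_iff[OF fA] by auto
    let ?B = "A \<inter> {x \<in> carrier G. f x \<in> V}"
    have Binv: "?B \<in> invariant_open_subgroups G T A"
      using V normal_vimage[OF V(1)] openin_vimage[OF V(2)] subgroup.subset[OF sA]
      unfolding invariant_open_subgroups_iff[OF A] by blast
    have "C = ?B" if C: "C \<in> invariant_open_subgroups G T A" "?B \<subseteq> C" for C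
    proof -
      have C': "C \<lhd> G" "C \<subset> A" using C(1) by (auto simp: invariant_open_subgroups_def)
      note sC = normal_imp_subgroup[OF C'(1)]
      have "f ` C \<noteq> f ` A"
      proof
        assume eq: "f ` C = f ` A"
        have "A \<subseteq> C"
        proof
          fix a assume a: "a \<in> A"
          then obtain c where c: "c \<in> C" "f a = f c" using eq by auto
          have G: "a \<in> carrier G" "c \<in> carrier G" using a c subgroup.subset[OF sA] subgroup.subset[OF sC] by auto
          have "c \<in> A" using c C' by auto
          then have "a \<otimes> inv c \<in> A" using a subgroup.m_closed[OF sA] subgroup.m_inv_closed[OF sA] by auto
          moreover have "f (a \<otimes> inv c) \<in> V"
            using G c subgroup.one_closed[OF normal_imp_subgroup[OF V(1)]] by simp
          ultimately have "a \<otimes> inv c \<in> C" using C(2) G by auto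
          then have "(a \<otimes> inv c) \<otimes> c \<in> C" using c subgroup.m_closed[OF sC] by auto
          then show "a \<in> C" using G by (simp add: m_assoc)
        qed
        then show False using C' by auto
      qed
      moreover have "B' \<subseteq> f ` C"
      proof
        fix y assume "y \<in> B'"
        then obtain a where "a \<in> A" "y = f a" "f a \<in> V" using V(3) by auto
        then show "y \<in> f ` C" using C(2) subgroup.subset[OF sA] by auto
      qed
      ultimately have "f ` C \<in> invariant_open_subgroups G' T' (f ` A)"
        using G'.invariant_open_subgroups_upward[OF fA inv' normal_image[OF C'(1)]] C'(2) by auto
      then have "f ` C = B'" using B' \<open>B' \<subseteq> f ` C\<close> by (auto simp: G'.max_invariant_open_subgroups_def)
      then have "C \<subseteq> ?B" using V(3) C' subgroup.subset[OF sA] by auto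
      then show ?thesis using C(2) by auto
    qed
    then have "?B \<in> max_invariant_open_subgroups A"
      using Binv unfolding max_invariant_open_subgroups_def by blast
    then show ?thesis using V(3) by (auto simp: max_invariant_core_alt)
  qed
  then show ?thesis
    using max_invariant_core_subset by (auto simp: G'.max_invariant_core_alt)
qed

text \<open>\<open>A\<close> lies in the product of the kernel and \<open>B\<close>. As the kernel
  sits inside the core \<open>M\<close> of \<open>A\<close>, this becomes
  \<open>A = (A \<inter> B) M\<close>, and \<open>M\<close> consists of non-generators. In the
  converse it lifts inclusions from one level of the system to the next.\<close>

lemma subset_if_image_subset:
  assumes A: "A \<lhd> G" and B: "B \<lhd> G" "closedin T A" "closedin T B"
    and ker: "kernel G G' f \<subseteq> max_invariant_core G T A" and sub: "f ` A \<subseteq> f ` B"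
  shows "A \<subseteq> B"
proof -
  let ?M = "max_invariant_core G T A"
  note sA = normal_imp_subgroup[OF A] and sB = normal_imp_subgroup[OF B(1)]
  have M: "?M \<lhd> G" "?M \<subseteq> A" using max_invariant_core_normal[OF A] max_invariant_core_subset by auto
  have "A \<subseteq> (A \<inter> B) <#> ?M"
  proof
    fix a assume a: "a \<in> A"
    then have "a \<in> kernel G G' f <#> B"
      using sub vimage_image[OF subgroup.subset[OF sB]] subgroup.subset[OF sA] by blast
    then obtain k b where kb: "k \<in> ?M" "b \<in> B" "a = k \<otimes> b"
      using ker unfolding set_mult_def by blast
    have G: "k \<in> carrier G" "b \<in> carrier G"
      using kb M(2) subgroup.subset[OF sA] subgroup.subset[OF sB] by auto
    have "inv k \<otimes> a \<in> A"
      using a kb(1) M(2) subgroup.m_closed[OF sA] subgroup.m_inv_closed[OF sA] by blast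
    then have "b \<in> A" using kb(3) G by (simp add: inv_mult_cancel)
    moreover have "a = b \<otimes> (inv b \<otimes> k \<otimes> b)"
      using kb(3) G by (simp add: word_simps)
    moreover have "inv b \<otimes> k \<otimes> b \<in> ?M"
      using normal.inv_op_closed1[OF M(1) G(2) kb(1)] .
    ultimately show "a \<in> (A \<inter> B) <#> ?M" using kb(2) unfolding set_mult_def by blast
  qed
  then have "A \<inter> B = A"
    using A B normal_subgroup_intersect by (intro max_invariant_core_nongenerating[OF A]) auto
  then show ?thesis by blast
qed

end

text \<open>Left-normed commutators with entries in \<open>Y\<close>; index \<open>n\<close>
  corresponds to weight \<open>n+1\<close>.\<close>

fun iterated_commutators :: "('a, 'm) monoid_scheme \<Rightarrow> 'a set \<Rightarrow> nat \<Rightarrow> 'a set" where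
  "iterated_commutators G Y 0 = Y"
| "iterated_commutators G Y (Suc n) = (\<lambda>(s, y). commutator G s y) ` (iterated_commutators G Y n \<times> Y)"

lemma finite_iterated_commutators: "finite Y \<Longrightarrow> finite (iterated_commutators G Y n)"
  by (induction n) auto

context group
begin

lemma commutator_conj_eq:
  assumes "x \<in> carrier G" "a \<in> carrier G"
  shows "inv a \<otimes> x \<otimes> a = x \<otimes> commutator G x a"
  using assms by (simp add: commutator_def word_simps)

lemma r_coset_mult_cong:
  assumes "V \<lhd> G" "x \<in> carrier G" "x' \<in> carrier G" "y \<in> carrier G" "y' \<in> carrier G"
    and "V #> x = V #> x'" "V #> y = V #> y'"
  shows "V #> (x \<otimes> y) = V #> (x' \<otimes> y')"
  using assms normal.rcos_sum[OF assms(1)] by metis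

lemma r_coset_pow_cong:
  assumes "V \<lhd> G" "x \<in> carrier G" "x' \<in> carrier G" "V #> x = V #> x'"
  shows "V #> (x [^] (k::nat)) = V #> (x' [^] k)"
proof (induction k)
  case (Suc k)
  then show ?case
    using r_coset_mult_cong[OF assms(1) _ _ assms(2,3) _ assms(4), of "x [^] k" "x' [^] k"] assms(2,3) by simp
qed simp

lemma r_coset_mult_right_mem:
  assumes "V \<lhd> G" "x \<in> carrier G" "v \<in> V"
  shows "V #> (x \<otimes> v) = V #> x"
proof -
  interpret normal V G by fact
  have "V #> (x \<otimes> v) = V #> (x \<otimes> \<one>)"
    using assms by (intro r_coset_mult_cong) (auto simp: coset_join2 subgroup_axioms subset)
  then show ?thesis using assms by simp
qed

lemma r_coset_eq_imp_right:
  assumes "V \<lhd> G" "x \<in> carrier G" "y \<in> carrier G" "V #> x = V #> y"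
  shows "\<exists>v\<in>V. x = y \<otimes> v"
proof -
  interpret normal V G by fact
  have "x \<in> V #> y" using rcos_self[OF assms(2) subgroup_axioms] assms(4) by simp
  then obtain v where v: "v \<in> V" "x = v \<otimes> y" by (auto simp: r_coset_def)
  then have "x = y \<otimes> (inv y \<otimes> v \<otimes> y)" using assms(3) subset by (auto simp: word_simps)
  then show ?thesis using inv_op_closed1 v assms(3) by blast
qed

lemma countable_generate:
  assumes "finite X" "X \<subseteq> carrier G"
  shows "countable (generate G X)"
proof -
  let ?X = "X \<union> m_inv G ` X"
  have fc: "foldr (\<otimes>) xs \<one> \<in> carrier G" if "xs \<in> lists ?X" for xs
    using that assms(2) by (induction xs) auto
  have fa: "foldr (\<otimes>) (xs @ ys) \<one> = foldr (\<otimes>) xs \<one> \<otimes> foldr (\<otimes>) ys \<one>"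
    if "xs \<in> lists ?X" "ys \<in> lists ?X" for xs ys
    using that(1)
  proof (induction xs)
    case (Cons x xs)
    then show ?case using fc[of xs] fc[OF that(2)] assms(2) by (auto simp: m_assoc)
  qed (use fc[OF that(2)] in simp)
  have "x \<in> (\<lambda>xs. foldr (\<otimes>) xs \<one>) ` lists ?X" if "x \<in> generate G X" for x
    using that
  proof induction
    case one
    then show ?case by (rule image_eqI[of _ _ "[]"]) auto
  next
    case (incl h)
    then show ?case using assms(2) by (intro image_eqI[of _ _ "[h]"]) auto
  next
    case (inv h)
    then show ?case using assms(2) by (intro image_eqI[of _ _ "[inv h]"]) auto
  next
    case (eng h1 h2)
    then obtain xs ys where "xs \<in> lists ?X" "ys \<in> lists ?X"
      "h1 = foldr (\<otimes>) xs \<one>" "h2 = foldr (\<otimes>) ys \<one>" by blast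
    then show ?case by (intro image_eqI[of _ _ "xs @ ys"]) (auto simp only: fa append_in_lists_conv)
  qed
  then have "generate G X \<subseteq> (\<lambda>xs. foldr (\<otimes>) xs \<one>) ` lists ?X" by (rule subsetI)
  moreover have "countable (lists ?X)" using assms(1) by (intro countable_lists countable_finite) auto
  then have "countable ((\<lambda>xs. foldr (\<otimes>) xs \<one>) ` lists ?X)" by (rule countable_image)
  ultimately show ?thesis by (rule countable_subset)
qed

end

context profinite_group
begin

section \<open>Lower central series of a product\<close>

text \<open>Weights are counted separately: the term \<open>lcs m (D F)\<close> lies in the closed
  subgroup generated by the elements that have some weight \<open>i\<close> in \<open>D\<close> and
  some weight \<open>j\<close> in \<open>F\<close> with \<open>i + j = m\<close>. For
  \<open>m = 2c+1\<close> one of the two weights is at least \<open>c+1\<close>.\<close>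

lemma lower_central_set_mult:
  assumes D: "D \<lhd> G" "closedin T D" and F: "F \<lhd> G" "closedin T F"
  shows "lcs (2 * c + 1) (D <#> F) \<subseteq> lcs (c + 1) D <#> lcs (c + 1) F"
proof -
  \<comment> \<open>Weight \<open>0\<close> has to impose no condition, so the dummy value at index
    \<open>0\<close> is replaced by the whole group.\<close>
  define lc where "lc i K = (if i = 0 then carrier G else lcs i K)" for i K
  have lc_normal: "lc i K \<lhd> G" if "K \<lhd> G" for i K
    using lower_central_normal[OF that] self_factor_iso by (auto simp: lc_def normal_inv_iff subgroup_self)
  have lc_comm: "commutator G x y \<in> lc (Suc i) K" if "K \<lhd> G" "x \<in> lc i K" "y \<in> K" for x y i K
  proof (cases "i = 0")
    case True
    then show ?thesis
      using that commutator_in_normal[OF that(1), of x y] normal_imp_subgroup[OF that(1), THEN subgroup.subset]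
      by (auto simp: lc_def)
  next
    case False
    then show ?thesis using that commutator_in_lower_central[of i x K y] by (auto simp: lc_def)
  qed
  define S where "S m = {x. \<exists>i j. i + j = m \<and> x \<in> lc i D \<and> x \<in> lc j F}" for m
  have lcG: "x \<in> carrier G" if "K \<lhd> G" "x \<in> lc i K" for x i K
    using that lc_normal[OF that(1)] normal_imp_subgroup subgroup.mem_carrier by metis
  have SG: "S m \<subseteq> carrier G" for m
    using lcG[OF D(1)] by (auto simp: S_def)
  have W: "closed_generate G T (S m) \<lhd> G" for m
  proof (rule closed_generate_normal[OF SG])
    fix g s assume g: "g \<in> carrier G" "s \<in> S m"
    then obtain i j where "i + j = m" "s \<in> lc i D" "s \<in> lc j F" by (auto simp: S_def)
    then have "g \<otimes> s \<otimes> inv g \<in> S m"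
      using g normal.inv_op_closed2[OF lc_normal[OF D(1)]] normal.inv_op_closed2[OF lc_normal[OF F(1)]]
      unfolding S_def by blast
    then show "g \<otimes> s \<otimes> inv g \<in> closed_generate G T (S m)" using closed_generate_superset by blast
  qed
  note sD = normal_imp_subgroup[OF D(1)] and sF = normal_imp_subgroup[OF F(1)]
  have DF: "subgroup (D <#> F) G" using normal_set_mult_subgroup[OF F(1) sD] .
  have key: "lcs m (D <#> F) \<subseteq> closed_generate G T (S m)" if "m \<ge> 1" for m
    using that
  proof (induction rule: lower_central_induct)
    case 1
    have "D \<subseteq> S 1"
    proof
      fix x assume "x \<in> D"
      then have "x \<in> lc 1 D" "x \<in> lc 0 F" using subgroup.subset[OF sD] by (auto simp: lc_def)
      then show "x \<in> S 1"
        unfolding S_def by (intro CollectI exI[of _ "1::nat"] exI[of _ "0::nat"] conjI) simp_all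
    qed
    moreover have "F \<subseteq> S 1"
    proof
      fix x assume "x \<in> F"
      then have "x \<in> lc 0 D" "x \<in> lc 1 F" using subgroup.subset[OF sF] by (auto simp: lc_def)
      then show "x \<in> S 1"
        unfolding S_def by (intro CollectI exI[of _ "0::nat"] exI[of _ "1::nat"] conjI) simp_all
    qed
    ultimately show ?case
      using set_mult_least[OF normal_imp_subgroup[OF W[of 1]]] closed_generate_superset[of "S 1"]
      by auto
  next
    case (Suc m)
    have comm: "commutator G s r \<in> closed_generate G T (S (Suc m))" if s: "s \<in> S m" and r: "r \<in> D \<union> F" for s r
    proof -
      obtain i j where ij: "i + j = m" "s \<in> lc i D" "s \<in> lc j F" using s by (auto simp: S_def)
      have G: "s \<in> carrier G" "r \<in> carrier G"
        using SG s r subgroup.subset[OF sD] subgroup.subset[OF sF] by auto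
      \<comment> \<open>A factor from \<open>D\<close> raises the weight in \<open>D\<close>, while
        normality of \<open>lc j F\<close> preserves the weight in \<open>F\<close>; symmetrically
        for a factor from \<open>F\<close>.\<close>
      have "commutator G s r \<in> S (Suc m)"
      proof (cases "r \<in> D")
        case True
        then have "commutator G s r \<in> lc (Suc i) D" "commutator G s r \<in> lc j F"
          using lc_comm[OF D(1) ij(2)] commutator_in_normal[OF lc_normal[OF F(1)] G] ij(3) by auto
        then show ?thesis using ij(1) unfolding S_def by (intro CollectI exI[of _ "Suc i"] exI[of _ j] conjI) simp_all
      next
        case False
        then have "commutator G s r \<in> lc i D" "commutator G s r \<in> lc (Suc j) F"
          using lc_comm[OF F(1) ij(3)] commutator_in_normal[OF lc_normal[OF D(1)] G] ij(2) r by auto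
        then show ?thesis using ij(1) unfolding S_def by (intro CollectI exI[of _ i] exI[of _ "Suc j"] conjI) simp_all
      qed
      then show ?thesis using closed_generate_superset by blast
    qed
    have gen: "commutator G x y \<in> closed_generate G T (S (Suc m))"
      if x: "x \<in> lcs m (D <#> F)" and y: "y \<in> D <#> F" for x y
    proof (rule closed_generate_commutator[OF subgroup_self closedin_carrier, where S = "S m" and R = "D \<union> F"])
      have sub: "D \<union> F \<subseteq> carrier G" using subgroup.subset[OF sD] subgroup.subset[OF sF] by auto
      show "y \<in> closed_generate G T (D \<union> F)"
        using set_mult_least[OF closed_generate_closed_subgroup(1)[OF sub]] closed_generate_superset[of "D \<union> F"] y
        by blast
      show "D \<union> F \<subseteq> carrier G" by fact
      show "x \<in> closed_generate G T (S m)" using x Suc.IH by auto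
    qed (use W SG comm normal.inv_op_closed2[OF W] closed_generate_closed_subgroup[OF SG] in auto)
    show ?case
      unfolding lower_central_Suc[OF Suc(1)] closed_commutator_alt
      by (rule closed_generate_least) (use closed_generate_closed_subgroup[OF SG] gen in auto)
  qed
  have "S (2 * c + 1) \<subseteq> lcs (c + 1) D <#> lcs (c + 1) F"
  proof
    fix x assume "x \<in> S (2 * c + 1)"
    then obtain i j where ij: "i + j = 2 * c + 1" "x \<in> lc i D" "x \<in> lc j F" by (auto simp: S_def)
    note sup = set_mult_superset[OF normal_imp_subgroup[OF lower_central_normal[OF D(1), of "c+1"]]
        normal_imp_subgroup[OF lower_central_normal[OF F(1), of "c+1"]]]
    show "x \<in> lcs (c + 1) D <#> lcs (c + 1) F"
    proof (cases "i \<ge> c + 1")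
      case True
      then have "x \<in> lcs (c + 1) D"
        using lower_central_antimono[OF D, of "c + 1" i] ij(2) by (auto simp: lc_def)
      then show ?thesis using sup by blast
    next
      case False
      then have "j \<ge> c + 1" using ij(1) by linarith
      then have "x \<in> lcs (c + 1) F"
        using lower_central_antimono[OF F, of "c + 1" j] ij(3) by (auto simp: lc_def)
      then show ?thesis using sup by blast
    qed
  qed
  moreover have "closedin T (lcs (c + 1) D <#> lcs (c + 1) F)"
    using lower_central_closed_subgroup(2)[OF sD D(2)] lower_central_closed_subgroup(2)[OF sF F(2)]
    by (intro closedin_set_mult)
  moreover have "subgroup (lcs (c + 1) D <#> lcs (c + 1) F) G"
    using lower_central_normal[OF D(1)] lower_central_normal[OF F(1)]
    by (intro normal_set_mult_subgroup) (auto simp: normal_imp_subgroup)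
  ultimately have "closed_generate G T (S (2 * c + 1)) \<subseteq> lcs (c + 1) D <#> lcs (c + 1) F"
    by (intro closed_generate_least)
  then show ?thesis using key[of "2 * c + 1"] by auto
qed

section \<open>Finitely generated profinite groups\<close>

text \<open>The product with \<open>N\<close> is an open subgroup, hence closed, and contains
  \<open>X\<close>; so the abstract subgroup generated by \<open>X\<close> is dense.\<close>

lemma dense_generate:
  assumes X: "X \<subseteq> carrier G" "closed_generate G T X = carrier G" and N: "N \<lhd> G" "openin T N"
  shows "generate G X <#> N = carrier G"
proof -
  have sub: "subgroup (generate G X) G" using generate_is_subgroup[OF X(1)] .
  have H: "subgroup (generate G X <#> N) G" by (rule normal_set_mult_subgroup[OF N(1) sub])
  note sup = set_mult_superset[OF sub normal_imp_subgroup[OF N(1)]]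
  have "openin T (generate G X <#> N)"
    by (rule openin_subgroup_mono[OF normal_imp_subgroup[OF N(1)] N(2) H sup(2)])
  then have "closedin T (generate G X <#> N)" using closedin_open_subgroup[OF H] by simp
  moreover have "X \<subseteq> generate G X <#> N" using sup(1) generate.incl[of _ X G] by auto
  ultimately have "carrier G \<subseteq> generate G X <#> N" using closed_generate_least[OF H] X(2) by auto
  then show ?thesis using subgroup.subset[OF H] by auto
qed

text \<open>Schreier generators for a transversal taken inside the dense subgroup generated by \<open>X\<close>.\<close>

lemma open_subgroup_generators:
  assumes X: "finite X" "X \<subseteq> carrier G" "closed_generate G T X = carrier G"
    and L: "subgroup L G" "openin T L"
  shows "\<exists>Y. finite Y \<and> Y \<subseteq> generate G X \<and> Y \<subseteq> L \<and> closed_generate G T Y = L"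
proof -
  interpret L: subgroup L G by fact
  have sD: "subgroup (generate G X) G" using generate_is_subgroup[OF X(2)] .
  obtain N where N: "N \<lhd> G" "openin T N" "N \<subseteq> L" using open_normal_subset_subgroup[OF L] by blast
  have "\<exists>t. t \<in> generate G X \<and> t \<in> C" if "C \<in> rcosets L" for C
  proof -
    obtain g where g: "g \<in> carrier G" "C = L #> g"
      using \<open>C \<in> rcosets L\<close> by (auto simp: RCOSETS_def)
    then have "g \<in> generate G X <#> N"
      using dense_generate[OF X(2,3) N(1,2)] by simp
    then obtain d n where dn: "d \<in> generate G X" "n \<in> N" "g = d \<otimes> n"
      by (auto simp: set_mult_def)
    have G: "d \<in> carrier G" "n \<in> carrier G"
      using dn subgroup.mem_carrier[OF sD] subgroup.mem_carrier[OF normal_imp_subgroup[OF N(1)]] by auto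
    then have "d = (d \<otimes> inv n \<otimes> inv d) \<otimes> g" using dn by (simp add: word_simps)
    moreover have "d \<otimes> inv n \<otimes> inv d \<in> L"
      using normal.inv_op_closed2[OF N(1) G(1)] dn(2) N subgroup.m_inv_closed[OF normal_imp_subgroup[OF N(1)]]
      by blast
    ultimately show ?thesis using dn(1) g(2) unfolding r_coset_def by blast
  qed
  then obtain t0 where t0: "\<And>C. C \<in> rcosets L \<Longrightarrow> t0 C \<in> generate G X \<and> t0 C \<in> C" by metis
  \<comment> \<open>The coset \<open>L\<close> is represented by \<open>\<one>\<close>, so that an
    element of \<open>L\<close> written as \<open>k\<close> times its representative, with
    \<open>k\<close> in \<open>?\<Lambda>\<close> as defined below, already lies in
    \<open>?\<Lambda>\<close>.\<close>
  define t where "t C = (if C = L then \<one> else t0 C)" for C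
  have tD: "t C \<in> generate G X" and tC: "t C \<in> C" if "C \<in> rcosets L" for C
    using t0[OF that] generate.one L.one_closed by (auto simp: t_def)
  have tG: "t C \<in> carrier G" if "C \<in> rcosets L" for C using tD[OF that] subgroup.mem_carrier[OF sD] by auto
  let ?X = "X \<union> m_inv G ` X"
  let ?y = "\<lambda>(C, x). t C \<otimes> x \<otimes> inv (t (L #> (t C \<otimes> x)))"
  let ?Y = "?y ` ((rcosets L) \<times> ?X)"
  let ?\<Lambda> = "closed_generate G T ?Y"
  have XG: "x \<in> carrier G" and XD: "x \<in> generate G X" if "x \<in> ?X" for x
    using that X(2) by (auto intro: generate.incl generate.inv)
  have yL: "?y (C, x) \<in> L" and yD: "?y (C, x) \<in> generate G X" if "C \<in> rcosets L" "x \<in> ?X" for C x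
  proof -
    have G: "t C \<otimes> x \<in> carrier G" using tG[OF that(1)] XG[OF that(2)] by simp
    then have C': "L #> (t C \<otimes> x) \<in> rcosets L" using L.subset rcosetsI by auto
    have "t (L #> (t C \<otimes> x)) \<in> L #> (t C \<otimes> x)" using tC[OF C'] .
    then obtain l where l: "l \<in> L" "t (L #> (t C \<otimes> x)) = l \<otimes> (t C \<otimes> x)" by (auto simp: r_coset_def)
    have lG: "l \<in> carrier G" using l L.subset by auto
    have "(t C \<otimes> x) \<otimes> inv (l \<otimes> (t C \<otimes> x)) = inv l"
      using tG[OF that(1)] XG[OF that(2)] lG by (simp add: word_simps)
    then show "?y (C, x) \<in> L" using l by simp
    show "?y (C, x) \<in> generate G X"
      using tD[OF that(1)] tD[OF C'] XD[OF that(2)] subgroup.m_closed[OF sD] subgroup.m_inv_closed[OF sD] by simp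
  qed
  have Ysub: "?Y \<subseteq> L" "?Y \<subseteq> generate G X" using yL yD by auto
  then have YG: "?Y \<subseteq> carrier G" using L.subset by auto
  note \<Lambda> = closed_generate_closed_subgroup[OF YG]
  interpret \<Lambda>: subgroup ?\<Lambda> G by (rule \<Lambda>(1))
  have \<Lambda>L: "?\<Lambda> \<subseteq> L" using closed_generate_least[OF L(1) closedin_open_subgroup[OF L]] Ysub by blast
  \<comment> \<open>A finite union of closed cosets, stable under right multiplication by generators
    and their inverses thanks to the choice of \<open>?y\<close>. It therefore contains the dense
    subgroup and, being closed, all of \<open>G\<close>.\<close>
  define U where "U = (\<Union>C\<in>rcosets L. ?\<Lambda> #> t C)"
  have Ucl: "closedin T U"
    unfolding U_def using finite_rcosets_open[OF L] closedin_r_coset[OF \<Lambda>(2)] tG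
    by (intro closedin_Union) auto
  have UG: "U \<subseteq> carrier G" using closedin_subset_carrier[OF Ucl] .
  have step: "u \<otimes> x \<in> U" if "u \<in> U" "x \<in> ?X" for u x
  proof -
    obtain C l where C: "C \<in> rcosets L" "l \<in> ?\<Lambda>" "u = l \<otimes> t C"
      using \<open>u \<in> U\<close> by (auto simp: U_def r_coset_def)
    let ?C = "L #> (t C \<otimes> x)"
    have G: "t C \<in> carrier G" "x \<in> carrier G" "l \<in> carrier G" using C tG XG[OF that(2)] \<Lambda>.subset by auto
    then have C': "?C \<in> rcosets L" using L.subset rcosetsI by auto
    have "u \<otimes> x = (l \<otimes> ?y (C, x)) \<otimes> t ?C"
      using G tG[OF C'] C by (simp add: word_simps)
    moreover have "?y (C, x) \<in> ?\<Lambda>"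
      using C(1) that(2) by (intro subsetD[OF closed_generate_superset] imageI) simp
    ultimately have "u \<otimes> x \<in> ?\<Lambda> #> t ?C" using \<Lambda>.m_closed[OF C(2)] unfolding r_coset_def by blast
    then show ?thesis using C' unfolding U_def by blast
  qed
  have step': "\<forall>u\<in>U. u \<otimes> g \<in> U" if "g \<in> generate G X" for g
    using that
  proof induction
    case (eng g h)
    have "u \<otimes> (g \<otimes> h) = (u \<otimes> g) \<otimes> h" if "u \<in> U" for u
      using that UG eng(1,2) subgroup.mem_carrier[OF sD] by (auto simp: m_assoc subset_iff)
    then show ?case using eng by auto
  qed (use UG step in auto)
  have Lcos: "L \<in> rcosets L" by (rule L.subgroup_in_rcosets[OF is_group])
  have "\<one> \<in> U"
    unfolding U_def using Lcos rcos_self[OF one_closed \<Lambda>.subgroup_axioms] by (auto intro!: bexI[of _ L] simp: t_def)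
  then have DU: "generate G X \<subseteq> U" using step' subgroup.mem_carrier[OF sD] by fastforce
  have "carrier G \<subseteq> U"
  proof
    fix x assume "x \<in> carrier G"
    then show "x \<in> U"
      using dense_generate[OF X(2,3)] mono_set_mult[OF DU order_refl]
      by (intro closed_memI[OF Ucl]) blast+
  qed
  have "L \<subseteq> ?\<Lambda>"
  proof
    fix l assume l: "l \<in> L"
    then obtain C k where C: "C \<in> rcosets L" "k \<in> ?\<Lambda>" "l = k \<otimes> t C"
      using \<open>carrier G \<subseteq> U\<close> L.subset by (auto simp: U_def r_coset_def)
    have G: "k \<in> carrier G" "t C \<in> carrier G" using C tG \<Lambda>.subset by auto
    have "inv k \<otimes> l \<in> L" using C(2) l \<Lambda>L by auto
    moreover have "inv k \<otimes> l = t C" using C(3) G by (simp add: inv_mult_cancel)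
    ultimately have "t C \<in> L" by simp
    then have "t C \<in> C \<inter> L" using tC[OF C(1)] by simp
    then have "C = L" using rcos_disjoint[OF L(1)] C(1) Lcos by (fastforce simp: pairwise_def disjnt_iff)
    then show "l \<in> ?\<Lambda>" using C(2,3) G(1) by (simp add: t_def)
  qed
  then have "?\<Lambda> = L" using \<Lambda>L by auto
  moreover have "finite ?Y" using finite_rcosets_open[OF L] X(1) by auto
  ultimately show ?thesis using Ysub by blast
qed

lemma fin_generated_iff:
  "fin_generated G T \<longleftrightarrow> (\<exists>X. finite X \<and> X \<subseteq> carrier G \<and> closed_generate G T X = carrier G)"
proof
  assume "\<exists>X. finite X \<and> X \<subseteq> carrier G \<and> closed_generate G T X = carrier G"
  then obtain X where X: "finite X" "X \<subseteq> carrier G" "closed_generate G T X = carrier G" by auto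
  obtain xs where "set xs = X" using finite_list[OF X(1)] by auto
  then show "fin_generated G T" using X by (auto simp: fin_generated_def d_generator_def)
next
  assume "fin_generated G T"
  then show "\<exists>X. finite X \<and> X \<subseteq> carrier G \<and> closed_generate G T X = carrier G"
    unfolding fin_generated_def d_generator_def by blast
qed

text \<open>An open normal subgroup is recovered from a finite set of topological generators inside
  the countable group generated by \<open>X\<close>, and there are only countably many such
  sets.\<close>

lemma countable_open_normal_base:
  assumes "fin_generated G T"
  shows "\<exists>U :: nat \<Rightarrow> 'a set. (\<forall>n. U n \<lhd> G \<and> openin T (U n)) \<and>
           (\<forall>N. N \<lhd> G \<and> openin T N \<longrightarrow> (\<exists>n. U n \<subseteq> N))"
proof -
  obtain X where X: "finite X" "X \<subseteq> carrier G" "closed_generate G T X = carrier G"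
    using assms fin_generated_iff by auto
  let ?\<N> = "{N. N \<lhd> G \<and> openin T N}"
  have "?\<N> \<subseteq> closed_generate G T ` {Y. finite Y \<and> Y \<subseteq> generate G X}"
  proof
    fix N assume "N \<in> ?\<N>"
    then obtain Y where "finite Y" "Y \<subseteq> generate G X" "closed_generate G T Y = N"
      using open_subgroup_generators[OF X] normal_imp_subgroup by blast
    then show "N \<in> closed_generate G T ` {Y. finite Y \<and> Y \<subseteq> generate G X}" by blast
  qed
  moreover have "countable {Y. finite Y \<and> Y \<subseteq> generate G X}"
    using countable_Collect_finite_subset[OF countable_generate[OF X(1,2)]] by simp
  then have "countable (closed_generate G T ` {Y. finite Y \<and> Y \<subseteq> generate G X})" by (rule countable_image)
  ultimately have "countable ?\<N>" by (rule countable_subset)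
  moreover have "carrier G \<in> ?\<N>" using openin_carrier by (auto simp: normal_inv_iff subgroup_self)
  ultimately have "range (from_nat_into ?\<N>) = ?\<N>" by (intro range_from_nat_into) auto
  then have 1: "from_nat_into ?\<N> n \<in> ?\<N>" and 2: "N \<in> range (from_nat_into ?\<N>)" if "N \<in> ?\<N>" for n N
    using that by auto
  show ?thesis
  proof (intro exI[of _ "from_nat_into ?\<N>"] conjI allI impI)
    show "from_nat_into ?\<N> n \<lhd> G" "openin T (from_nat_into ?\<N> n)" for n
      using 1[OF \<open>carrier G \<in> ?\<N>\<close>] by auto
    fix N assume "N \<lhd> G \<and> openin T N"
    then obtain n where "N = from_nat_into ?\<N> n" using 2[of N] by auto
    then show "\<exists>n. from_nat_into ?\<N> n \<subseteq> N" by blast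
  qed
qed

end

section \<open>Finiteness of lower central sections\<close>

context group
begin

lemma set_mult_one_right: "A \<subseteq> carrier G \<Longrightarrow> A <#> {\<one>} = A"
  by (force simp: set_mult_def)

text \<open>In \<open>[a^(k+1), y] = [a^k, y]^a [a, y]\<close> the conjugation by \<open>a\<close>
  multiplies \<open>[a^k, y]\<close> by \<open>[[a^k, y], a]\<close>, an element of
  \<open>V\<close>.\<close>

lemma commutator_pow_left_cong:
  assumes V: "V \<lhd> G" and A: "subgroup A G" "a \<in> A" and y: "y \<in> carrier G"
    and central: "\<And>x. x \<in> A \<Longrightarrow> commutator G (commutator G x y) a \<in> V"
  shows "V #> commutator G (a [^] (k::nat)) y = V #> (commutator G a y) [^] k"
proof (induction k)
  case (Suc k)
  have aG: "a \<in> carrier G" using subgroup.mem_carrier[OF A] .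
  let ?x = "commutator G (a [^] k) y"
  have ak: "a [^] k \<in> A"
    using A by (induction k) (auto simp: subgroup.one_closed subgroup.m_closed)
  have "commutator G (a [^] Suc k) y = (?x \<otimes> commutator G ?x a) \<otimes> commutator G a y"
    using aG y by (simp add: commutator_mult_left commutator_conj_eq)
  also have "V #> \<dots> = V #> ((commutator G a y) [^] k \<otimes> commutator G a y)"
    using aG y V Suc r_coset_mult_right_mem[OF V _ central[OF ak]] by (intro r_coset_mult_cong) auto
  finally show ?case by simp
qed (use y in simp)

text \<open>The mirror image, from \<open>[a, y^(k+1)] = [a, y] [a, y^k]^y\<close>, where
  conjugation by \<open>y\<close> is trivial modulo \<open>V\<close>.\<close>

lemma commutator_pow_right_cong:
  assumes V: "V \<lhd> G" and L: "subgroup L G" "y \<in> L" and a: "a \<in> carrier G"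
    and central: "\<And>x. x \<in> L \<Longrightarrow> commutator G (commutator G a x) y \<in> V"
  shows "V #> commutator G a (y [^] (k::nat)) = V #> (commutator G a y) [^] k"
proof (induction k)
  case (Suc k)
  have yG: "y \<in> carrier G" using subgroup.mem_carrier[OF L] .
  let ?x = "commutator G a (y [^] k)"
  have yk: "y [^] k \<in> L"
    using L by (induction k) (auto simp: subgroup.one_closed subgroup.m_closed)
  have "commutator G a (y [^] Suc k) = commutator G a y \<otimes> (?x \<otimes> commutator G ?x y)"
    using yG a by (simp add: commutator_mult_right commutator_conj_eq)
  also have "V #> \<dots> = V #> (commutator G a y \<otimes> (commutator G a y) [^] k)"
    using yG a V Suc r_coset_mult_right_mem[OF V _ central[OF yk]] by (intro r_coset_mult_cong) auto
  finally show ?case using yG a by (simp only: nat_pow_Suc2 commutator_closed)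
qed (use a in simp)

end

context profinite_group
begin

text \<open>Modulo \<open>V\<close> the finite set \<open>S\<close> consists of commuting torsion
  elements and so generates a finite group. Adjoining one \<open>s\<close> at a time, the closed
  subgroup obtained so far is normalised by \<open>s\<close> and contains some \<open>s^q\<close>,
  so that finitely many of its cosets make up the next one.\<close>

lemma finite_cosets_central_torsion:
  assumes V: "V \<lhd> G" "closedin T V"
    and S: "finite S" "S \<subseteq> carrier G"
    and torsion: "\<And>s. s \<in> S \<Longrightarrow> \<exists>q>0. s [^] (q::nat) \<in> V"
    and comm: "\<And>s t. s \<in> S \<Longrightarrow> t \<in> S \<Longrightarrow> commutator G s t \<in> V"
  shows "\<exists>R. finite R \<and> R \<subseteq> carrier G \<and> closed_generate G T (S \<union> V) \<subseteq> V <#> R"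
  using S torsion comm
proof (induction S)
  case empty
  interpret V: normal V G by fact
  have "closed_generate G T ({} \<union> V) \<subseteq> V <#> {\<one>}"
    using closed_generate_eq[OF V.subgroup_axioms V(2)] V.subset by (auto simp: set_mult_def)
  then show ?case by (intro exI[of _ "{\<one>}"]) auto
next
  case (insert s S)
  interpret V: normal V G by fact
  have SV: "S \<union> V \<subseteq> carrier G" using insert V.subset by auto
  let ?B = "closed_generate G T (S \<union> V)"
  note B = closed_generate_closed_subgroup[OF SV]
  interpret B: subgroup ?B G by (rule B)
  have VB: "V \<subseteq> ?B" "S \<subseteq> ?B" using closed_generate_superset[of "S \<union> V"] by auto
  obtain R where R: "finite R" "R \<subseteq> carrier G" "?B \<subseteq> V <#> R" using insert by auto
  have sG: "s \<in> carrier G" using insert by auto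
  obtain q where q: "q > 0" "s [^] (q::nat) \<in> V" using insert.prems(2)[of s] by auto
  have spow: "(s [^] q) [^] (j::nat) \<in> ?B" for j
    using q(2) VB(1) by (induction j) auto
  have conj: "s \<otimes> b \<otimes> inv s \<in> ?B" if "b \<in> ?B" for b
  proof (rule closed_generate_invariant[OF SV sG _ that])
    fix t assume t: "t \<in> S \<union> V"
    have tG: "t \<in> carrier G" using t SV by auto
    show "s \<otimes> t \<otimes> inv s \<in> ?B"
    proof (cases "t \<in> V")
      case True
      then show ?thesis using V.inv_op_closed2[OF sG] VB by auto
    next
      case False
      then have "commutator G t s \<in> V" using t insert by auto
      then have "commutator G t (inv s) \<in> V"
        using V.inv_op_closed2[OF sG] tG sG by (simp add: commutator_inv_right)
      then have "t \<otimes> commutator G t (inv s) \<in> ?B" using VB t by blast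
      moreover have "t \<otimes> commutator G t (inv s) = s \<otimes> t \<otimes> inv s"
        using tG sG by (simp add: commutator_def word_simps)
      ultimately show ?thesis by simp
    qed
  qed
  have swap: "\<exists>b'\<in>?B. s [^] (k::nat) \<otimes> b = b' \<otimes> s [^] k" if "b \<in> ?B" for k b
    using that
  proof (induction k arbitrary: b)
    case (Suc k)
    have bG: "b \<in> carrier G" using Suc(2) by auto
    obtain b' where b': "b' \<in> ?B" "s [^] k \<otimes> (s \<otimes> b \<otimes> inv s) = b' \<otimes> s [^] k"
      using Suc(1)[OF conj[OF Suc(2)]] by auto
    have "s [^] Suc k \<otimes> b = (s [^] k \<otimes> (s \<otimes> b \<otimes> inv s)) \<otimes> s"
      using sG bG by (simp add: word_simps)
    also have "\<dots> = b' \<otimes> s [^] Suc k"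
      unfolding b'(2) using sG b'(1) by (simp add: m_assoc)
    finally show ?case using b'(1) by blast
  qed auto
  \<comment> \<open>Exponents below \<open>q\<close> suffice, since \<open>s^q\<close> lies in
    \<open>V\<close> and is absorbed by \<open>?B\<close>.\<close>
  define U where "U = (\<Union>k\<in>{..<q}. ?B #> s [^] k)"
  have UI: "b \<otimes> s [^] k \<in> U" if "b \<in> ?B" for b and k :: nat
  proof -
    have "s [^] k = s [^] (q * (k div q) + k mod q)" by simp
    also have "\<dots> = (s [^] q) [^] (k div q) \<otimes> s [^] (k mod q)"
      using sG by (simp only: nat_pow_mult[symmetric] nat_pow_pow)
    finally have "b \<otimes> s [^] k = (b \<otimes> (s [^] q) [^] (k div q)) \<otimes> s [^] (k mod q)"
      using that sG by (simp add: m_assoc)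
    moreover have "b \<otimes> (s [^] q) [^] (k div q) \<in> ?B" using that spow by simp
    ultimately have "b \<otimes> s [^] k \<in> ?B #> s [^] (k mod q)" unfolding r_coset_def by blast
    then show ?thesis unfolding U_def using q(1) by (intro UN_I[of "k mod q"]) simp_all
  qed
  have UE: "\<exists>b k. b \<in> ?B \<and> k < q \<and> x = b \<otimes> s [^] k" if "x \<in> U" for x
    using that unfolding U_def r_coset_def by blast
  have Ucl: "closedin T U"
    unfolding U_def using closedin_r_coset[OF B(2)] sG by (intro closedin_Union) auto
  have "subgroup U G"
  proof (rule subgroupI)
    show "U \<subseteq> carrier G" using closedin_subset_carrier[OF Ucl] .
    show "U \<noteq> {}" using UI[OF B.one_closed] by blast
  next
    fix x assume "x \<in> U"
    then obtain b k where bk: "b \<in> ?B" "k < q" "x = b \<otimes> s [^] k" using UE by blast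
    have bG: "b \<in> carrier G" using bk by auto
    have "s [^] k \<otimes> s [^] (q - k) = s [^] q" using sG bk(2) by (simp add: nat_pow_mult)
    then have "inv (s [^] q) = inv (s [^] (q - k)) \<otimes> inv (s [^] k)"
      using sG by (metis inv_mult_group nat_pow_closed)
    then have "inv (s [^] k) = s [^] (q - k) \<otimes> inv (s [^] q)"
      using sG by (simp add: inv_mult_cancel)
    then have "inv x = s [^] (q - k) \<otimes> (inv (s [^] q) \<otimes> inv b)"
      using bk(3) bG sG by (simp add: word_simps)
    moreover have "inv (s [^] q) \<otimes> inv b \<in> ?B" using q(2) VB bk(1) by (intro B.m_closed B.m_inv_closed) auto
    ultimately show "inv x \<in> U" using swap[of "inv (s [^] q) \<otimes> inv b" "q - k"] UI by metis
  next
    fix x y assume "x \<in> U" "y \<in> U"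
    obtain b k where bk1: "b \<in> ?B" "x = b \<otimes> s [^] (k::nat)"
      using UE[OF \<open>x \<in> U\<close>] by (elim exE conjE)
    obtain b' l where bk2: "b' \<in> ?B" "y = b' \<otimes> s [^] (l::nat)"
      using UE[OF \<open>y \<in> U\<close>] by (elim exE conjE)
    note bk = bk1 bk2
    obtain b'' where b'': "b'' \<in> ?B" "s [^] k \<otimes> b' = b'' \<otimes> s [^] k" using swap[OF bk(3)] by blast
    have G: "b \<in> carrier G" "b' \<in> carrier G" "b'' \<in> carrier G" using bk b'' by auto
    have "x \<otimes> y = b \<otimes> (s [^] k \<otimes> b') \<otimes> s [^] l" using bk G sG by (simp add: m_assoc)
    also have "\<dots> = (b \<otimes> b'') \<otimes> s [^] (k + l)"
      unfolding b''(2) using G sG by (simp add: m_assoc nat_pow_mult)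
    finally show "x \<otimes> y \<in> U" using UI[of "b \<otimes> b''" "k + l"] bk(1) b''(1) by simp
  qed
  moreover have "insert s S \<union> V \<subseteq> U"
  proof
    fix x assume "x \<in> insert s S \<union> V"
    then consider "x = s" | "x \<in> ?B" using VB by auto
    then show "x \<in> U"
    proof cases
      case 1
      then show ?thesis using UI[OF B.one_closed, of 1] sG by simp
    next
      case 2
      then show ?thesis using UI[of x 0] by simp
    qed
  qed
  ultimately have "closed_generate G T (insert s S \<union> V) \<subseteq> U"
    using Ucl by (intro closed_generate_least)
  also have "U \<subseteq> ?B <#> (\<lambda>k. s [^] k) ` {..<q}"
    unfolding U_def r_coset_def set_mult_def by blast
  also have "\<dots> \<subseteq> (V <#> R) <#> (\<lambda>k. s [^] k) ` {..<q}"
    by (intro mono_set_mult R order_refl)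
  also have "\<dots> = V <#> (R <#> (\<lambda>k. s [^] k) ` {..<q})"
    using sG R(2) V.subset by (intro set_mult_assoc) auto
  finally have "closed_generate G T (insert s S \<union> V) \<subseteq> V <#> (R <#> (\<lambda>k. s [^] k) ` {..<q})" .
  moreover have "finite (R <#> (\<lambda>k. s [^] k) ` {..<q})" using R(1) by (simp add: set_mult_def)
  moreover have "R <#> (\<lambda>k. s [^] k) ` {..<q} \<subseteq> carrier G"
    using R(2) sG by (intro setmult_subset_G) auto
  ultimately show ?case by blast
qed

lemma iterated_commutators_subset:
  assumes "Y \<subseteq> L"
  shows "iterated_commutators G Y n \<subseteq> lcs (Suc n) L"
proof (induction n)
  case (Suc n)
  then show ?case using assms commutator_in_lower_central[of "Suc n" _ L] by auto
qed (use assms in auto)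

text \<open>In the induction step the subgroup on the right contains the next term of the series,
  which makes it invariant under conjugation by \<open>L\<close>. Hence it is enough to place
  commutators of generators in it.\<close>

lemma lower_central_generators:
  assumes L: "L \<lhd> G" "closedin T L" and Y: "Y \<subseteq> L" "closed_generate G T Y = L"
  shows "lcs (Suc n) L \<subseteq>
           closed_generate G T (iterated_commutators G Y n \<union> lcs (Suc (Suc n)) L)"
proof (induction n)
  case 0
  have "L \<subseteq> closed_generate G T (Y \<union> lcs (Suc (Suc 0)) L)"
    using closed_generate_mono[of Y "Y \<union> lcs (Suc (Suc 0)) L"] Y(2) by blast
  then show ?case by simp
next
  case (Suc n)
  interpret L: normal L G by fact
  let ?S = "iterated_commutators G Y (Suc n) \<union> lcs (Suc (Suc (Suc n))) L"
  let ?V = "closed_generate G T ?S"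
  note lcG = lower_central_subset_carrier[OF L.subset]
  have lc_sub: "lcs (Suc m) L \<subseteq> L" for m using lower_central_subset[OF L] .
  have Ssub: "?S \<subseteq> lcs (Suc (Suc n)) L"
    using iterated_commutators_subset[OF Y(1), of "Suc n"] lower_central_Suc_subset[OF L, of "Suc (Suc n)"] by auto
  then have SG: "?S \<subseteq> carrier G" using lcG by blast
  note V = closed_generate_closed_subgroup[OF SG]
  interpret V: subgroup ?V G by (rule V)
  have Vsub: "?V \<subseteq> lcs (Suc (Suc n)) L"
    using lower_central_closed_subgroup[OF L.subgroup_axioms L(2)] by (intro closed_generate_least Ssub)
  have VS: "?S \<subseteq> ?V" by (rule closed_generate_superset)
  have nrm: "l \<otimes> v \<otimes> inv l \<in> ?V" if l: "l \<in> L" and v: "v \<in> ?V" for l v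
  proof -
    have "commutator G v (inv l) \<in> ?V"
      using commutator_in_lower_central[of "Suc (Suc n)" v L "inv l"] v Vsub VS l by auto
    then have "v \<otimes> commutator G v (inv l) \<in> ?V" using v by (rule V.m_closed[rotated])
    moreover have "v \<otimes> commutator G v (inv l) = l \<otimes> v \<otimes> inv l"
      using l v by (simp add: commutator_def word_simps)
    ultimately show ?thesis by simp
  qed
  have gen: "commutator G x y \<in> ?V" if x: "x \<in> lcs (Suc n) L" and y: "y \<in> L" for x y
  proof (rule closed_generate_commutator[OF L.subgroup_axioms L(2) V nrm,
        where R = Y and S = "iterated_commutators G Y n \<union> lcs (Suc (Suc n)) L"])
    show "x \<in> closed_generate G T (iterated_commutators G Y n \<union> lcs (Suc (Suc n)) L)"
      using Suc x by blast
    show "y \<in> closed_generate G T Y" using y Y by simp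
    show "iterated_commutators G Y n \<union> lcs (Suc (Suc n)) L \<subseteq> L"
      using iterated_commutators_subset[OF Y(1), of n] lc_sub by blast
    show "Y \<subseteq> L" by fact
    fix s r assume s: "s \<in> iterated_commutators G Y n \<union> lcs (Suc (Suc n)) L" and r: "r \<in> Y"
    have "commutator G s r \<in> ?S"
    proof (cases "s \<in> iterated_commutators G Y n")
      case True
      then have "commutator G s r \<in> iterated_commutators G Y (Suc n)"
        using r by (auto intro!: image_eqI[of _ _ "(s, r)"])
      then show ?thesis by blast
    next
      case False
      then show ?thesis using commutator_in_lower_central[of "Suc (Suc n)" s L r] s r Y(1) by auto
    qed
    then show "commutator G s r \<in> ?V" using VS by blast
  qed
  have "closed_generate G T {commutator G x y |x y. x \<in> lcs (Suc n) L \<and> y \<in> L} \<subseteq> ?V"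
    by (rule closed_generate_least[OF V]) (use gen in auto)
  then show ?case
    unfolding lower_central_Suc[of "Suc n", simplified] closed_commutator_alt .
qed

text \<open>Modulo the next term the iterated commutators are multilinear, so a suitable power of each of
  them can be computed with entries in \<open>F\<close>.\<close>

lemma iterated_commutators_torsion:
  assumes L: "L \<lhd> G" "closedin T L" and Y: "Y \<subseteq> L"
    and F: "F \<lhd> G" "F \<subseteq> L" "\<And>y. y \<in> Y \<Longrightarrow> \<exists>e>0. y [^] (e::nat) \<in> F"
    and s: "s \<in> iterated_commutators G Y n"
  shows "\<exists>q>0. \<exists>u\<in>lcs (Suc n) F.
           lcs (Suc (Suc n)) L #> s [^] (q::nat) = lcs (Suc (Suc n)) L #> u"
  using s
proof (induction n arbitrary: s)
  case 0
  then show ?case using F(3)[of s] by auto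
next
  case (Suc n)
  interpret L: normal L G by fact
  interpret F: normal F G by fact
  let ?A = "lcs (Suc n) L"
  let ?V1 = "lcs (Suc (Suc n)) L"
  let ?V = "lcs (Suc (Suc (Suc n))) L"
  note lcG = lower_central_subset_carrier[OF L.subset]
  have A: "subgroup ?A G" using lower_central_closed_subgroup[OF L.subgroup_axioms L(2)] by blast
  have V1: "?V1 \<lhd> G" and V: "?V \<lhd> G" using lower_central_normal[OF L(1)] by blast+
  interpret V: normal ?V G by (rule V)
  obtain t y where t: "t \<in> iterated_commutators G Y n" "y \<in> Y" "s = commutator G t y" using Suc(2) by auto
  obtain q u where q: "q > 0" "u \<in> lcs (Suc n) F" "?V1 #> t [^] (q::nat) = ?V1 #> u"
    using Suc(1)[OF t(1)] by auto
  obtain e where e: "e > 0" "y [^] (e::nat) \<in> F" using F(3)[OF t(2)] by auto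
  have tA: "t \<in> ?A" using t(1) iterated_commutators_subset[OF Y] by blast
  have yL: "y \<in> L" using t(2) Y by auto
  have uA: "u \<in> ?A" using q(2) lower_central_mono[OF F(2)] by blast
  have G: "t \<in> carrier G" "y \<in> carrier G" "u \<in> carrier G" using tA uA yL lcG L.subset by blast+
  have up: "commutator G a b \<in> ?V1" if "a \<in> ?A" "b \<in> L" for a b
    using commutator_in_lower_central[of "Suc n" a L b] that by simp
  have up2: "commutator G a b \<in> ?V" if "a \<in> ?V1" "b \<in> L" for a b
    using commutator_in_lower_central[of "Suc (Suc n)" a L b] that by simp
  have AL: "?A \<subseteq> L" "?V1 \<subseteq> L" using lower_central_subset[OF L] by blast+
  obtain z where z: "z \<in> ?V1" "t [^] q = u \<otimes> z"
    using r_coset_eq_imp_right[OF V1 _ G(3) q(3)] G by auto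
  have zG: "z \<in> carrier G" using z(1) lcG by blast
  have tq: "t [^] q \<in> ?A" using tA A by (induction q) (auto simp: subgroup.one_closed subgroup.m_closed)
  let ?y = "y [^] e"
  have yF: "?y \<in> F" "?y \<in> L" "?y \<in> carrier G" using e(2) F(2) F.subset by auto
  \<comment> \<open>The exponent \<open>q\<close> brings \<open>t\<close> into the series of
    \<open>F\<close> modulo \<open>?V1\<close>, and \<open>e\<close> brings \<open>y\<close> into
    \<open>F\<close>. Bilinearity modulo \<open>?V\<close> turns the power \<open>q e\<close> of
    \<open>[t, y]\<close> into \<open>[t^q, y^e]\<close>.\<close>
  have "?V #> s [^] (q * e) = ?V #> (s [^] q) [^] e"
    using G t(3) by (simp add: nat_pow_pow)
  also have "\<dots> = ?V #> (commutator G (t [^] q) y) [^] e"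
    unfolding t(3) using G up up2 AL tA yL
    by (intro r_coset_pow_cong[OF V] commutator_pow_left_cong[OF V A tA G(2), symmetric]) auto
  also have "\<dots> = ?V #> commutator G (t [^] q) ?y"
    using G up[OF tq] up2 yL
    by (intro commutator_pow_right_cong[OF V L.subgroup_axioms yL, symmetric]) auto
  \<comment> \<open>With \<open>t^q = u z\<close> and \<open>z\<close> in \<open>?V1\<close>, the
    factors besides \<open>[u, y^e]\<close> are \<open>[[u, y^e], z]\<close> and
    \<open>[z, y^e]\<close>, both in \<open>?V\<close>.\<close>
  also have "commutator G (t [^] q) ?y = (commutator G u ?y \<otimes> commutator G (commutator G u ?y) z) \<otimes> commutator G z ?y"
    unfolding z(2) using G zG yF by (simp add: commutator_mult_left commutator_conj_eq)
  also have "?V #> \<dots> = ?V #> (commutator G u ?y \<otimes> commutator G (commutator G u ?y) z)"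
    using up2[OF z(1) yF(2)] G zG yF by (intro r_coset_mult_right_mem[OF V]) auto
  also have "\<dots> = ?V #> commutator G u ?y"
    using up2[OF up[OF uA yF(2)]] z(1) AL G zG yF by (intro r_coset_mult_right_mem[OF V]) auto
  finally have "?V #> s [^] (q * e) = ?V #> commutator G u ?y" .
  moreover have "commutator G u ?y \<in> lcs (Suc (Suc n)) F"
    using commutator_in_lower_central[of "Suc n" u F ?y] q(2) yF(1) by simp
  moreover have "q * e > 0" using q(1) e(1) by simp
  ultimately show ?case by blast
qed

lemma pow_in_open_normal:
  assumes "F \<lhd> G" "openin T F" "x \<in> carrier G"
  shows "\<exists>e>0. x [^] (e::nat) \<in> F"
proof -
  interpret F: normal F G by fact
  have "\<not> inj_on (\<lambda>n::nat. F #> x [^] n) UNIV"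
  proof
    assume "inj_on (\<lambda>n::nat. F #> x [^] n) UNIV"
    moreover have "range (\<lambda>n::nat. F #> x [^] n) \<subseteq> rcosets F"
      using assms(3) F.subset rcosetsI by auto
    ultimately show False
      using finite_rcosets_open[OF F.subgroup_axioms assms(2)] finite_subset finite_imageD infinite_UNIV_nat by metis
  qed
  then obtain m n :: nat where mn: "m < n" "F #> x [^] m = F #> x [^] n"
    unfolding inj_on_def by (metis linorder_neqE_nat)
  have "x [^] n = x [^] (n - m) \<otimes> x [^] m" using mn(1) assms(3) by (simp add: nat_pow_mult)
  moreover have "x [^] n \<in> F #> x [^] m"
    using mn(2) rcos_self[OF _ F.subgroup_axioms, of "x [^] n"] assms(3) by simp
  then have "x [^] n \<otimes> inv (x [^] m) \<in> F" using F.rcos_module_imp[OF is_group] assms(3) by simp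
  ultimately have "x [^] (n - m) \<in> F" using assms(3) by (simp add: m_assoc)
  then show ?thesis using mn(1) by (intro exI[of _ "n - m"]) auto
qed

text \<open>For \<open>n \<ge> c\<close> the section from \<open>lcs (n+1) L\<close> to
  \<open>lcs (n+2) L\<close>, taken modulo \<open>K\<close>, is generated by finitely many commuting
  iterated commutators. A power of each is congruent to an element of \<open>lcs (n+1) F\<close>,
  which lies in \<open>lcs (c+1) F\<close> and so in \<open>K\<close>. The finite sets of
  representatives multiply along the induction on \<open>m\<close>.\<close>

lemma finite_cosets_lower_central:
  assumes L: "L \<lhd> G" "closedin T L" and Y: "finite Y" "Y \<subseteq> L" "closed_generate G T Y = L"
    and F: "F \<lhd> G" "openin T F" "F \<subseteq> L" and K: "K \<lhd> G" "closedin T K"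
    and FK: "lcs (c + 1) F \<subseteq> K"
  shows "\<exists>R. finite R \<and> R \<subseteq> carrier G \<and>
           lcs (c + 1) L <#> K \<subseteq> (lcs (c + m + 1) L <#> K) <#> R"
proof (induction m)
  case 0
  have "(lcs (c + 1) L <#> K) \<subseteq> carrier G"
    using normal_imp_subgroup[OF L(1)] normal_imp_subgroup[OF K(1)] lower_central_subset_carrier
    by (intro setmult_subset_G) (auto simp: subgroup.subset)
  then have "lcs (c + 1) L <#> K \<subseteq> (lcs (c + 0 + 1) L <#> K) <#> {\<one>}"
    by (simp add: set_mult_one_right)
  then show ?case by (intro exI[of _ "{\<one>}"]) auto
next
  case (Suc m)
  let ?n = "c + m"
  interpret L: normal L G by fact
  interpret K: normal K G by fact
  interpret F: normal F G by fact
  let ?B = "lcs (Suc ?n) L <#> K"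
  let ?V = "lcs (Suc (Suc ?n)) L <#> K"
  let ?S = "iterated_commutators G Y ?n"
  have lcN: "lcs i L \<lhd> G" for i using lower_central_normal[OF L(1)] .
  have V: "?V \<lhd> G" using normal_set_mult_normal[OF K(1) lcN] .
  interpret V: normal ?V G by (rule V)
  have Vcl: "closedin T ?V"
    using lower_central_closed_subgroup[OF L.subgroup_axioms L(2)] K by (intro closedin_set_mult) auto
  note Vsup = set_mult_superset[OF normal_imp_subgroup[OF lcN[of "Suc (Suc ?n)"]] K.subgroup_axioms]
  have S: "?S \<subseteq> lcs (Suc ?n) L" by (rule iterated_commutators_subset[OF Y(2)])
  have SG: "?S \<subseteq> carrier G" using S lower_central_subset_carrier[OF L.subset] by blast
  have "\<exists>R. finite R \<and> R \<subseteq> carrier G \<and> closed_generate G T (?S \<union> ?V) \<subseteq> ?V <#> R"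
  proof (rule finite_cosets_central_torsion[OF V Vcl finite_iterated_commutators[OF Y(1)] SG])
    fix s assume s: "s \<in> ?S"
    obtain q u where q: "q > 0" "u \<in> lcs (Suc ?n) F"
      "lcs (Suc (Suc ?n)) L #> s [^] (q::nat) = lcs (Suc (Suc ?n)) L #> u"
      using iterated_commutators_torsion[OF L Y(2) F(1,3) pow_in_open_normal[OF F(1,2)] s] Y(2) L.subset by blast
    have uK: "u \<in> K"
      using lower_central_antimono[OF F(1) closedin_open_subgroup[OF F.subgroup_axioms F(2)], of "c + 1" "Suc ?n"]
        q(2) FK by auto
    have sG: "s \<in> carrier G" using s SG by auto
    obtain z where "z \<in> lcs (Suc (Suc ?n)) L" "s [^] q = u \<otimes> z"
      using r_coset_eq_imp_right[OF lcN _ K.mem_carrier[OF uK] q(3)] sG by auto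
    then have "s [^] q \<in> ?V" using Vsup uK by auto
    then show "\<exists>q>0. s [^] (q::nat) \<in> ?V" using q(1) by blast
  next
    fix s t assume "s \<in> ?S" "t \<in> ?S"
    then have "commutator G s t \<in> lcs (Suc (Suc ?n)) L"
      using S lower_central_subset[OF L, of "Suc ?n"] by (intro commutator_in_lower_central) auto
    then show "commutator G s t \<in> ?V" using Vsup by auto
  qed
  then obtain R where R: "finite R" "R \<subseteq> carrier G" "closed_generate G T (?S \<union> ?V) \<subseteq> ?V <#> R" by auto
  obtain R' where R': "finite R'" "R' \<subseteq> carrier G"
    "lcs (c + 1) L <#> K \<subseteq> ?B <#> R'" using Suc by auto
  have SV: "?S \<union> ?V \<subseteq> carrier G" using SG V.subset by auto
  have "closed_generate G T (?S \<union> lcs (Suc (Suc ?n)) L) \<subseteq> closed_generate G T (?S \<union> ?V)"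
    using Vsup by (intro closed_generate_mono) auto
  then have "lcs (Suc ?n) L \<subseteq> closed_generate G T (?S \<union> ?V)"
    using lower_central_generators[OF L Y(2,3), of ?n] by auto
  moreover have "K \<subseteq> closed_generate G T (?S \<union> ?V)"
    using Vsup(2) closed_generate_superset[of "?S \<union> ?V"] by auto
  ultimately have "?B \<subseteq> closed_generate G T (?S \<union> ?V)"
    by (intro set_mult_least closed_generate_closed_subgroup(1)[OF SV])
  then have "?B \<subseteq> ?V <#> R" using R(3) by auto
  then have "?B <#> R' \<subseteq> (?V <#> R) <#> R'" by (rule mono_set_mult[OF _ order_refl])
  also have "\<dots> = ?V <#> (R <#> R')" using R R' V.subset by (intro set_mult_assoc) auto
  finally have "lcs (c + 1) L <#> K \<subseteq> ?V <#> (R <#> R')" using R'(3) by auto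
  moreover have "finite (R <#> R')" using R(1) R'(1) by (simp add: set_mult_def)
  moreover have "R <#> R' \<subseteq> carrier G" using R(2) R'(2) by (intro setmult_subset_G) auto
  ultimately show ?case by (intro exI[of _ "R <#> R'"]) auto
qed

lemma finite_r_cosets_if_cover:
  assumes V: "subgroup V G" and R: "finite R" "R \<subseteq> carrier G" and B: "B \<subseteq> V <#> R"
  shows "finite ((\<lambda>b. V #> b) ` B)"
proof -
  have "V #> b \<in> (\<lambda>r. V #> r) ` R" if "b \<in> B" for b
  proof -
    have "b \<in> V <#> R" using that B by auto
    then obtain v r where v: "v \<in> V" "r \<in> R" "b = v \<otimes> r" by (auto simp: set_mult_def)
    then have "V #> r = V #> b"
      using repr_independence[of b V r] V R(2) by (auto simp: r_coset_def)
    then show ?thesis using v(2) by auto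
  qed
  then have "(\<lambda>b. V #> b) ` B \<subseteq> (\<lambda>r. V #> r) ` R" by (rule image_subsetI)
  then show ?thesis by (rule finite_subset) (use R(1) in simp)
qed

text \<open>With \<open>L = DF\<close>, the group \<open>\<gamma>(D)K\<close> lies between \<open>\<gamma>\<^bsub>2c+1\<^esub>(L)K\<close> and \<open>\<gamma>\<^bsub>c+1\<^esub>(L)K\<close>, where the
  former has finite index in the latter, and there are only finitely many choices for \<open>L\<close>.\<close>

lemma finite_lower_central_products:
  assumes fg: "fin_generated G T" and F: "F \<lhd> G" "openin T F" and K: "K \<lhd> G" "closedin T K"
    and FK: "lcs (c + 1) F \<subseteq> K"
  shows "finite {lcs (c + 1) D <#> K | D. D \<lhd> G \<and> openin T D}"
proof -
  interpret F: normal F G by fact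
  interpret K: normal K G by fact
  have Fcl: "closedin T F" using closedin_open_subgroup[OF F.subgroup_axioms F(2)] .
  obtain X where X: "finite X" "X \<subseteq> carrier G" "closed_generate G T X = carrier G"
    using fg fin_generated_iff by auto
  let ?\<L> = "{L. subgroup L G \<and> F \<subseteq> L \<and> L \<subseteq> carrier G}"
  have "(\<lambda>b. F #> b) ` carrier G = rcosets F" by (auto simp: RCOSETS_def)
  then have "finite ?\<L>"
    using finite_rcosets_open[OF F.subgroup_axioms F(2)] by (intro finite_subgroups_between F.subgroup_axioms) simp
  then have fin\<L>: "finite {L. L \<lhd> G \<and> F \<subseteq> L}"
    by (rule rev_finite_subset) (use normal_imp_subgroup subgroup.subset in blast)
  let ?between = "\<lambda>L. {C. subgroup C G \<and> lcs (2 * c + 1) L <#> K \<subseteq> C \<and>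
                         C \<subseteq> lcs (c + 1) L <#> K}"
  have fin: "finite (?between L)" if L: "L \<lhd> G" "F \<subseteq> L" for L
  proof -
    note sL = normal_imp_subgroup[OF L(1)]
    have Lop: "openin T L" using openin_subgroup_mono[OF F.subgroup_axioms F(2) sL L(2)] .
    have Lcl: "closedin T L" using closedin_open_subgroup[OF sL Lop] .
    obtain Y where Y: "finite Y" "Y \<subseteq> L" "closed_generate G T Y = L"
      using open_subgroup_generators[OF X sL Lop] by blast
    obtain R where R: "finite R" "R \<subseteq> carrier G"
      "lcs (c + 1) L <#> K \<subseteq> (lcs (c + c + 1) L <#> K) <#> R"
      using finite_cosets_lower_central[OF L(1) Lcl Y F L(2) K FK, of c] by blast
    have V: "subgroup (lcs (2 * c + 1) L <#> K) G"
      by (intro normal_set_mult_subgroup K normal_imp_subgroup lower_central_normal L)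
    show ?thesis
      by (rule finite_subgroups_between[OF V finite_r_cosets_if_cover[OF V R(1,2)]])
         (use R(3) in \<open>simp add: mult_2\<close>)
  qed
  have "{lcs (c + 1) D <#> K | D. D \<lhd> G \<and> openin T D} \<subseteq> (\<Union>L\<in>{L. L \<lhd> G \<and> F \<subseteq> L}. ?between L)"
  proof
    fix C assume "C \<in> {lcs (c + 1) D <#> K | D. D \<lhd> G \<and> openin T D}"
    then obtain D where D: "D \<lhd> G" "openin T D" "C = lcs (c + 1) D <#> K" by auto
    note sD = normal_imp_subgroup[OF D(1)]
    have Dcl: "closedin T D" using closedin_open_subgroup[OF sD D(2)] .
    let ?L = "D <#> F"
    note DF = set_mult_superset[OF sD F.subgroup_axioms]
    have gD: "subgroup (lcs (c + 1) D) G"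
      using normal_imp_subgroup[OF lower_central_normal[OF D(1)]] .
    have C: "subgroup C G" unfolding D(3) by (rule normal_set_mult_subgroup[OF K(1) gD])
    note sup = set_mult_superset[OF gD K.subgroup_axioms, folded D(3)]
    have "lcs (2 * c + 1) ?L \<subseteq> lcs (c + 1) D <#> lcs (c + 1) F"
      by (rule lower_central_set_mult[OF D(1) Dcl F(1) Fcl])
    also have "\<dots> \<subseteq> C" using sup FK by (intro set_mult_least[OF C]) auto
    finally have "lcs (2 * c + 1) ?L <#> K \<subseteq> C" using sup by (intro set_mult_least[OF C])
    moreover have "C \<subseteq> lcs (c + 1) ?L <#> K"
      unfolding D(3) by (intro mono_set_mult lower_central_mono DF order_refl)
    ultimately have "C \<in> ?between ?L" using C by auto
    then show "C \<in> (\<Union>L\<in>{L. L \<lhd> G \<and> F \<subseteq> L}. ?between L)"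
      using normal_set_mult_normal[OF F(1) D(1)] DF(2) by blast
  qed
  then show ?thesis by (rule finite_subset) (use fin\<L> fin in auto)
qed

end

section \<open>Obliquity\<close>

lemma not_empty_if_mem: "x \<in> A \<Longrightarrow> A \<noteq> {}"
  by blast

lemma finite_chain_has_least:
  assumes "finite \<F>" "\<F> \<noteq> {}" "\<And>C D. C \<in> \<F> \<Longrightarrow> D \<in> \<F> \<Longrightarrow> C \<subseteq> D \<or> D \<subseteq> C"
  shows "\<exists>M\<in>\<F>. \<forall>C\<in>\<F>. M \<subseteq> C"
proof -
  obtain M where M: "M \<in> \<F>" "\<forall>C\<in>\<F>. C \<subseteq> M \<longrightarrow> M = C"
    using finite_has_minimal[OF assms(1,2)] by blast
  then have "M \<subseteq> C" if "C \<in> \<F>" for C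
    using assms(3)[OF M(1) that] that by auto
  then show ?thesis using M(1) by blast
qed

section \<open>Closed normal subgroups of a JNNF group\<close>

locale JNNF_group = profinite_group +
  fixes c
  assumes JNNF: "JNNF c G T"
begin

abbreviation \<gamma> where "\<gamma> \<equiv> lcs (c + 1)"

text \<open>The defining property pulled back from the quotient by \<open>N\<close>; this is how a
  term \<open>\<gamma> F\<close> is found inside a prescribed subgroup.\<close>

lemma ex_lower_central_subset:
  assumes "N \<lhd> G" "closedin T N" "N \<noteq> {\<one>}"
  shows "\<exists>F. F \<lhd> G \<and> openin T F \<and> \<gamma> F \<subseteq> N"
  using assms JNNF virtually_nilpotent_quotient_iff[OF assms(1,2), of c] by (simp add: JNNF_def)

lemma lower_central_nontrivial:
  assumes "F \<lhd> G" "openin T F"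
  shows "\<gamma> F \<noteq> {\<one>}"
  using assms JNNF virtually_nilpotent_alt[of c] by (auto simp: JNNF_def)

lemma lower_central_not_subset_one:
  assumes "F \<lhd> G" "openin T F"
  shows "\<not> \<gamma> F \<subseteq> {\<one>}"
  using lower_central_nontrivial[OF assms] subgroup.one_closed[OF normal_imp_subgroup[OF lower_central_normal[OF assms(1)]]]
  by auto

text \<open>Choose \<open>F\<close> with \<open>\<gamma> F\<close> inside \<open>C\<close> and an
  open normal \<open>V\<close> meeting \<open>C\<close> only in \<open>\<one>\<close>. Then
  \<open>\<gamma> (F \<inter> V)\<close> lies in both and vanishes, which contradicts the failure of
  virtual nilpotency.\<close>

lemma finite_normal_trivial:
  assumes C: "C \<lhd> G" "finite C"
  shows "C = {\<one>}"
proof (rule ccontr)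
  assume "C \<noteq> {\<one>}"
  have CG: "C \<subseteq> carrier G" using subgroup.subset[OF normal_imp_subgroup[OF C(1)]] .
  have fin_closed: "closedin T B" if "B \<subseteq> C" for B
    using that CG finite_subset[OF that C(2)] Hausdorff
    by (auto simp: closedin_Hausdorff_finite_eq topspace_eq_carrier)
  obtain F where F: "F \<lhd> G" "openin T F" "\<gamma> F \<subseteq> C"
    using ex_lower_central_subset[OF C(1) fin_closed[OF order_refl] \<open>C \<noteq> {\<one>}\<close>] by auto
  have "openin T (carrier G - (C - {\<one>}))"
    using fin_closed[of "C - {\<one>}"] openin_carrier by (intro openin_diff) auto
  then obtain V where V: "V \<lhd> G" "openin T V" "V \<subseteq> carrier G - (C - {\<one>})"
    using open_normal_base[of "carrier G - (C - {\<one>})"] by auto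
  have D: "F \<inter> V \<lhd> G" "openin T (F \<inter> V)" using F V normal_subgroup_intersect by auto
  have "\<gamma> (F \<inter> V) \<subseteq> V"
    using lower_central_subset[OF D(1) closedin_open_subgroup[OF normal_imp_subgroup[OF D(1)] D(2)]] by blast
  moreover have "\<gamma> (F \<inter> V) \<subseteq> C" using F(3) lower_central_mono[of "F \<inter> V" F "c + 1"] by auto
  ultimately have "\<gamma> (F \<inter> V) \<subseteq> {\<one>}" using V(3) by blast
  then show False using lower_central_not_subset_one[OF D] by blast
qed

text \<open>\<open>A\<close> and \<open>B\<close> contain some \<open>\<gamma> F\<close> and
  \<open>\<gamma> F'\<close>, hence both contain the non-trivial group
  \<open>\<gamma> (F \<inter> F')\<close>.\<close>

lemma Int_nontrivial:
  assumes "A \<lhd> G" "closedin T A" "A \<noteq> {\<one>}" "B \<lhd> G" "closedin T B" "B \<noteq> {\<one>}"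
  shows "A \<inter> B \<noteq> {\<one>}"
proof
  assume AB: "A \<inter> B = {\<one>}"
  obtain F where F: "F \<lhd> G" "openin T F" "\<gamma> F \<subseteq> A" using ex_lower_central_subset assms by blast
  obtain F' where F': "F' \<lhd> G" "openin T F'" "\<gamma> F' \<subseteq> B" using ex_lower_central_subset assms by blast
  have D: "F \<inter> F' \<lhd> G" "openin T (F \<inter> F')" using F F' normal_subgroup_intersect by auto
  have "\<gamma> (F \<inter> F') \<subseteq> \<gamma> F" "\<gamma> (F \<inter> F') \<subseteq> \<gamma> F'" by (simp_all add: lower_central_mono)
  then show False using lower_central_not_subset_one[OF D] F(3) F'(3) AB by blast
qed

text \<open>Intersecting with \<open>carrier G\<close> covers the empty family, whose
  \<open>\<Inter>\<close> is the whole type.\<close>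

lemma finite_Inter_nontrivial:
  assumes "finite \<A>" "\<And>A. A \<in> \<A> \<Longrightarrow> A \<lhd> G \<and> closedin T A \<and> A \<noteq> {\<one>}"
  shows "carrier G \<inter> \<Inter>\<A> \<lhd> G \<and> closedin T (carrier G \<inter> \<Inter>\<A>) \<and> carrier G \<inter> \<Inter>\<A> \<noteq> {\<one>}"
  using assms
proof (induction \<A>)
  case empty
  have "carrier G \<lhd> G" by (auto simp: normal_inv_iff subgroup_self)
  then show ?case
    using closedin_carrier lower_central_not_subset_one[OF _ openin_carrier]
      lower_central_subset_carrier[of "carrier G" "c + 1"] by auto
next
  case (insert A \<A>)
  have eq: "carrier G \<inter> \<Inter>(insert A \<A>) = A \<inter> (carrier G \<inter> \<Inter>\<A>)" by auto
  show ?case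
    unfolding eq
    using insert.prems[of A] insert.IH insert.prems normal_subgroup_intersect[of A "carrier G \<inter> \<Inter>\<A>"]
      Int_nontrivial[of A "carrier G \<inter> \<Inter>\<A>"] closedin_Int[of T A "carrier G \<inter> \<Inter>\<A>"]
    by simp
qed

lemma max_invariant_core_nontrivial:
  assumes "A \<lhd> G" "closedin T A" "A \<noteq> {\<one>}"
  shows "max_invariant_core G T A \<noteq> {\<one>}"
  using finite_normal_if_core_trivial[OF assms] finite_normal_trivial by blast

lemma lower_central_closed_normal:
  assumes "D \<lhd> G" "openin T D"
  shows "\<gamma> D \<lhd> G" "closedin T (\<gamma> D)" "\<gamma> D \<subseteq> D"
  using assms lower_central_normal lower_central_subset
    lower_central_closed_subgroup(2)[OF normal_imp_subgroup closedin_open_subgroup] closedin_open_subgroup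
  by (simp_all add: normal_imp_subgroup)

text \<open>A generalised obliquity theorem. If the family were infinite, then by compactness and Zorn's
  lemma there would be a closed normal \<open>B\<close> minimal among those containing infinitely many members;
  but modulo the core of \<open>B\<close> only finitely many members remain, and by minimality infinitely
  many of them generate \<open>B\<close> together with the core, so coincide with \<open>B\<close>.\<close>

lemma finite_lower_central_not_subset:
  assumes fg: "fin_generated G T" and H: "H \<lhd> G" "openin T H"
  shows "finite {\<gamma> D | D. D \<lhd> G \<and> openin T D \<and> \<not> \<gamma> D \<subseteq> H}"
proof -
  define \<A> where "\<A> = {\<gamma> D | D. D \<lhd> G \<and> openin T D \<and> \<not> \<gamma> D \<subseteq> H}"
  have "finite \<A>"
  proof (rule ccontr)
    assume inf: "infinite \<A>"
    have memA: "A \<lhd> G" "closedin T A" "\<not> A \<subseteq> H" if "A \<in> \<A>" for A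
      using that lower_central_closed_normal by (auto simp: \<A>_def)
    have fin: "finite ((\<lambda>A. A <#> K) ` \<B>)"
      if K: "K \<lhd> G" "closedin T K" "K \<noteq> {\<one>}" and "\<B> \<subseteq> \<A>" for K \<B>
    proof -
      obtain F where F: "F \<lhd> G" "openin T F" "\<gamma> F \<subseteq> K" using ex_lower_central_subset[OF K] by blast
      have "(\<lambda>A. A <#> K) ` \<B> \<subseteq> {\<gamma> D <#> K | D. D \<lhd> G \<and> openin T D}"
        using \<open>\<B> \<subseteq> \<A>\<close> by (auto simp: \<A>_def)
      then show ?thesis
        by (rule finite_subset) (rule finite_lower_central_products[OF fg F(1,2) K(1,2) F(3)])
    qed
    \<comment> \<open>No member of \<open>\<A>\<close> lies in \<open>H\<close>, so no member of
      \<open>?S\<close> does either; this keeps intersections of chains away from the trivial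
      group.\<close>
    let ?S = "{B. B \<lhd> G \<and> closedin T B \<and> infinite {A \<in> \<A>. A \<subseteq> B}}"
    have notH: "\<not> B \<subseteq> H" if "B \<in> ?S" for B
    proof -
      have "{A \<in> \<A>. A \<subseteq> B} \<noteq> {}" using that by (metis (no_types, lifting) finite.emptyI mem_Collect_eq)
      then show ?thesis using memA(3) by blast
    qed
    have "\<exists>M\<in>?S. \<forall>X\<in>?S. X \<subseteq> M \<longrightarrow> X = M"
    proof (rule ex_minimal_set)
      have "{A \<in> \<A>. A \<subseteq> carrier G} = \<A>"
        using memA(2) closedin_subset_carrier by blast
      then have "carrier G \<in> ?S"
        using inf closedin_carrier by (simp add: normal_inv_iff subgroup_self)
      then show "?S \<noteq> {}" by blast
      fix \<C> assume ne: "\<C> \<noteq> {}" and sub: "\<C> \<subseteq> ?S"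
        and ch: "\<And>C D. C \<in> \<C> \<Longrightarrow> D \<in> \<C> \<Longrightarrow> C \<subseteq> D \<or> D \<subseteq> C"
      let ?I = "\<Inter>\<C>"
      have I: "?I \<lhd> G" "closedin T ?I"
        using ne sub by (auto intro!: normal_Inter closedin_Inter)
      \<comment> \<open>The sets \<open>C - H\<close> are closed because \<open>H\<close> is open,
        so by compactness \<open>?I\<close> is not contained in \<open>H\<close>. It is therefore
        non-trivial, and \<open>fin\<close> applies to it.\<close>
      have "\<Inter>((\<lambda>C. C - H) ` \<C>) \<noteq> {}"
      proof (rule compact_directed_Inter_nonempty[OF compact])
        show "(\<lambda>C. C - H) ` \<C> \<noteq> {}" using ne by auto
        fix X assume "X \<in> (\<lambda>C. C - H) ` \<C>"
        then obtain C where C: "C \<in> \<C>" "X = C - H" by auto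
        then show "closedin T X" using sub H(2) by (auto intro: closedin_diff)
        show "X \<noteq> {}" using C notH[of C] sub by auto
      next
        fix X Y assume "X \<in> (\<lambda>C. C - H) ` \<C>" "Y \<in> (\<lambda>C. C - H) ` \<C>"
        then obtain C D where "C \<in> \<C>" "X = C - H" "D \<in> \<C>" "Y = D - H" by auto
        then show "\<exists>E\<in>(\<lambda>C. C - H) ` \<C>. E \<subseteq> X \<inter> Y" using ch[of C D] by auto
      qed
      then obtain y where y: "y \<in> \<Inter>((\<lambda>C. C - H) ` \<C>)" by blast
      then have "y \<in> ?I" "y \<notin> H" using ne by auto
      moreover have "\<one> \<in> H" by (rule subgroup.one_closed[OF normal_imp_subgroup[OF H(1)]])
      ultimately have "?I \<noteq> {\<one>}" by (metis singletonD)
      then have finI: "finite ((\<lambda>A. A <#> ?I) ` \<A>)" by (rule fin[OF I]) simp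
      note sI = normal_imp_subgroup[OF I(1)]
      \<comment> \<open>The products with \<open>?I\<close> that arise from infinitely many members.
        There are finitely many of them, and by the pigeonhole principle each \<open>C\<close> of
        the chain contains one.\<close>
      define \<P> where "\<P> = {P \<in> (\<lambda>A. A <#> ?I) ` \<A>. infinite {A \<in> \<A>. A <#> ?I = P}}"
      have P: "\<exists>P\<in>\<P>. P \<subseteq> C" if C: "C \<in> \<C>" for C
      proof -
        have CS: "C \<lhd> G" "infinite {A \<in> \<A>. A \<subseteq> C}" using C sub by auto
        have "finite ((\<lambda>A. A <#> ?I) ` {A \<in> \<A>. A \<subseteq> C})"
          by (rule finite_subset[OF _ finI]) auto
        then have "\<exists>A0\<in>{A \<in> \<A>. A \<subseteq> C}.
            infinite {A \<in> {A \<in> \<A>. A \<subseteq> C}. A <#> ?I = A0 <#> ?I}"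
          by (rule pigeonhole_infinite[OF CS(2)])
        then obtain A0 where A0: "A0 \<in> {A \<in> \<A>. A \<subseteq> C}"
          "infinite {A \<in> {A \<in> \<A>. A \<subseteq> C}. A <#> ?I = A0 <#> ?I}"
          by (rule bexE)
        have "infinite {A \<in> \<A>. A <#> ?I = A0 <#> ?I}"
          using A0(2) by (rule infinite_super[rotated]) auto
        moreover have "A0 <#> ?I \<subseteq> C"
          using A0(1) C by (intro set_mult_least[OF normal_imp_subgroup[OF CS(1)]]) auto
        ultimately show ?thesis using A0(1) by (intro bexI[of _ "A0 <#> ?I"]) (auto simp: \<P>_def)
      qed
      have finP: "finite \<P>" using finI by (simp add: \<P>_def)
      \<comment> \<open>If every \<open>P\<close> failed to lie in some \<open>g P\<close> of the
        chain, the least of the finitely many \<open>g P\<close> would contain some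
        \<open>P0\<close>, and then so would \<open>g P0\<close>.\<close>
      have "\<exists>P\<in>\<P>. \<forall>C\<in>\<C>. P \<subseteq> C"
      proof (rule ccontr)
        assume "\<not> (\<exists>P\<in>\<P>. \<forall>C\<in>\<C>. P \<subseteq> C)"
        then have "\<forall>P\<in>\<P>. \<exists>C. C \<in> \<C> \<and> \<not> P \<subseteq> C" by blast
        then obtain g where g: "\<forall>P\<in>\<P>. g P \<in> \<C> \<and> \<not> P \<subseteq> g P" by (rule bchoice[THEN exE])
        obtain C0 where "C0 \<in> \<C>" using ne by blast
        then obtain P1 where "P1 \<in> \<P>" by (rule bexE[OF P])
        then have "\<P> \<noteq> {}" by (rule not_empty_if_mem)
        have "\<exists>M\<in>g ` \<P>. \<forall>C\<in>g ` \<P>. M \<subseteq> C"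
        proof (rule finite_chain_has_least)
          show "finite (g ` \<P>)" using finP by (rule finite_imageI)
          show "g ` \<P> \<noteq> {}" using \<open>\<P> \<noteq> {}\<close> by (simp only: image_is_empty not_False_eq_True)
          fix C D assume "C \<in> g ` \<P>" "D \<in> g ` \<P>"
          then have "C \<in> \<C>" "D \<in> \<C>" using g by blast+
          then show "C \<subseteq> D \<or> D \<subseteq> C" by (rule ch)
        qed
        then obtain M where M: "M \<in> g ` \<P>" "\<forall>C\<in>g ` \<P>. M \<subseteq> C" by (rule bexE)
        from M(1) g have "M \<in> \<C>" by blast
        then obtain P0 where P0: "P0 \<in> \<P>" "P0 \<subseteq> M" using P by blast
        have "M \<subseteq> g P0" using M(2) P0(1) by (rule bspec[OF _ imageI])
        then show False using g P0 by blast
      qed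
      then obtain P0 where P0: "P0 \<in> \<P>" "\<forall>C\<in>\<C>. P0 \<subseteq> C" by (rule bexE)
      have "{A \<in> \<A>. A <#> ?I = P0} \<subseteq> {A \<in> \<A>. A \<subseteq> ?I}"
      proof (rule subsetI)
        fix A assume A: "A \<in> {A \<in> \<A>. A <#> ?I = P0}"
        then have 1: "A \<in> \<A>" by simp
        then have "A \<subseteq> P0"
          using A set_mult_superset(1)[OF normal_imp_subgroup[OF memA(1)] sI] by auto
        then have "A \<subseteq> ?I" using P0(2) by auto
        then show "A \<in> {A \<in> \<A>. A \<subseteq> ?I}" using 1 by simp
      qed
      moreover have "infinite {A \<in> \<A>. A <#> ?I = P0}" using P0(1) by (simp add: \<P>_def)
      ultimately have "infinite {A \<in> \<A>. A \<subseteq> ?I}" by (rule infinite_super)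
      then show "?I \<in> ?S" using I by simp
    qed
    then obtain B where BS: "B \<in> ?S" and min: "\<forall>X\<in>?S. X \<subseteq> B \<longrightarrow> X = B" by (rule bexE)
    have B: "B \<lhd> G" "closedin T B" and Binf: "infinite {A \<in> \<A>. A \<subseteq> B}" using BS by auto
    have "B \<noteq> {\<one>}"
      using notH[OF BS] subgroup.one_closed[OF normal_imp_subgroup[OF H(1)]] by auto
    let ?M = "max_invariant_core G T B"
    have M: "?M \<lhd> G" "closedin T ?M" "?M \<noteq> {\<one>}"
      using max_invariant_core_normal closedin_max_invariant_core max_invariant_core_nontrivial B \<open>B \<noteq> {\<one>}\<close>
      by auto
    have "finite ((\<lambda>A. A <#> ?M) ` {A \<in> \<A>. A \<subseteq> B})" by (rule fin[OF M]) auto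
    then have "\<exists>A0\<in>{A \<in> \<A>. A \<subseteq> B}. infinite {A \<in> {A \<in> \<A>. A \<subseteq> B}. A <#> ?M = A0 <#> ?M}"
      by (rule pigeonhole_infinite[OF Binf])
    then obtain A0 where A0: "A0 \<in> {A \<in> \<A>. A \<subseteq> B}"
      "infinite {A \<in> {A \<in> \<A>. A \<subseteq> B}. A <#> ?M = A0 <#> ?M}"
      by (rule bexE)
    let ?B = "A0 <#> ?M"
    have A0': "A0 \<lhd> G" "closedin T A0" "A0 \<subseteq> B" using A0(1) memA[of A0] by auto
    have "{A \<in> {A \<in> \<A>. A \<subseteq> B}. A <#> ?M = ?B} \<subseteq> {A \<in> \<A>. A \<subseteq> ?B}"
    proof (rule subsetI)
      fix A assume A: "A \<in> {A \<in> {A \<in> \<A>. A \<subseteq> B}. A <#> ?M = ?B}"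
      then have 1: "A \<in> \<A>" by simp
      then have "A \<subseteq> ?B"
        using A set_mult_superset(1)[OF normal_imp_subgroup[OF memA(1)] normal_imp_subgroup[OF M(1)]] by auto
      then show "A \<in> {A \<in> \<A>. A \<subseteq> ?B}" using 1 by simp
    qed
    then have "infinite {A \<in> \<A>. A \<subseteq> ?B}" using A0(2) by (rule infinite_super)
    then have "?B \<in> ?S"
      using normal_set_mult_normal[OF M(1) A0'(1)] closedin_set_mult[OF A0'(2) M(2)] by simp
    moreover have "?B \<subseteq> B"
      using A0'(3) max_invariant_core_subset by (intro set_mult_least normal_imp_subgroup B)
    ultimately have BB: "?B = B" by (rule bspec[OF min, THEN mp])
    have "{A \<in> {A \<in> \<A>. A \<subseteq> B}. A <#> ?M = ?B} \<subseteq> {B}"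
    proof
      fix A assume A: "A \<in> {A \<in> {A \<in> \<A>. A \<subseteq> B}. A <#> ?M = ?B}"
      then have "A \<in> \<A>" "A \<subseteq> B" "B \<subseteq> A <#> ?M" using BB by auto
      then show "A \<in> {B}"
        using max_invariant_core_nongenerating[OF B(1)] memA[of A] by auto
    qed
    then have "finite {A \<in> {A \<in> \<A>. A \<subseteq> B}. A <#> ?M = ?B}" by (rule finite_subset) simp
    then show False using A0(2) by (rule notE[rotated])
  qed
  then show ?thesis by (simp add: \<A>_def)
qed

text \<open>Condition (iv) before any quotient is taken: the exceptional \<open>\<gamma> D\<close>
  are finite in number, so a single \<open>\<gamma> F\<close> fits below all of them.\<close>

lemma ex_lower_central_bound:
  assumes "fin_generated G T" "H \<lhd> G" "openin T H"
  shows "\<exists>F. F \<lhd> G \<and> openin T F \<and> (\<forall>D. D \<lhd> G \<and> openin T D \<longrightarrow> \<gamma> D \<subseteq> H \<or> \<gamma> F \<subseteq> \<gamma> D)"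
proof -
  let ?\<A> = "{\<gamma> D | D. D \<lhd> G \<and> openin T D \<and> \<not> \<gamma> D \<subseteq> H}"
  have props: "A \<lhd> G \<and> closedin T A \<and> A \<noteq> {\<one>}" if "A \<in> ?\<A>" for A
    using that lower_central_closed_normal lower_central_nontrivial by auto
  have J: "carrier G \<inter> \<Inter>?\<A> \<lhd> G \<and> closedin T (carrier G \<inter> \<Inter>?\<A>) \<and> carrier G \<inter> \<Inter>?\<A> \<noteq> {\<one>}"
    by (rule finite_Inter_nontrivial[OF finite_lower_central_not_subset[OF assms]]) (rule props)
  obtain F where F: "F \<lhd> G" "openin T F" "\<gamma> F \<subseteq> carrier G \<inter> \<Inter>?\<A>"
    using ex_lower_central_subset[OF conjunct1[OF J] conjunct1[OF conjunct2[OF J]] conjunct2[OF conjunct2[OF J]]]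
    by (elim exE conjE)
  have "\<gamma> D \<subseteq> H \<or> \<gamma> F \<subseteq> \<gamma> D" if "D \<lhd> G" "openin T D" for D
  proof (cases "\<gamma> D \<subseteq> H")
    case False
    then have "\<gamma> D \<in> ?\<A>" using that by blast
    then show ?thesis using F(3) by blast
  qed simp
  then show ?thesis using F(1,2) by blast
qed

text \<open>Every requirement on \<open>H (Suc n)\<close> passes to smaller open normal subgroups,
  so witnesses for the separate requirements are intersected. One member \<open>U n\<close> of a
  countable base is absorbed per step, which explains the shifted index in the last clause.\<close>

lemma ex_descending_sequence:
  assumes fg: "fin_generated G T"
  shows "\<exists>H :: nat \<Rightarrow> 'a set. (\<forall>n. H n \<lhd> G \<and> openin T (H n) \<and> H (Suc n) \<subseteq> H n \<and>
           \<gamma> (H (Suc n)) \<subseteq> max_invariant_core G T (\<gamma> (H n)) \<and>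
           (\<forall>D. D \<lhd> G \<and> openin T D \<longrightarrow> \<gamma> D \<subseteq> H n \<or> \<gamma> (H (Suc n)) \<subseteq> \<gamma> D)) \<and>
           (\<forall>N. N \<lhd> G \<and> openin T N \<longrightarrow> (\<exists>n. H (Suc n) \<subseteq> N))"
proof -
  obtain U :: "nat \<Rightarrow> 'a set" where U: "\<And>n. U n \<lhd> G \<and> openin T (U n)"
    "\<And>N. N \<lhd> G \<Longrightarrow> openin T N \<Longrightarrow> \<exists>n. U n \<subseteq> N"
    using countable_open_normal_base[OF fg] by blast
  let ?Q = "\<lambda>n H H'. H' \<subseteq> H \<and> H' \<subseteq> U n \<and> \<gamma> H' \<subseteq> max_invariant_core G T (\<gamma> H) \<and>
      (\<forall>D. D \<lhd> G \<and> openin T D \<longrightarrow> \<gamma> D \<subseteq> H \<or> \<gamma> H' \<subseteq> \<gamma> D)"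
  have "\<exists>H. \<forall>n. (H n \<lhd> G \<and> openin T (H n)) \<and> ?Q n (H n) (H (Suc n))"
  proof (rule dependent_nat_choice)
    show "\<exists>H. H \<lhd> G \<and> openin T H" using U(1) by blast
    fix H n assume H: "H \<lhd> G \<and> openin T H"
    let ?A = "\<gamma> H"
    have A: "?A \<lhd> G" "closedin T ?A" "?A \<noteq> {\<one>}"
      using lower_central_closed_normal lower_central_nontrivial H by auto
    obtain F1 where F1: "F1 \<lhd> G" "openin T F1" "\<gamma> F1 \<subseteq> max_invariant_core G T ?A"
      using ex_lower_central_subset[OF max_invariant_core_normal[OF A(1)]
          closedin_max_invariant_core[OF A(1,2)] max_invariant_core_nontrivial[OF A]] by blast
    obtain F2 where F2: "F2 \<lhd> G" "openin T F2"
      "\<forall>D. D \<lhd> G \<and> openin T D \<longrightarrow> \<gamma> D \<subseteq> H \<or> \<gamma> F2 \<subseteq> \<gamma> D"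
      using ex_lower_central_bound[OF fg] H by blast
    let ?H = "(F1 \<inter> F2) \<inter> (U n \<inter> H)"
    have "?H \<lhd> G" "openin T ?H"
      using F1 F2 U(1)[of n] H by (auto intro!: normal_subgroup_intersect)
    moreover have "\<gamma> ?H \<subseteq> \<gamma> F1" "\<gamma> ?H \<subseteq> \<gamma> F2" by (auto intro!: lower_central_mono)
    then have "\<gamma> ?H \<subseteq> max_invariant_core G T ?A"
      "\<forall>D. D \<lhd> G \<and> openin T D \<longrightarrow> \<gamma> D \<subseteq> H \<or> \<gamma> ?H \<subseteq> \<gamma> D"
      using F1(3) F2(3) by blast+
    ultimately show "\<exists>H'. (H' \<lhd> G \<and> openin T H') \<and> ?Q n H H'" by (intro exI[of _ ?H]) auto
  qed
  then obtain H where H: "\<And>n. (H n \<lhd> G \<and> openin T (H n)) \<and> ?Q n (H n) (H (Suc n))" by blast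
  have "\<exists>n. H (Suc n) \<subseteq> N" if N: "N \<lhd> G" "openin T N" for N
  proof -
    obtain n where n: "U n \<subseteq> N" using U(2)[OF N] by blast
    have "H (Suc n) \<subseteq> U n" using H[of n] by simp
    then show ?thesis using n by blast
  qed
  then show ?thesis using H by (intro exI[of _ H]) simp
qed

end

section \<open>The inverse system of a JNNF group\<close>

context profinite_group
begin

text \<open>The natural map from \<open>G/N'\<close> to \<open>G/N\<close> is realised as
  multiplication of a coset by the set \<open>N\<close>, without choosing representatives.\<close>

lemma quotient_transition:
  assumes N: "N \<lhd> G" and N': "N' \<lhd> G" "N' \<subseteq> N" and x: "x \<in> carrier G"
  shows "N <#> (N' #> x) = N #> x"
proof -
  note sN = normal_imp_subgroup[OF N] and sN' = normal_imp_subgroup[OF N'(1)]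
  have "N <#> N' = N"
    using set_mult_least[OF sN order_refl N'(2)] set_mult_superset(1)[OF sN sN'] by (rule subset_antisym)
  then show ?thesis
    using setmult_rcos_assoc[OF subgroup.subset[OF sN] subgroup.subset[OF sN'] x] by simp
qed

lemma quotient_transition_epi:
  assumes N: "N \<lhd> G" "closedin T N" and N': "N' \<lhd> G" "closedin T N'" "N' \<subseteq> N"
  shows "profinite_epi (G Mod N') (quotient_topology G T N') (G Mod N) (quotient_topology G T N) (\<lambda>C. N <#> C)"
proof -
  interpret E: profinite_epi G T "G Mod N" "quotient_topology G T N" "\<lambda>x. N #> x" by (rule quotient_epi[OF N])
  interpret E': profinite_epi G T "G Mod N'" "quotient_topology G T N'" "\<lambda>x. N' #> x"
    by (rule quotient_epi[OF N'(1,2)])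
  have tr: "N <#> (N' #> x) = N #> x" if "x \<in> carrier G" for x
    using quotient_transition[OF N(1) N'(1,3) that] .
  show ?thesis
  proof
    show "(\<lambda>C. N <#> C) \<in> hom (G Mod N') (G Mod N)"
    proof (rule homI)
      fix C assume "C \<in> carrier (G Mod N')"
      then show "N <#> C \<in> carrier (G Mod N)" using tr by (auto simp: carrier_FactGroup)
    next
      fix C D assume "C \<in> carrier (G Mod N')" "D \<in> carrier (G Mod N')"
      then obtain x y where xy: "x \<in> carrier G" "C = N' #> x" "y \<in> carrier G" "D = N' #> y"
        by (auto simp: carrier_FactGroup)
      then have "C \<otimes>\<^bsub>G Mod N'\<^esub> D = N' #> (x \<otimes> y)" using E'.hom_mult by simp
      then have "N <#> (C \<otimes>\<^bsub>G Mod N'\<^esub> D) = N #> (x \<otimes> y)" using tr xy by (simp only: m_closed)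
      also have "\<dots> = (N <#> C) \<otimes>\<^bsub>G Mod N\<^esub> (N <#> D)"
        using E.hom_mult[of x y] tr xy by simp
      finally show "N <#> (C \<otimes>\<^bsub>G Mod N'\<^esub> D) = (N <#> C) \<otimes>\<^bsub>G Mod N\<^esub> (N <#> D)" .
    qed
    have "continuous_map T (quotient_topology G T N) ((\<lambda>C. N <#> C) \<circ> (\<lambda>x. N' #> x))"
      using E.contf by (rule continuous_map_eq) (simp add: tr topspace_eq_carrier)
    then show "continuous_map (quotient_topology G T N') (quotient_topology G T N) (\<lambda>C. N <#> C)"
      using continuous_compose_quotient_map_eq[OF E'.quotient_map_f] by blast
    have "(\<lambda>C. N <#> C) ` carrier (G Mod N') = (\<lambda>x. N <#> (N' #> x)) ` carrier G"
      by (simp add: carrier_FactGroup image_image)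
    also have "\<dots> = carrier (G Mod N)"
      unfolding carrier_FactGroup by (intro image_cong refl tr)
    finally show "(\<lambda>C. N <#> C) ` carrier (G Mod N') = carrier (G Mod N)" .
  qed
qed

text \<open>Injectivity is the triviality of the intersection and surjectivity is compactness; the
  inverse is continuous because the domain is compact and the target Hausdorff.\<close>

lemma quotient_inverse_system:
  fixes K :: "nat \<Rightarrow> 'a set"
  assumes K: "\<And>n. K n \<lhd> G" "\<And>n. closedin T (K n)" and dec: "\<And>n. K (Suc n) \<subseteq> K n"
    and trivial: "(\<Inter>n. K n) = {\<one>}"
  defines "Gs \<equiv> \<lambda>n. G Mod K n" and "Ts \<equiv> \<lambda>n. quotient_topology G T (K n)" and "\<rho> \<equiv> \<lambda>n C. K n <#> C"
  shows "profinite_inverse_system Gs Ts \<rho>" "is_inverse_limit G T (\<lambda>n x. K n #> x) Gs Ts \<rho>"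
proof -
  have sK: "subgroup (K n) G" for n using normal_imp_subgroup[OF K(1)] .
  have E: "profinite_epi G T (Gs n) (Ts n) (\<lambda>x. K n #> x)" for n
    unfolding Gs_def Ts_def by (rule quotient_epi[OF K])
  have E': "profinite_epi (Gs (Suc n)) (Ts (Suc n)) (Gs n) (Ts n) (\<rho> n)" for n
    unfolding Gs_def Ts_def \<rho>_def by (rule quotient_transition_epi[OF K K dec])
  have prof: "profinite_group (Gs n) (Ts n)" for n
    unfolding Gs_def Ts_def by (rule profinite_quotient[OF K])
  show "profinite_inverse_system Gs Ts \<rho>"
    unfolding profinite_inverse_system_def
    using prof E'[unfolded profinite_epi_def profinite_epi_axioms_def] by blast
  have tr: "\<rho> n (K (Suc n) #> x) = K n #> x" if "x \<in> carrier G" for x n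
    unfolding \<rho>_def by (rule quotient_transition[OF K(1) K(1) dec that])
  let ?\<pi> = "\<lambda>x n. K n #> x"
  have carr: "?\<pi> x \<in> carrier (inverse_limit Gs \<rho>)" if "x \<in> carrier G" for x
    using that tr by (simp add: inverse_limit_def Gs_def carrier_FactGroup)
  have inj: "inj_on ?\<pi> (carrier G)"
  proof (rule inj_onI)
    fix x y assume xy: "x \<in> carrier G" "y \<in> carrier G" "?\<pi> x = ?\<pi> y"
    have "x \<otimes> inv y \<in> K n" for n
    proof -
      have "K n #> x = K n #> y" using fun_cong[OF xy(3)] .
      then have "x \<in> K n #> y" using rcos_self[OF xy(1) sK[of n]] by simp
      then show ?thesis using subgroup.rcos_module_imp[OF sK is_group xy(2)] by simp
    qed
    then have "x \<otimes> inv y = \<one>" using trivial by blast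
    then show "x = y" using xy(1,2) by (metis inv_equality inv_inv inv_closed)
  qed
  have surj: "?\<pi> ` carrier G = carrier (inverse_limit Gs \<rho>)"
  proof (intro subset_antisym image_subsetI carr)
    show "carrier (inverse_limit Gs \<rho>) \<subseteq> ?\<pi> ` carrier G"
    proof
      fix C assume C: "C \<in> carrier (inverse_limit Gs \<rho>)"
      have Cn: "C n \<in> carrier (Gs n)" "\<rho> n (C (Suc n)) = C n" for n
        using C by (auto simp: inverse_limit_def)
      have ex: "\<exists>x\<in>carrier G. C n = K n #> x" for n
        using Cn(1)[of n] by (auto simp: Gs_def carrier_FactGroup)
      \<comment> \<open>A compatible sequence of cosets is a decreasing sequence of non-empty closed
        sets; a point common to all of them maps to it.\<close>
      have "\<Inter>(range C) \<noteq> {}"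
      proof (rule compact_space_imp_nest[OF compact])
        fix n
        obtain x where x: "x \<in> carrier G" "C n = K n #> x" using ex by blast
        show "closedin T (C n)" unfolding x(2) by (rule closedin_r_coset[OF K(2) x(1)])
        show "C n \<noteq> {}" using x rcos_self[OF x(1) sK] by blast
      next
        have "C (Suc n) \<subseteq> C n" for n
        proof
          fix y assume y: "y \<in> C (Suc n)"
          obtain x where x: "x \<in> carrier G" "C (Suc n) = K (Suc n) #> x" using ex by blast
          then have "y \<in> carrier G" using y r_coset_subset_G[OF subgroup.subset[OF sK]] by blast
          then have "y = \<one> \<otimes> y" by simp
          then have "y \<in> K n <#> C (Suc n)"
            using y subgroup.one_closed[OF sK[of n]] unfolding set_mult_def by blast
          then show "y \<in> C n" using Cn(2)[of n] by (simp add: \<rho>_def)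
        qed
        then show "antimono_on UNIV C" by (rule decseq_SucI)
      qed
      then obtain x where x: "\<And>n. x \<in> C n" by blast
      have "x \<in> carrier G"
        using x[of 0] ex[of 0] r_coset_subset_G[OF subgroup.subset[OF sK]] by blast
      moreover have "?\<pi> x = C"
      proof
        fix n
        obtain y where y: "y \<in> carrier G" "C n = K n #> y" using ex by blast
        then show "K n #> x = C n" using x[of n] repr_independence[OF _ y(1) sK] by simp
      qed
      ultimately show "C \<in> ?\<pi> ` carrier G" by blast
    qed
  qed
  have top: "topspace (inverse_limit_topology Gs Ts \<rho>) = carrier (inverse_limit Gs \<rho>)"
  proof -
    have "topspace (Ts n) = carrier (Gs n)" for n
      using prof[of n] by (simp add: profinite_group_def topological_group_def topological_group_axioms_def)
    then show ?thesis by (auto simp: inverse_limit_topology_def inverse_limit_def)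
  qed
  have "homeomorphic_map T (inverse_limit_topology Gs Ts \<rho>) ?\<pi>"
  proof (rule continuous_imp_homeomorphic_map[OF _ compact])
    have "continuous_map T (Ts n) (\<lambda>x. K n #> x)" for n
      using E[of n] by (simp add: profinite_epi_def profinite_epi_axioms_def)
    then show "continuous_map T (inverse_limit_topology Gs Ts \<rho>) ?\<pi>"
      using carr unfolding inverse_limit_topology_def continuous_map_in_subtopology
      by (auto simp: continuous_map_componentwise_UNIV topspace_eq_carrier)
    have "Hausdorff_space (Ts n)" for n
      using prof[of n] by (simp add: profinite_group_def profinite_group_axioms_def)
    then show "Hausdorff_space (inverse_limit_topology Gs Ts \<rho>)"
      unfolding inverse_limit_topology_def
      by (intro Hausdorff_space_subtopology) (simp add: Hausdorff_space_product_topology)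
    show "?\<pi> ` topspace T = topspace (inverse_limit_topology Gs Ts \<rho>)"
      by (simp add: top topspace_eq_carrier surj)
    show "inj_on ?\<pi> (topspace T)" using inj by (simp add: topspace_eq_carrier)
  qed
  moreover have "?\<pi> \<in> iso G (inverse_limit Gs \<rho>)"
  proof -
    have "?\<pi> \<in> hom G (inverse_limit Gs \<rho>)"
    proof (rule homI[OF carr])
      fix x y assume "x \<in> carrier G" "y \<in> carrier G"
      then show "?\<pi> (x \<otimes> y) = ?\<pi> x \<otimes>\<^bsub>inverse_limit Gs \<rho>\<^esub> ?\<pi> y"
        using normal.rcos_sum[OF K(1)] by (simp add: inverse_limit_def Gs_def)
    qed
    then show ?thesis using inj surj by (simp add: iso_iff)
  qed
  ultimately show "is_inverse_limit G T (\<lambda>n x. K n #> x) Gs Ts \<rho>"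
    using topological_group_axioms by (simp add: is_inverse_limit_def)
qed

end

section \<open>Verification of conditions (i)-(iv) for the quotients\<close>

context JNNF_group
begin

lemma inverse_limit_exists:
  assumes fg: "fin_generated G T"
  shows "\<exists>(Gs :: nat \<Rightarrow> 'a set monoid) Ts \<rho> p P.
           profinite_inverse_system Gs Ts \<rho> \<and> is_inverse_limit G T p Gs Ts \<rho> \<and> JNNF_conditions c Gs Ts \<rho> P"
proof -
  obtain H :: "nat \<Rightarrow> 'a set" where H: "\<And>n. H n \<lhd> G" "\<And>n. openin T (H n)" "\<And>n. H (Suc n) \<subseteq> H n"
    and HM: "\<And>n. \<gamma> (H (Suc n)) \<subseteq> max_invariant_core G T (\<gamma> (H n))"
    and Hiv: "\<And>n D. D \<lhd> G \<Longrightarrow> openin T D \<Longrightarrow> \<gamma> D \<subseteq> H n \<or> \<gamma> (H (Suc n)) \<subseteq> \<gamma> D"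
    and Hbase: "\<And>N. N \<lhd> G \<Longrightarrow> openin T N \<Longrightarrow> \<exists>n. H (Suc n) \<subseteq> N"
    using ex_descending_sequence[OF fg] by (elim exE conjE) blast
  \<comment> \<open>With this shift \<open>\<gamma> (H (n+1))\<close> lies strictly above
    \<open>K n\<close> and, for \<open>n > 0\<close>, inside \<open>K (n-1)\<close>. So its image in
    \<open>G/K n\<close> is non-trivial and contained in the kernel of the map to
    \<open>G/K (n-1)\<close>.\<close>
  define K where "K n = max_invariant_core G T (\<gamma> (H (Suc n)))" for n
  have A: "\<gamma> (H n) \<lhd> G" "closedin T (\<gamma> (H n))" "\<gamma> (H n) \<noteq> {\<one>}" "\<gamma> (H n) \<subseteq> H n" for n
    using lower_central_closed_normal[OF H(1,2)] lower_central_nontrivial[OF H(1,2)] by auto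
  have K: "K n \<lhd> G" "closedin T (K n)" "K n \<noteq> {\<one>}" for n
    unfolding K_def using max_invariant_core_normal[OF A(1)] closedin_max_invariant_core[OF A(1,2)]
      max_invariant_core_nontrivial[OF A(1-3)] by auto
  have Kpsub: "K n \<subset> \<gamma> (H (Suc n))" for n
    unfolding K_def by (rule max_invariant_core_psubset[OF A(1) A(3)])
  have Ksup: "\<gamma> (H (Suc (Suc n))) \<subseteq> K n" for n unfolding K_def by (rule HM)
  have dec: "K (Suc n) \<subseteq> K n" for n using Kpsub[of "Suc n"] Ksup[of n] by blast
  have KH: "K n \<subseteq> H (Suc n)" for n using Kpsub[of n] A(4)[of "Suc n"] by blast
  have \<gamma>dec: "\<gamma> (H (Suc n)) \<subset> \<gamma> (H n)" for n
    using HM[of n] max_invariant_core_psubset[OF A(1) A(3), of n] by blast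
  have "(\<Inter>n. K n) \<subseteq> {\<one>}"
  proof
    fix x assume x: "x \<in> (\<Inter>n. K n)"
    show "x \<in> {\<one>}"
    proof (rule ccontr)
      assume "x \<notin> {\<one>}"
      moreover have "x \<in> carrier G" using x subgroup.subset[OF normal_imp_subgroup[OF K(1)[of 0]]] by auto
      ultimately obtain N where N: "N \<lhd> G" "openin T N" "x \<notin> N" using open_normal_separating[of x] by auto
      obtain n where "H (Suc n) \<subseteq> N" using Hbase[OF N(1,2)] by blast
      then show False using x KH[of n] N(3) by blast
    qed
  qed
  then have triv: "(\<Inter>n. K n) = {\<one>}"
    using subgroup.one_closed[OF normal_imp_subgroup[OF K(1)]] by blast
  define Gs where "Gs n = G Mod K n" for n
  define Ts where "Ts n = quotient_topology G T (K n)" for n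
  define \<rho> where "\<rho> n C = K n <#> C" for n C
  define f where "f n x = K n #> x" for n x
  define P where "P n = f n ` H n" for n
  have sys: "profinite_inverse_system Gs Ts \<rho>" "is_inverse_limit G T f Gs Ts \<rho>"
    using quotient_inverse_system[OF K(1,2) dec triv]
    unfolding Gs_def[abs_def] Ts_def[abs_def] \<rho>_def[abs_def] f_def[abs_def] by auto
  have "JNNF_conditions c Gs Ts \<rho> P"
    unfolding JNNF_conditions_def Let_def
  proof (rule allI)
    fix n
    let ?\<gamma> = "lower_central (Gs n) (Ts n) (c + 1)" and ?Q = "\<rho> n ` P (Suc n)"
    let ?M = "max_invariant_core (Gs n) (Ts n) (f n ` \<gamma> (H n))"
    let ?M' = "max_invariant_core (Gs n) (Ts n) (?\<gamma> (P n))"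
    let ?N = "kernel (Gs n) (Gs (n - 1)) (\<rho> (n - 1))"
    interpret E: profinite_epi G T "Gs n" "Ts n" "f n"
      unfolding Gs_def Ts_def f_def[abs_def] by (rule quotient_epi[OF K(1,2)])
    have ker: "kernel G (Gs n) (f n) = K n"
      unfolding Gs_def f_def[abs_def] by (rule kernel_quotient[OF K(1)])
    have HG: "H m \<subseteq> carrier G" for m using openin_subset_carrier[OF H(2)] .
    have Q: "\<rho> n ` P (Suc n) = f n ` H (Suc n)"
      unfolding P_def image_image
    proof (rule image_cong[OF refl])
      fix x assume "x \<in> H (Suc n)"
      then have "x \<in> carrier G" using HG by (rule subsetD[rotated])
      then show "\<rho> n (f (Suc n) x) = f n x"
        unfolding \<rho>_def f_def by (rule quotient_transition[OF K(1) K(1) dec])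
    qed
    have \<gamma>f: "?\<gamma> (f n ` X) = f n ` \<gamma> X" if "X \<subseteq> carrier G" for X
      using E.image_lower_central[OF that] by simp
    have sub_iff: "f n ` X \<subseteq> f n ` Y \<longleftrightarrow> X \<subseteq> Y" if "X \<subseteq> carrier G" "subgroup Y G" "K n \<subseteq> Y" for X Y
      using E.image_subset_image_iff[OF that(1,2)] that(3) ker by simp
    have sH: "subgroup (H m) G" for m using normal_imp_subgroup[OF H(1)] .
    have s\<gamma>: "subgroup (\<gamma> (H m)) G" for m using normal_imp_subgroup[OF A(1)] .
    have \<gamma>G: "\<gamma> (H m) \<subseteq> carrier G" for m using subgroup.subset[OF s\<gamma>] .
    have fone: "f n ` X \<noteq> {\<one>\<^bsub>Gs n\<^esub>}" if "X \<subseteq> carrier G" "\<not> X \<subseteq> K n" for X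
    proof
      assume eq: "f n ` X = {\<one>\<^bsub>Gs n\<^esub>}"
      have "X \<subseteq> K n"
      proof
        fix x assume x: "x \<in> X"
        then have "f n x = \<one>\<^bsub>Gs n\<^esub>" using eq by blast
        then have "x \<in> kernel G (Gs n) (f n)" using x that(1) by (auto simp: kernel_def)
        then show "x \<in> K n" using ker by simp
      qed
      then show False using that(2) by simp
    qed
    have Kn\<gamma>: "K n \<subseteq> \<gamma> (H n)" using Kpsub[of n] \<gamma>dec[of n] by blast
    have 1: "P n \<lhd> Gs n" "openin (Ts n) (P n)"
      unfolding P_def using E.normal_image[OF H(1)] E.openin_image[OF H(2)] by auto
    have 2: "virtually_nilpotent c (Gs n) (Ts n)"
      using JNNF K[of n] unfolding Gs_def Ts_def JNNF_def by simp
    \<comment> \<open>Strictness survives in the quotient because \<open>K n\<close> is contained in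
      \<open>H (Suc n)\<close>.\<close>
    have "H (Suc n) \<noteq> H n" using \<gamma>dec[of n] by auto
    then have 3: "f n ` H (Suc n) \<subset> P n"
      using sub_iff[OF HG sH KH, of n] H(3)[of n] unfolding P_def by blast
    have 4: "?M \<subset> f n ` \<gamma> (H n)"
      using \<gamma>G Kpsub[of n] \<gamma>dec[of n] by (intro E.G'.max_invariant_core_psubset E.normal_image A fone) auto
    have core: "f n ` max_invariant_core G T (\<gamma> (H n)) \<subseteq> ?M"
      by (rule E.image_max_invariant_core[OF A(1)])
    have 5: "f n ` \<gamma> (H (Suc n)) \<subseteq> ?M" if "n = 0"
      using core image_mono[OF HM[of n], of "f n"] by blast
    have 6: "?N \<subseteq> ?M"
      "f n ` \<gamma> (H (Suc n)) \<subseteq> ?N" if "n \<noteq> 0"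
    proof -
      obtain m where m: "n = Suc m" using \<open>n \<noteq> 0\<close> by (cases n) auto
      have tr: "\<rho> m (f n x) = f m x" if "x \<in> carrier G" for x
        unfolding \<rho>_def f_def m by (rule quotient_transition[OF K(1) K(1) dec that])
      have kerm: "kernel G (Gs m) (f m) = K m"
        unfolding Gs_def f_def[abs_def] by (rule kernel_quotient[OF K(1)])
      \<comment> \<open>The composite of \<open>f n\<close> and \<open>\<rho> m\<close> is
        \<open>f m\<close>, whose kernel \<open>K m\<close> is the core of
        \<open>\<gamma> (H n)\<close>.\<close>
      have "kernel (Gs n) (Gs m) (\<rho> m) = f n ` K m"
      proof (intro subset_antisym subsetI)
        fix C assume "C \<in> kernel (Gs n) (Gs m) (\<rho> m)"
        then have C: "C \<in> f n ` carrier G" "\<rho> m C = \<one>\<^bsub>Gs m\<^esub>"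
          using E.surjf by (auto simp: kernel_def)
        then obtain x where x: "x \<in> carrier G" "C = f n x" "\<rho> m C = \<one>\<^bsub>Gs m\<^esub>" by blast
        then have "x \<in> kernel G (Gs m) (f m)" using tr by (simp add: kernel_def)
        then show "C \<in> f n ` K m" using x kerm by blast
      next
        fix C assume "C \<in> f n ` K m"
        then obtain x where x: "x \<in> K m" "C = f n x" by blast
        then have "x \<in> carrier G" "f m x = \<one>\<^bsub>Gs m\<^esub>" using kerm by (auto simp: kernel_def)
        then show "C \<in> kernel (Gs n) (Gs m) (\<rho> m)" using x(2) tr by (auto simp: kernel_def)
      qed
      then have ker': "?N = f n ` K m" by (simp add: m)
      show "?N \<subseteq> ?M"
        unfolding ker' using core by (simp add: K_def m)
      show "f n ` \<gamma> (H (Suc n)) \<subseteq> ?N"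
        unfolding ker' using Ksup[of m] by (auto simp: m)
    qed
    have 7: "f n ` \<gamma> (H (Suc n)) \<noteq> {\<one>\<^bsub>Gs n\<^esub>}"
      using Kpsub[of n] by (intro fone \<gamma>G) blast
    have 8: "?\<gamma> N \<subseteq> P n \<or> f n ` \<gamma> (H (Suc n)) \<subseteq> ?\<gamma> N"
      if N: "N \<lhd> Gs n \<and> openin (Ts n) N" for N
    proof -
      \<comment> \<open>The preimage of \<open>N\<close> is open and normal in \<open>G\<close> and
        has image \<open>N\<close>, so the dichotomy built into the sequence \<open>H\<close>
        applies to it.\<close>
      let ?D = "{x \<in> carrier G. f n x \<in> N}"
      have D: "?D \<lhd> G" "openin T ?D" using N E.normal_vimage E.openin_vimage by auto
      have "f n ` ?D = N" using N E.G'.openin_subset_carrier by (intro E.image_vimage) blast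
      then have eq: "?\<gamma> N = f n ` \<gamma> ?D" using \<gamma>f[of ?D] by simp
      show ?thesis
        unfolding eq P_def using Hiv[OF D, of n] by blast
    qed
    show "(P n \<lhd> Gs n \<and> openin (Ts n) (P n)) \<and> virtually_nilpotent c (Gs n) (Ts n) \<and> ?Q \<subset> P n \<and>
         (?M' \<subset> ?\<gamma> (P n) \<and>
          (if n = 0 then ?\<gamma> ?Q \<subseteq> ?M' else ?N \<subseteq> ?M' \<and> ?\<gamma> ?Q \<subseteq> ?N) \<and> ?\<gamma> ?Q \<noteq> {\<one>\<^bsub>Gs n\<^esub>}) \<and>
         (\<forall>N. N \<lhd> Gs n \<and> openin (Ts n) N \<longrightarrow> ?\<gamma> N \<subseteq> P n \<or> ?\<gamma> ?Q \<subseteq> ?\<gamma> N)"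
      unfolding Q \<gamma>f[OF HG, of "Suc n"] \<gamma>f[OF HG, of n, folded P_def]
      using 1 2 3 4 5 6 7 8 by simp
  qed
  then show ?thesis using sys by blast
qed

end

section \<open>Limits of systems satisfying the JNNF conditions\<close>

context profinite_group
begin

text \<open>If the next term is trivial, then \<open>lcs i N\<close> commutes with \<open>N\<close>,
  so it is an abelian closed normal subgroup and vanishes; this repeats down to
  \<open>i = 1\<close>.\<close>

lemma fitting_free_lower_central:
  assumes ff: "fitting_free G T" and N: "N \<lhd> G" "closedin T N"
    and i: "i \<ge> 1" and triv: "lcs i N \<subseteq> {\<one>}"
  shows "N = {\<one>}"
  using i triv
proof (induction rule: lower_central_induct)
  case 1
  then show ?case using subgroup.one_closed[OF normal_imp_subgroup[OF N(1)]] by auto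
next
  case (Suc i)
  let ?A = "lcs i N"
  have A: "?A \<lhd> G" using lower_central_normal[OF N(1)] .
  note sA = normal_imp_subgroup[OF A]
  have "x \<otimes> y = y \<otimes> x" if "x \<in> ?A" "y \<in> ?A" for x y
  proof -
    have "y \<in> N" using lower_central_subset[OF N] that(2) by auto
    then have "commutator G x y = \<one>"
      using commutator_in_lower_central[OF Suc(1) that(1)] Suc.prems by auto
    then show ?thesis
      using commutator_eq_one_iff subgroup.mem_carrier[OF sA] that by blast
  qed
  then have "comm_group (G\<lparr>carrier := ?A\<rparr>)" by (rule comm_group_if_commute[OF sA])
  then have "?A = {\<one>}"
    using ff A lower_central_closed_subgroup(2)[OF normal_imp_subgroup[OF N(1)] N(2)]
    by (simp add: fitting_free_def)
  then show ?case using Suc.IH by simp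
qed

text \<open>For \<open>U\<close> open normal, \<open>Y\<close> and \<open>Y U\<close> have the same
  image in \<open>G/U\<close>, hence so have their lower central terms. Statements about open normal
  subgroups, such as (iv), pass to closed ones in this way.\<close>

lemma lower_central_eq_Inter:
  assumes Y: "Y \<lhd> G" "closedin T Y"
    and x: "\<And>N. N \<lhd> G \<Longrightarrow> openin T N \<Longrightarrow> Y \<subseteq> N \<Longrightarrow> x \<in> lcs i N"
  shows "x \<in> lcs i Y"
proof (rule closed_memI)
  note sY = normal_imp_subgroup[OF Y(1)]
  show "closedin T (lcs i Y)" using lower_central_closed_subgroup[OF sY Y(2)] by blast
  have "carrier G \<lhd> G" by (simp add: normal_inv_iff subgroup_self)
  then show xG: "x \<in> carrier G"
    using x[OF _ openin_carrier subgroup.subset[OF sY]] lower_central_subset_carrier[OF order_refl] by blast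
  fix U assume U: "U \<lhd> G" "openin T U"
  note sU = normal_imp_subgroup[OF U(1)]
  note YU = open_normal_set_mult[OF Y(1) U]
  interpret E: profinite_epi G T "G Mod U" "quotient_topology G T U" "\<lambda>x. U #> x"
    by (rule quotient_epi[OF U(1) closedin_open_subgroup[OF sU U(2)]])
  have YG: "Y \<subseteq> carrier G" using subgroup.subset[OF sY] .
  have "(\<lambda>x. U #> x) ` (Y <#> U) = (\<lambda>x. U #> x) ` Y"
  proof (rule subset_antisym[OF image_subsetI image_mono[OF YU(3)]])
    fix z assume "z \<in> Y <#> U"
    then obtain y u where "y \<in> Y" "u \<in> U" "z = y \<otimes> u" by (auto simp: set_mult_def)
    then show "U #> z \<in> (\<lambda>x. U #> x) ` Y"
      using r_coset_mult_right_mem[OF U(1)] YG by (intro image_eqI[of _ _ y]) auto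
  qed
  then have "(\<lambda>x. U #> x) ` lcs i (Y <#> U) = (\<lambda>x. U #> x) ` lcs i Y"
    using E.image_lower_central[OF YG] E.image_lower_central[OF subgroup.subset[OF normal_imp_subgroup[OF YU(1)]]]
    by simp
  moreover have "x \<in> lcs i (Y <#> U)" using x[OF YU(1-3)] .
  ultimately have "U #> x \<in> (\<lambda>x. U #> x) ` lcs i Y" by blast
  then obtain a where a: "a \<in> lcs i Y" "U #> x = U #> a" by blast
  have "a \<in> carrier G" using a(1) lower_central_subset_carrier[OF YG] by blast
  then obtain u where "u \<in> U" "x = a \<otimes> u" using r_coset_eq_imp_right[OF U(1) xG _ a(2)] by blast
  then show "x \<in> lcs i Y <#> U" using a(1) unfolding set_mult_def by blast
qed

end

text \<open>Profiniteness is assumed of the members of the system; for \<open>G\<close>, a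
  topological group by the definition of the limit, it is derived below.\<close>

locale profinite_limit =
  fixes G (structure) and T and \<pi> and Hs and Us and \<sigma>
  assumes sys: "profinite_inverse_system Hs Us \<sigma>"
    and lim: "is_inverse_limit G T \<pi> Hs Us \<sigma>"
begin

lemma profinite_Hs: "profinite_group (Hs n) (Us n)"
  using sys by (simp add: profinite_inverse_system_def)

lemma transition_epi: "profinite_epi (Hs (Suc n)) (Us (Suc n)) (Hs n) (Us n) (\<sigma> n)"
  unfolding profinite_epi_def profinite_epi_axioms_def
  using sys by (simp add: profinite_inverse_system_def)

lemma topspace_Us: "topspace (Us n) = carrier (Hs n)"
  using profinite_Hs[of n] by (simp add: profinite_group_def topological_group_def topological_group_axioms_def)

lemma top_group: "topological_group G T"
  using lim by (simp add: is_inverse_limit_def)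

lemma iso_lim: "(\<lambda>x n. \<pi> n x) \<in> iso G (inverse_limit Hs \<sigma>)"
  using lim by (simp add: is_inverse_limit_def)

lemma homeo_lim: "homeomorphic_map T (inverse_limit_topology Hs Us \<sigma>) (\<lambda>x n. \<pi> n x)"
  using lim by (simp add: is_inverse_limit_def)

lemma in_lim:
  assumes "x \<in> carrier G"
  shows "\<pi> n x \<in> carrier (Hs n)" "\<sigma> n (\<pi> (Suc n) x) = \<pi> n x"
proof -
  have "(\<lambda>n. \<pi> n x) \<in> carrier (inverse_limit Hs \<sigma>)"
    using iso_lim assms by (auto simp: iso_iff)
  then show "\<pi> n x \<in> carrier (Hs n)" "\<sigma> n (\<pi> (Suc n) x) = \<pi> n x" by (auto simp: inverse_limit_def)
qed

lemma hom_\<pi>: "\<pi> n \<in> hom G (Hs n)"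
proof (rule homI[OF in_lim(1)])
  fix x y assume "x \<in> carrier G" "y \<in> carrier G"
  then have "(\<lambda>n. \<pi> n (x \<otimes> y)) = (\<lambda>n. \<pi> n x) \<otimes>\<^bsub>inverse_limit Hs \<sigma>\<^esub> (\<lambda>n. \<pi> n y)"
    using iso_lim by (simp add: iso_def hom_def)
  then show "\<pi> n (x \<otimes> y) = \<pi> n x \<otimes>\<^bsub>Hs n\<^esub> \<pi> n y"
    by (simp add: inverse_limit_def fun_eq_iff)
qed

lemma \<pi>_eqI:
  assumes "x \<in> carrier G" "y \<in> carrier G" "\<And>n. \<pi> n x = \<pi> n y"
  shows "x = y"
proof -
  have "inj_on (\<lambda>x n. \<pi> n x) (carrier G)" using iso_lim by (simp add: iso_iff)
  then show ?thesis by (rule inj_onD) (use assms in auto)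
qed

text \<open>A compatible sequence through \<open>y\<close> has two halves: upwards from
  \<open>n\<close> by choosing preimages under the surjective transition maps, downwards by applying
  these maps.\<close>

lemma \<pi>_surj: "\<pi> n ` carrier G = carrier (Hs n)"
proof (intro subset_antisym image_subsetI in_lim subsetI)
  fix y assume y: "y \<in> carrier (Hs n)"
  have "\<exists>w. \<forall>k. w k \<in> carrier (Hs (n + k)) \<and> (k = 0 \<longrightarrow> w k = y) \<and> \<sigma> (n + k) (w (Suc k)) = w k"
  proof -
    have "\<exists>w. \<forall>k. (w k \<in> carrier (Hs (n + k)) \<and> (k = 0 \<longrightarrow> w k = y)) \<and> \<sigma> (n + k) (w (Suc k)) = w k"
    proof (rule dependent_nat_choice)
      show "\<exists>w. w \<in> carrier (Hs (n + 0)) \<and> ((0::nat) = 0 \<longrightarrow> w = y)" using y by auto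
      fix w k assume "w \<in> carrier (Hs (n + k)) \<and> (k = 0 \<longrightarrow> w = y)"
      then have "w \<in> \<sigma> (n + k) ` carrier (Hs (Suc (n + k)))"
        using profinite_epi.surjf[OF transition_epi] by simp
      then show "\<exists>w'. (w' \<in> carrier (Hs (n + Suc k)) \<and> (Suc k = 0 \<longrightarrow> w' = y)) \<and> \<sigma> (n + k) w' = w" by auto
    qed
    then show ?thesis by simp
  qed
  then obtain w where w: "\<And>k. w k \<in> carrier (Hs (n + k))" "w 0 = y" "\<And>k. \<sigma> (n + k) (w (Suc k)) = w k" by blast
  \<comment> \<open>The value \<open>v k\<close> lives in \<open>Hs (n - k)\<close>; only
    \<open>k \<le> n\<close> is used, so the truncated subtraction does no harm.\<close>
  define v where "v = rec_nat y (\<lambda>k. \<sigma> (n - Suc k))"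
  have v: "v 0 = y" "v (Suc k) = \<sigma> (n - Suc k) (v k)" for k by (simp_all add: v_def)
  have vc: "v k \<in> carrier (Hs (n - k))" if "k \<le> n" for k
    using that
  proof (induction k)
    case (Suc k)
    then have "n - k = Suc (n - Suc k)" by simp
    then have "v k \<in> carrier (Hs (Suc (n - Suc k)))" using Suc by simp
    then show ?case unfolding v(2) using profinite_epi.surjf[OF transition_epi, of "n - Suc k"] by blast
  qed (simp add: v y)
  define z where "z m = (if m \<le> n then v (n - m) else w (m - n))" for m
  have zc: "z m \<in> carrier (Hs m)" for m
    using vc[of "n - m"] w(1)[of "m - n"] by (cases "m \<le> n") (auto simp: z_def)
  have z\<sigma>: "\<sigma> m (z (Suc m)) = z m" for m
  proof -
    consider "m < n" | "m \<ge> n" by linarith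
    then show ?thesis
    proof cases
      case 1
      then have "n - m = Suc (n - Suc m)" "n - Suc (n - Suc m) = m" by auto
      then show ?thesis using 1 v(2)[of "n - Suc m"] by (simp add: z_def)
    next
      case 2
      have "z m = w (m - n)" using 2 w(2) v(1) by (cases "m = n") (auto simp: z_def)
      moreover have "z (Suc m) = w (Suc (m - n))" using 2 by (simp add: z_def Suc_diff_le)
      ultimately show ?thesis using w(3)[of "m - n"] 2 by simp
    qed
  qed
  have "z \<in> carrier (inverse_limit Hs \<sigma>)" using zc z\<sigma> by (simp add: inverse_limit_def)
  then have "z \<in> (\<lambda>x n. \<pi> n x) ` carrier G" using iso_lim by (simp add: iso_iff)
  then obtain x where "x \<in> carrier G" "z = (\<lambda>n. \<pi> n x)" by blast
  moreover have "z n = y" by (simp add: z_def v)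
  ultimately show "y \<in> \<pi> n ` carrier G" by auto
qed

lemma continuous_\<pi>: "continuous_map T (Us n) (\<pi> n)"
proof -
  have "continuous_map T (inverse_limit_topology Hs Us \<sigma>) (\<lambda>x n. \<pi> n x)"
    using homeo_lim by (rule homeomorphic_imp_continuous_map)
  then have "continuous_map T (product_topology Us UNIV) (\<lambda>x n. \<pi> n x)"
    by (simp add: inverse_limit_topology_def continuous_map_in_subtopology)
  then show ?thesis by (simp add: continuous_map_componentwise_UNIV)
qed

text \<open>Compatible sequences form an intersection of equalisers of continuous maps into
  Hausdorff spaces, a closed subset of a compact product. Points that differ in coordinate
  \<open>n\<close> are separated by the preimage of a clopen subset of \<open>Hs n\<close>.\<close>

lemma profinite_limit_group: "profinite_group G T"
proof -
  interpret topological_group G T by (rule top_group)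
  have HsT: "compact_space (Us n)" "Hausdorff_space (Us n)" for n
    using profinite_Hs[of n] by (simp_all add: profinite_group_def profinite_group_axioms_def)
  let ?X = "product_topology Us UNIV"
  have "carrier (inverse_limit Hs \<sigma>) = (\<Inter>n. {x \<in> topspace ?X. \<sigma> n (x (Suc n)) = x n})"
    by (auto simp: inverse_limit_def topspace_Us)
  moreover have "closedin ?X {x \<in> topspace ?X. \<sigma> n (x (Suc n)) = x n}" for n
  proof (rule closedin_continuous_maps_eq[OF HsT(2)])
    show "continuous_map ?X (Us n) (\<lambda>x. x n)" by (rule continuous_map_product_projection) simp
    have "continuous_map ?X (Us (Suc n)) (\<lambda>x. x (Suc n))" by (rule continuous_map_product_projection) simp
    from continuous_map_compose[OF this profinite_epi.contf[OF transition_epi]]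
    show "continuous_map ?X (Us n) (\<lambda>x. \<sigma> n (x (Suc n)))" by (simp add: o_def)
  qed
  ultimately have "closedin ?X (carrier (inverse_limit Hs \<sigma>))" by auto
  moreover have "compact_space ?X" using HsT by (simp add: compact_space_product_topology)
  ultimately have "compact_space (inverse_limit_topology Hs Us \<sigma>)"
    unfolding inverse_limit_topology_def by (intro compact_space_subtopology closedin_compact_space)
  then have comp: "compact_space T"
    using homeomorphic_compact_space[OF homeomorphic_map_imp_homeomorphic_space[OF homeo_lim]] by simp
  have sep: "\<exists>A. openin T A \<and> closedin T A \<and> x \<in> A \<and> y \<notin> A"
    if xy: "x \<in> topspace T" "y \<in> topspace T" "x \<noteq> y" for x y
  proof -
    have G: "x \<in> carrier G" "y \<in> carrier G" using xy topspace_eq_carrier by auto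
    then obtain n where n: "\<pi> n x \<noteq> \<pi> n y" using \<pi>_eqI xy(3) by blast
    interpret H: profinite_group "Hs n" "Us n" by (rule profinite_Hs)
    have "closedin (Us n) {\<pi> n y}"
      using HsT(2) in_lim(1)[OF G(2)] by (simp add: closedin_Hausdorff_singleton topspace_Us)
    then have "openin (Us n) (carrier (Hs n) - {\<pi> n y})" using H.openin_carrier by (intro openin_diff)
    then obtain C where C: "openin (Us n) C" "closedin (Us n) C" "\<pi> n x \<in> C" "C \<subseteq> carrier (Hs n) - {\<pi> n y}"
      using H.clopen_base[of "carrier (Hs n) - {\<pi> n y}" "\<pi> n x"] in_lim(1)[OF G(1)] n by blast
    have "openin T {z \<in> topspace T. \<pi> n z \<in> C}" "closedin T {z \<in> topspace T. \<pi> n z \<in> C}"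
      using openin_continuous_map_preimage[OF continuous_\<pi> C(1)]
        closedin_continuous_map_preimage[OF continuous_\<pi> C(2)] by auto
    then show ?thesis using C(3,4) xy(1) by (intro exI[of _ "{z \<in> topspace T. \<pi> n z \<in> C}"]) auto
  qed
  show ?thesis
    by (intro profinite_group.intro profinite_group_axioms.intro top_group comp
        clopen_separation_imp[of T, OF sep])
qed

sublocale profinite_group G T
  by (rule profinite_limit_group)

lemma \<pi>_epi: "profinite_epi G T (Hs n) (Us n) (\<pi> n)"
  unfolding profinite_epi_def profinite_epi_axioms_def
  using profinite_limit_group profinite_Hs hom_\<pi> continuous_\<pi> \<pi>_surj by simp

text \<open>The elements of \<open>K\<close> that agree with \<open>x\<close> at level
  \<open>n\<close> form a decreasing sequence of non-empty closed sets; a common element agrees with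
  \<open>x\<close> at all levels.\<close>

lemma closed_if_in_all_images:
  assumes K: "closedin T K" and x: "x \<in> carrier G" and all: "\<And>n. \<pi> n x \<in> \<pi> n ` K"
  shows "x \<in> K"
proof -
  have KG: "K \<subseteq> carrier G" using closedin_subset_carrier[OF K] .
  let ?C = "\<lambda>n. K \<inter> {k \<in> carrier G. \<pi> n k \<in> {\<pi> n x}}"
  have "\<Inter>(range ?C) \<noteq> {}"
  proof (rule compact_space_imp_nest[OF compact])
    fix n
    interpret H: profinite_group "Hs n" "Us n" by (rule profinite_Hs)
    have "closedin (Us n) {\<pi> n x}"
      using H.Hausdorff in_lim(1)[OF x] by (simp add: closedin_Hausdorff_singleton topspace_Us)
    then show "closedin T (?C n)" by (intro closedin_Int K profinite_epi.closedin_vimage[OF \<pi>_epi])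
    obtain k where "k \<in> K" "\<pi> n x = \<pi> n k" using all[of n] by blast
    then have "k \<in> ?C n" using KG by auto
    then show "?C n \<noteq> {}" by (rule not_empty_if_mem)
  next
    have "?C (Suc n) \<subseteq> ?C n" for n
    proof
      fix k assume k: "k \<in> ?C (Suc n)"
      then have "\<pi> n k = \<pi> n x" using in_lim(2)[of k n] in_lim(2)[OF x, of n] by auto
      then show "k \<in> ?C n" using k by auto
    qed
    then show "antimono_on UNIV ?C" by (rule decseq_SucI)
  qed
  then obtain k where k: "\<And>n. k \<in> ?C n" by blast
  have "k = x" by (rule \<pi>_eqI) (use k x in auto)
  then show ?thesis using k by auto
qed

end

section \<open>The converse: limits of systems with (i)-(iv)\<close>

locale JNNF_limit = profinite_limit +
  fixes c R
  assumes cond: "JNNF_conditions c Hs Us \<sigma> R"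
    and ff: "fitting_free G T"
begin

abbreviation \<Gamma> where "\<Gamma> n \<equiv> lower_central (Hs n) (Us n) (c + 1)"

abbreviation Q where "Q n \<equiv> \<sigma> n ` R (Suc n)"

text \<open>The parts about kernels are stated at \<open>Suc n\<close>, where the exceptional case
  of index \<open>0\<close> does not arise.\<close>

lemma
  shows R_open_normal: "R n \<lhd> Hs n" "openin (Us n) (R n)"
    and vnil: "virtually_nilpotent c (Hs n) (Us n)"
    and Q_psubset: "Q n \<subset> R n"
    and kernel_subset_core: "kernel (Hs (Suc n)) (Hs n) (\<sigma> n) \<subseteq>
           max_invariant_core (Hs (Suc n)) (Us (Suc n)) (\<Gamma> (Suc n) (R (Suc n)))"
    and \<Gamma>_Q_subset: "\<Gamma> (Suc n) (Q (Suc n)) \<subseteq> kernel (Hs (Suc n)) (Hs n) (\<sigma> n)"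
    and \<Gamma>_Q_nontrivial: "\<Gamma> n (Q n) \<noteq> {\<one>\<^bsub>Hs n\<^esub>}"
    and dichotomy: "N \<lhd> Hs n \<Longrightarrow> openin (Us n) N \<Longrightarrow> \<Gamma> n N \<subseteq> R n \<or> \<Gamma> n (Q n) \<subseteq> \<Gamma> n N"
proof -
  note C = cond[unfolded JNNF_conditions_def Let_def, THEN spec]
  show "R n \<lhd> Hs n" "openin (Us n) (R n)" "virtually_nilpotent c (Hs n) (Us n)" "Q n \<subset> R n"
    "\<Gamma> n (Q n) \<noteq> {\<one>\<^bsub>Hs n\<^esub>}"
    "N \<lhd> Hs n \<Longrightarrow> openin (Us n) N \<Longrightarrow> \<Gamma> n N \<subseteq> R n \<or> \<Gamma> n (Q n) \<subseteq> \<Gamma> n N"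
    using C[of n] by blast+
  show "kernel (Hs (Suc n)) (Hs n) (\<sigma> n) \<subseteq>
           max_invariant_core (Hs (Suc n)) (Us (Suc n)) (\<Gamma> (Suc n) (R (Suc n)))"
    "\<Gamma> (Suc n) (Q (Suc n)) \<subseteq> kernel (Hs (Suc n)) (Hs n) (\<sigma> n)"
    using C[of "Suc n"] by simp_all
qed

definition H where "H n = {x \<in> carrier G. \<pi> n x \<in> R n}"

lemma H_open_normal: "H n \<lhd> G" "openin T (H n)"
  unfolding H_def using profinite_epi.normal_vimage[OF \<pi>_epi R_open_normal(1)]
    profinite_epi.openin_vimage[OF \<pi>_epi R_open_normal(2)] by auto

lemma image_H_Suc: "\<pi> n ` H (Suc n) \<subseteq> Q n"
proof (rule image_subsetI)
  fix x assume "x \<in> H (Suc n)"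
  then show "\<pi> n x \<in> Q n"
    using in_lim(2)[of x n] by (intro image_eqI[of _ _ "\<pi> (Suc n) x"]) (auto simp: H_def)
qed

lemma H_Suc: "H (Suc n) \<subseteq> H n"
proof
  fix x assume x: "x \<in> H (Suc n)"
  then have "\<pi> n x \<in> R n" using image_H_Suc[of n] Q_psubset[of n] by blast
  then show "x \<in> H n" using x by (auto simp: H_def)
qed

lemma H_antimono: "m \<le> n \<Longrightarrow> H n \<subseteq> H m"
  by (induction n rule: dec_induct) (use H_Suc in auto)

text \<open>At level \<open>n+1\<close> the intersection maps into \<open>Q (n+1)\<close>, so its
  term of index \<open>c+1\<close> maps into the kernel of \<open>\<sigma> n\<close> and is trivial
  at level \<open>n\<close>. This holds for every \<open>n\<close>, and Fitting-freeness does the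
  rest.\<close>

lemma Inter_H: "(\<Inter>n. H n) = {\<one>}"
proof -
  let ?I = "\<Inter>n. H n"
  have I: "?I \<lhd> G" "closedin T ?I"
    using H_open_normal closedin_open_subgroup[OF normal_imp_subgroup]
    by (auto intro!: normal_Inter closedin_Inter)
  have IG: "?I \<subseteq> carrier G" using subgroup.subset[OF normal_imp_subgroup[OF I(1)]] .
  have "lcs (c + 1) ?I \<subseteq> {\<one>}"
  proof
    fix x assume x: "x \<in> lcs (c + 1) ?I"
    then have xG: "x \<in> carrier G" using lower_central_subset_carrier[OF IG] by blast
    have "\<pi> n x = \<pi> n \<one>" for n
    proof -
      interpret E: profinite_epi G T "Hs (Suc n)" "Us (Suc n)" "\<pi> (Suc n)" by (rule \<pi>_epi)
      interpret E': profinite_epi G T "Hs n" "Us n" "\<pi> n" by (rule \<pi>_epi)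
      have "\<pi> (Suc n) x \<in> \<Gamma> (Suc n) (\<pi> (Suc n) ` ?I)"
        using x E.image_lower_central[OF IG] by blast
      also have "\<dots> \<subseteq> \<Gamma> (Suc n) (Q (Suc n))"
        using image_H_Suc[of "Suc n"] by (intro E.G'.lower_central_mono) blast
      also have "\<dots> \<subseteq> kernel (Hs (Suc n)) (Hs n) (\<sigma> n)" by (rule \<Gamma>_Q_subset)
      finally show ?thesis using in_lim(2)[OF xG] by (simp add: kernel_def)
    qed
    then have "x = \<one>" by (rule \<pi>_eqI[OF xG one_closed])
    then show "x \<in> {\<one>}" by simp
  qed
  then show ?thesis using fitting_free_lower_central[OF ff I, of "c + 1"] by simp
qed

lemma ex_kernel_subset:
  assumes K: "K \<lhd> G" "closedin T K" "K \<noteq> {\<one>}"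
  shows "\<exists>n0. kernel G (Hs n0) (\<pi> n0) \<subseteq> K"
proof -
  note sK = normal_imp_subgroup[OF K(1)]
  have KG: "K \<subseteq> carrier G" using subgroup.subset[OF sK] .
  let ?g = "lcs (c + 1) K"
  have "\<not> ?g \<subseteq> {\<one>}" using fitting_free_lower_central[OF ff K(1,2), of "c + 1"] K(3) by auto
  then have "\<not> ?g \<subseteq> (\<Inter>n. H n)" by (simp add: Inter_H)
  then obtain n0 where n0: "\<not> ?g \<subseteq> H n0" by blast
  \<comment> \<open>The subgroups \<open>H n\<close> decrease, so once \<open>?g\<close> escapes
    from one of them it escapes from all later ones.\<close>
  have notH: "\<not> ?g \<subseteq> H n" if "n \<ge> n0" for n using n0 H_antimono[OF that] by blast
  have kernel_sub: "kernel (Hs (Suc n)) (Hs n) (\<sigma> n) \<subseteq> \<pi> (Suc n) ` K" if n: "n \<ge> n0" for n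
  proof -
    interpret E: profinite_epi G T "Hs n" "Us n" "\<pi> n" by (rule \<pi>_epi)
    interpret E1: profinite_epi G T "Hs (Suc n)" "Us (Suc n)" "\<pi> (Suc n)" by (rule \<pi>_epi)
    interpret S: profinite_epi "Hs (Suc n)" "Us (Suc n)" "Hs n" "Us n" "\<sigma> n" by (rule transition_epi)
    have \<pi>K: "\<pi> n ` K \<lhd> Hs n" "closedin (Us n) (\<pi> n ` K)"
      using E.normal_image[OF K(1)] E.closedin_image[OF K(2)] by auto
    have \<Gamma>K: "\<Gamma> n (\<pi> n ` K) = \<pi> n ` ?g" using E.image_lower_central[OF KG] by simp
    \<comment> \<open>Every open normal \<open>N\<close> above the image of \<open>K\<close> has
      \<open>\<Gamma> n N\<close> outside \<open>R n\<close>, so the second alternative holds for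
      each; intersecting over all \<open>N\<close> gives the claim for the closed image.\<close>
    have QK: "\<Gamma> n (Q n) \<subseteq> \<Gamma> n (\<pi> n ` K)"
    proof
      fix x assume x: "x \<in> \<Gamma> n (Q n)"
      show "x \<in> \<Gamma> n (\<pi> n ` K)"
      proof (rule E.G'.lower_central_eq_Inter[OF \<pi>K])
        fix N assume N: "N \<lhd> Hs n" "openin (Us n) N" "\<pi> n ` K \<subseteq> N"
        have "\<not> \<Gamma> n N \<subseteq> R n"
        proof
          assume "\<Gamma> n N \<subseteq> R n"
          then have "\<pi> n ` ?g \<subseteq> R n"
            using E.G'.lower_central_mono[OF N(3), of "c + 1"] \<Gamma>K by simp
          then have "?g \<subseteq> H n" using lower_central_subset_carrier[OF KG] by (force simp: H_def)
          then show False using notH[OF n] by blast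
        qed
        then show "x \<in> \<Gamma> n N" using dichotomy[OF N(1,2)] x by blast
      qed
    qed
    let ?A = "\<Gamma> (Suc n) (R (Suc n))"
    let ?B = "\<Gamma> (Suc n) (\<pi> (Suc n) ` K)"
    let ?M = "max_invariant_core (Hs (Suc n)) (Us (Suc n)) ?A"
    have \<pi>K1: "\<pi> (Suc n) ` K \<lhd> Hs (Suc n)" "closedin (Us (Suc n)) (\<pi> (Suc n) ` K)"
      using E1.normal_image[OF K(1)] E1.closedin_image[OF K(2)] by auto
    have RG: "R (Suc n) \<subseteq> carrier (Hs (Suc n))" using E1.G'.openin_subset_carrier[OF R_open_normal(2)] .
    have Rcl: "closedin (Us (Suc n)) (R (Suc n))"
      using E1.G'.closedin_open_subgroup[OF normal_imp_subgroup[OF R_open_normal(1)] R_open_normal(2)] .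
    have A: "?A \<lhd> Hs (Suc n)" "closedin (Us (Suc n)) ?A"
      using E1.G'.lower_central_normal[OF R_open_normal(1)]
        E1.G'.lower_central_closed_subgroup[OF normal_imp_subgroup[OF R_open_normal(1)] Rcl] by auto
    have B: "?B \<lhd> Hs (Suc n)" "closedin (Us (Suc n)) ?B"
      using E1.G'.lower_central_normal[OF \<pi>K1(1)]
        E1.G'.lower_central_closed_subgroup[OF normal_imp_subgroup[OF \<pi>K1(1)] \<pi>K1(2)] by auto
    have "\<sigma> n ` (\<pi> (Suc n) ` K) = \<pi> n ` K"
      unfolding image_image using in_lim(2) KG by (intro image_cong) auto
    \<comment> \<open>\<open>\<Gamma> n (Q n)\<close> is the image of \<open>?A\<close> under
      \<open>\<sigma> n\<close>; the inclusion can be lifted because the kernel lies in the core of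
      \<open>?A\<close>.\<close>
    then have "\<sigma> n ` ?A \<subseteq> \<sigma> n ` ?B"
      using QK S.image_lower_central[OF RG, of "c + 1"]
        S.image_lower_central[OF subgroup.subset[OF normal_imp_subgroup[OF \<pi>K1(1)]], of "c + 1"] by simp
    then have "?A \<subseteq> ?B"
      using S.subset_if_image_subset[OF A(1) B(1) A(2) B(2) kernel_subset_core] by blast
    then have "?M \<subseteq> ?B" using E1.G'.max_invariant_core_subset by blast
    also have "?B = \<pi> (Suc n) ` ?g" using E1.image_lower_central[OF KG] by simp
    also have "\<dots> \<subseteq> \<pi> (Suc n) ` K" by (intro image_mono lower_central_subset K)
    finally show ?thesis using kernel_subset_core by blast
  qed
  have "x \<in> K" if x: "x \<in> kernel G (Hs n0) (\<pi> n0)" for x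
  proof (rule closed_if_in_all_images[OF K(2)])
    show xG: "x \<in> carrier G" using x by (simp add: kernel_def)
    have low: "\<pi> m x = \<pi> m \<one>" if "m \<le> n0" for m
      using that
    proof (induction rule: inc_induct)
      case base
      interpret E: profinite_epi G T "Hs n0" "Us n0" "\<pi> n0" by (rule \<pi>_epi)
      show ?case using x by (simp add: kernel_def)
    next
      case (step m)
      then show ?case using in_lim(2)[OF xG, of m] in_lim(2)[OF one_closed, of m] by metis
    qed
    \<comment> \<open>Elements with the same image at level \<open>m\<close> differ at level
      \<open>m+1\<close> by an element of the kernel of \<open>\<sigma> m\<close>, which from
      \<open>n0\<close> on lies in the image of \<open>K\<close>.\<close>
    have high: "\<pi> m x \<in> \<pi> m ` K" if "n0 \<le> m" for m
      using that
    proof (induction rule: dec_induct)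
      case base
      then show ?case using low[OF order_refl] subgroup.one_closed[OF sK] by auto
    next
      case (step m)
      interpret E1: profinite_epi G T "Hs (Suc m)" "Us (Suc m)" "\<pi> (Suc m)" by (rule \<pi>_epi)
      interpret E: profinite_epi G T "Hs m" "Us m" "\<pi> m" by (rule \<pi>_epi)
      interpret S: profinite_epi "Hs (Suc m)" "Us (Suc m)" "Hs m" "Us m" "\<sigma> m" by (rule transition_epi)
      obtain k where k: "k \<in> K" "\<pi> m x = \<pi> m k" using step by blast
      have kG: "k \<in> carrier G" using k KG by auto
      have "\<sigma> m (\<pi> (Suc m) (x \<otimes> inv k)) = \<one>\<^bsub>Hs m\<^esub>"
        using in_lim(2)[of "x \<otimes> inv k" m] k(2) xG kG by simp
      then have "\<pi> (Suc m) (x \<otimes> inv k) \<in> kernel (Hs (Suc m)) (Hs m) (\<sigma> m)"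
        using xG kG by (simp add: kernel_def)
      then have "\<pi> (Suc m) (x \<otimes> inv k) \<in> \<pi> (Suc m) ` K" using kernel_sub[of m] step by blast
      then obtain k' where k': "k' \<in> K" "\<pi> (Suc m) (x \<otimes> inv k) = \<pi> (Suc m) k'" by blast
      have k'G: "k' \<in> carrier G" using k' KG by auto
      have "\<pi> (Suc m) x = \<pi> (Suc m) ((x \<otimes> inv k) \<otimes> k)" using xG kG by (simp add: m_assoc)
      also have "\<dots> = \<pi> (Suc m) (k' \<otimes> k)"
        using xG kG k'G k'(2) E1.hom_mult[of "x \<otimes> inv k" k] E1.hom_mult[of k' k] by simp
      finally show ?case using subgroup.m_closed[OF sK k'(1) k(1)] by blast
    qed
    show "\<pi> m x \<in> \<pi> m ` K" for m
    proof (cases "m \<le> n0")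
      case True
      then show ?thesis using low[OF True] subgroup.one_closed[OF sK] by auto
    qed (use high in auto)
  qed
  then show ?thesis by blast
qed

text \<open>An open normal \<open>F\<close> with trivial term of index \<open>c+1\<close> is itself
  trivial by Fitting-freeness, so \<open>G\<close> would be discrete. Then some
  \<open>\<pi> n\<close> is injective, and so is \<open>\<sigma> n\<close>, although its kernel
  contains the non-trivial \<open>\<Gamma> (Suc n) (Q (Suc n))\<close>.\<close>

lemma not_virtually_nilpotent: "\<not> virtually_nilpotent c G T"
proof
  assume "virtually_nilpotent c G T"
  then obtain F where F: "F \<lhd> G" "openin T F" "lcs (c + 1) F = {\<one>}"
    using virtually_nilpotent_alt by auto
  have Fcl: "closedin T F" using closedin_open_subgroup[OF normal_imp_subgroup[OF F(1)] F(2)] .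
  have op1: "openin T {\<one>}"
    using F(2) fitting_free_lower_central[OF ff F(1) Fcl, of "c + 1"] F(3) by simp
  have "\<exists>n. kernel G (Hs n) (\<pi> n) - {\<one>} = {}"
  proof (rule ccontr)
    assume ne: "\<not> ?thesis"
    \<comment> \<open>These sets are closed because \<open>{\<one>}\<close> is open, and they
      decrease; a common point would be a non-trivial element that is trivial at every
      level.\<close>
    let ?C = "\<lambda>n. kernel G (Hs n) (\<pi> n) - {\<one>}"
    have "\<Inter>(range ?C) \<noteq> {}"
    proof (rule compact_space_imp_nest[OF compact])
      show "closedin T (?C n)" for n
        using profinite_epi.kernel_normal_closed(2)[OF \<pi>_epi] op1 by (intro closedin_diff)
      show "?C n \<noteq> {}" for n using ne by blast
      have "?C (Suc n) \<subseteq> ?C n" for n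
      proof -
        interpret S: profinite_epi "Hs (Suc n)" "Us (Suc n)" "Hs n" "Us n" "\<sigma> n" by (rule transition_epi)
        show ?thesis using in_lim(2)[of _ n] by (force simp: kernel_def)
      qed
      then show "antimono_on UNIV ?C" by (rule decseq_SucI)
    qed
    then obtain x where x: "\<And>n. x \<in> ?C n" by blast
    have "x = \<one>"
    proof (rule \<pi>_eqI)
      show "\<pi> n x = \<pi> n \<one>" for n
      proof -
        interpret E: profinite_epi G T "Hs n" "Us n" "\<pi> n" by (rule \<pi>_epi)
        show ?thesis using x[of n] by (simp add: kernel_def)
      qed
    qed (use x in \<open>auto simp: kernel_def\<close>)
    then show False using x by blast
  qed
  then obtain n where n: "kernel G (Hs n) (\<pi> n) \<subseteq> {\<one>}" by blast
  interpret E1: profinite_epi G T "Hs (Suc n)" "Us (Suc n)" "\<pi> (Suc n)" by (rule \<pi>_epi)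
  have "\<Gamma> (Suc n) (Q (Suc n)) \<subseteq> {\<one>\<^bsub>Hs (Suc n)\<^esub>}"
  proof
    fix y assume "y \<in> \<Gamma> (Suc n) (Q (Suc n))"
    then have y: "y \<in> carrier (Hs (Suc n))" "\<sigma> n y = \<one>\<^bsub>Hs n\<^esub>"
      using \<Gamma>_Q_subset[of n] by (auto simp: kernel_def)
    then obtain x where x: "x \<in> carrier G" "y = \<pi> (Suc n) x" using \<pi>_surj by blast
    then have "x \<in> kernel G (Hs n) (\<pi> n)" using y(2) in_lim(2)[OF x(1)] by (simp add: kernel_def)
    then show "y \<in> {\<one>\<^bsub>Hs (Suc n)\<^esub>}" using n x(2) by auto
  qed
  moreover have "\<one>\<^bsub>Hs (Suc n)\<^esub> \<in> \<Gamma> (Suc n) (Q (Suc n))"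
  proof -
    interpret S: profinite_epi "Hs (Suc (Suc n))" "Us (Suc (Suc n))" "Hs (Suc n)" "Us (Suc n)" "\<sigma> (Suc n)"
      by (rule transition_epi)
    show ?thesis
      using E1.G'.lower_central_normal[OF S.normal_image[OF R_open_normal(1)]]
      by (intro subgroup.one_closed normal_imp_subgroup)
  qed
  ultimately show False using \<Gamma>_Q_nontrivial[of "Suc n"] by blast
qed

text \<open>Once the kernel of \<open>\<pi> n\<close> lies in \<open>N\<close>, the group
  \<open>G/N\<close> is a quotient of \<open>Hs n\<close> and inherits virtual nilpotency from
  it.\<close>

lemma JNNF_limit: "JNNF c G T"
  unfolding JNNF_def
proof (intro conjI allI impI profinite_limit_group not_virtually_nilpotent)
  fix N assume N: "N \<lhd> G \<and> closedin T N \<and> N \<noteq> {\<one>}"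
  then obtain n where n: "kernel G (Hs n) (\<pi> n) \<subseteq> N" using ex_kernel_subset by blast
  obtain F where "F \<lhd> G" "openin T F" "lcs (c + 1) F \<subseteq> kernel G (Hs n) (\<pi> n)"
    using vnil profinite_epi.virtually_nilpotent_iff[OF \<pi>_epi] by blast
  then show "virtually_nilpotent c (G Mod N) (quotient_topology G T N)"
    using N n virtually_nilpotent_quotient_iff by blast
qed

end

theorem theorem3p7:
  fixes G :: "('a, 'm) monoid_scheme" and T :: "'a topology" and c :: nat
    and Hs :: "nat \<Rightarrow> ('b, 'n) monoid_scheme" and Us :: "nat \<Rightarrow> 'b topology"
    and \<sigma> :: "nat \<Rightarrow> 'b \<Rightarrow> 'b" and R :: "nat \<Rightarrow> 'b set" and \<pi> :: "nat \<Rightarrow> 'a \<Rightarrow> 'b" and d :: nat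
  shows
    "(profinite_group G T \<and> fin_generated G T \<and> fitting_free G T \<and> JNNF c G T \<longrightarrow>
        (\<exists>(Gs :: nat \<Rightarrow> 'a set monoid) Ts \<rho> p P.
           profinite_inverse_system Gs Ts \<rho> \<and>
           is_inverse_limit G T p Gs Ts \<rho> \<and>
           JNNF_conditions c Gs Ts \<rho> P))
     \<and>
     (d \<ge> 1 \<and>
        profinite_inverse_system Hs Us \<sigma> \<and>
        (\<forall>n. d_generator d (Hs n) (Us n)) \<and>
        is_inverse_limit G T \<pi> Hs Us \<sigma> \<and>
        fitting_free G T \<and>
        JNNF_conditions c Hs Us \<sigma> R \<longrightarrow>
        (\<forall>K. K \<lhd> G \<and> closedin T K \<and> K \<noteq> {\<one>\<^bsub>G\<^esub>} \<longrightarrow>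
           (\<exists>n0. kernel G (Hs n0) (\<pi> n0) \<subseteq> K)) \<and>
        JNNF c G T)"
proof (intro conjI impI)
  assume A: "profinite_group G T \<and> fin_generated G T \<and> fitting_free G T \<and> JNNF c G T"
  then interpret JNNF_group G T c
    by (simp add: JNNF_group_def JNNF_group_axioms_def)
  show "\<exists>(Gs :: nat \<Rightarrow> 'a set monoid) Ts \<rho> p P.
           profinite_inverse_system Gs Ts \<rho> \<and>
           is_inverse_limit G T p Gs Ts \<rho> \<and>
           JNNF_conditions c Gs Ts \<rho> P"
    using inverse_limit_exists A by blast
next
  assume A: "d \<ge> 1 \<and>
        profinite_inverse_system Hs Us \<sigma> \<and>
        (\<forall>n. d_generator d (Hs n) (Us n)) \<and>
        is_inverse_limit G T \<pi> Hs Us \<sigma> \<and>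
        fitting_free G T \<and>
        JNNF_conditions c Hs Us \<sigma> R"
  then interpret JNNF_limit G T \<pi> Hs Us \<sigma> c R
    by (simp add: JNNF_limit_def JNNF_limit_axioms_def profinite_limit_def)
  show "\<forall>K. K \<lhd> G \<and> closedin T K \<and> K \<noteq> {\<one>\<^bsub>G\<^esub>} \<longrightarrow> (\<exists>n0. kernel G (Hs n0) (\<pi> n0) \<subseteq> K)"
    using ex_kernel_subset by blast
  show "JNNF c G T" by (rule JNNF_limit)
qed

end
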